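(* Let $m,n\in\mathbb{N}$, let $p=(t(p),x(p))\in\mathbb{R}^{m+n}$ be fixed, let $\Omega\subset\mathbb{R}^n$ be a non-empty, open and bounded subset, and let $\mathfrak{U}=G\times\Omega$ with $G=\{(t_1,\dots,t_m)\in\mathbb{R}^m: -T<t_i<T,\ 1\leqslant i\leqslant m\}$. Let $T>0$ be sufficiently large (as specified in the context). Let $\mathcal{X}\in C^\infty(\bar{\mathfrak{U}};\mathbb{R}^{m+n})$ vanish identically on $\mathfrak{U}\cap\partial\mathfrak{D}_p$, and let $V\in C^\infty(\bar{\mathfrak{U}})$, $F\in C^\infty(\bar{\mathfrak{U}})$ and $H\in C^\infty(\bar G)$. Let $\Theta_p$ be any neighbourhood of $\bar\Gamma_p$ in $\partial\mathfrak{U}$, let $\sigma>0$, and let $W_p\subset\mathfrak{U}$ be any subset that satisfies $W_p\supset\overline{\mathcal{O}_\sigma(\Gamma_p)}\cap\mathfrak{U}$. Let $z_1,z_2\in C^2(\mathfrak{U})$ be two solutions of the system $$\square z+\nabla_{\mathcal{X}}z+V(t,x)z=F(t,x)\ \text{ in }\mathfrak{U},\qquad z(t,x)=H(t)\ \text{ on }\partial\mathfrak{U}.$$ Then we have the following three cases for uniqueness: (1) If $\mathcal{N}z_1=\mathcal{N}z_2$ on $\Theta_p$, then $z_1=z_2$ on $\mathfrak{U}\cap\mathfrak{D}_p$. (2) If $(z_1,\nabla_t z_1)=(z_2,\nabla_t z_2)$ on $W_p$, then $z_1=z_2$ on $\mathfrak{U}\cap\mathfrak{D}_p$. (3) If $(z_1,\nabla_x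 z_1)=(z_2,\nabla_x z_2)$ on $W_p$, then $z_1=z_2$ on $\mathfrak{U}\cap\mathfrak{D}_p$.
   Context: Coordinates on $\mathbb{R}^{m+n}=\mathbb{R}^m\times\mathbb{R}^n$ are $(t,x)=(t_1,\dots,t_m,x_1,\dots,x_n)$; $\nabla_t z=(\partial_{t_1}z,\dots,\partial_{t_m}z)$, $\nabla_x z=(\partial_{x_1}z,\dots,\partial_{x_n}z)$, $\square=-\sum_{i=1}^m\partial_{t_i}^2+\sum_{j=1}^n\partial_{x_j}^2$, and $\nabla_{\mathcal{X}}z=\mathcal{X}^\alpha\partial_\alpha z$ is the derivative of $z$ along the vector field $\mathcal{X}$. Only the spatial part of the boundary is used, and one writes $\partial\mathfrak{U}:=G\times\partial\Omega$. $\mathcal{N}$ is the outward pointing unit normal of $\mathfrak{U}$, i.e. $\mathcal{N}=\sum_{j=1}^n\nu^{x_j}\partial_{x_j}$ with $\nu^x$ the outward unit normal of $\Omega$. $f_p:=\frac14\left(|x-x(p)|^2-|t-t(p)|^2\right)$ and $\mathfrak{D}_p:=\{f_p>0\}$, with boundary $\partial\mathfrak{D}_p=\{f_p=0\}$. $\Gamma_p:=\partial\mathfrak{U}\cap\mathfrak{D}_p\cap\{\mathcal{N}f_p>0\}$. For $y\in\mathbb{R}^n$ and $\sigma>0$, $\mathcal{O}_\sigma(y):=\{y_1\in\mathbb{R}^n:\|y_1-y\|_{\mathbb{R}^n}<\sigma\}$, and $\mathcal{O}_\sigma(\Gamma_p):=\bigcup_{(\tau,y)\in\Gamma_p}\left(\{\tau\}\times\mathcal{O}_\sigma(y)\right)\subset\mathbb{R}^{m+n}$.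 A solution of the system is a function $z\in C^2(\mathfrak{U})$ satisfying the equation in $\mathfrak{U}$ and the boundary condition on $\partial\mathfrak{U}$. "$T$ sufficiently large": the purpose is that the boundary of $\mathfrak{U}\cap\mathfrak{D}_p$ be made of $\mathfrak{U}\cap\partial\mathfrak{D}_p$ and $\partial\mathfrak{U}\cap\mathfrak{D}_p$, with no contribution from the temporal part of the boundary of $\mathfrak{U}$. In particular, the paper states that the result holds when $T>R$, where $R:=\sup_{\mathfrak{U}\cap\mathfrak{D}_p}|x-x(p)|$.
   Formalization: "T sufficiently large" means the temporal boundary does not meet the boundary of U∩D_p (T>R alone fails if t(p)≠0); Ω is assumed to have C¹ boundary so its outward normal exists, and solutions are C² in U and C¹ up to the spatial boundary so that z=H and Nz make sense there. *)

theory Defs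
  imports "HOL-Analysis.Analysis"
begin

section \<open>Derivatives and differentiability classes\<close>

text \<open>
  All derivatives are taken within a set \<open>S\<close>. For open \<open>S\<close> this is the ordinary derivative; for the
  sets \<open>closure G\<close>, \<open>closure (G \<times> \<Omega>)\<close> and \<open>G \<times> closure \<Omega>\<close> used below, where \<open>G\<close> is an open cube and
  \<open>\<Omega>\<close> a \<open>C\<^sup>1\<close> domain, the derivative within the set is unique, and at boundary points it is
  the continuation of the interior derivative as soon as the function is \<open>C\<^sup>1\<close> up to the boundary.
\<close>

definition dir_deriv ::
    "'a::real_normed_vector set \<Rightarrow> 'a \<Rightarrow> ('a \<Rightarrow> 'b::real_normed_vector) \<Rightarrow> 'a \<Rightarrow> 'b" where
  "dir_deriv S v f q = frechet_derivative f (at q within S) v"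

primrec Ck_on ::
    "nat \<Rightarrow> 'a::real_normed_vector set \<Rightarrow> ('a \<Rightarrow> 'b::real_normed_vector) \<Rightarrow> bool" where
  "Ck_on 0 S f \<longleftrightarrow> continuous_on S f"
| "Ck_on (Suc k) S f \<longleftrightarrow> f differentiable_on S \<and> (\<forall>v. Ck_on k S (dir_deriv S v f))"

definition smooth_on ::
    "'a::real_normed_vector set \<Rightarrow> ('a \<Rightarrow> 'b::real_normed_vector) \<Rightarrow> bool" where
  "smooth_on S f \<longleftrightarrow> (\<forall>k. Ck_on k S f)"

abbreviation e_t :: "'m::finite \<Rightarrow> (real ^ 'm) \<times> (real ^ 'n)" where
  "e_t i \<equiv> (axis i 1, 0)"

abbreviation e_x :: "'n::finite \<Rightarrow> (real ^ 'm) \<times> (real ^ 'n)" where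
  "e_x j \<equiv> (0, axis j 1)"

definition grad_t ::
    "((real ^ 'm) \<times> (real ^ 'n)) set \<Rightarrow> ((real ^ 'm) \<times> (real ^ 'n) \<Rightarrow> real) \<Rightarrow>
      (real ^ 'm) \<times> (real ^ 'n) \<Rightarrow> real ^ 'm" where
  "grad_t S z q = (\<chi> i. dir_deriv S (e_t i) z q)"

definition grad_x ::
    "((real ^ 'm) \<times> (real ^ 'n)) set \<Rightarrow> ((real ^ 'm) \<times> (real ^ 'n) \<Rightarrow> real) \<Rightarrow>
      (real ^ 'm) \<times> (real ^ 'n) \<Rightarrow> real ^ 'n" where
  "grad_x S z q = (\<chi> j. dir_deriv S (e_x j) z q)"

definition ultra_box ::
    "((real ^ 'm) \<times> (real ^ 'n)) set \<Rightarrow> ((real ^ 'm) \<times> (real ^ 'n) \<Rightarrow> real) \<Rightarrow>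
      (real ^ 'm) \<times> (real ^ 'n) \<Rightarrow> real" where
  "ultra_box S z q =
     - (\<Sum>i\<in>UNIV. dir_deriv S (e_t i) (dir_deriv S (e_t i) z) q)
     + (\<Sum>j\<in>UNIV. dir_deriv S (e_x j) (dir_deriv S (e_x j) z) q)"

definition deriv_along ::
    "((real ^ 'm) \<times> (real ^ 'n)) set \<Rightarrow> ((real ^ 'm) \<times> (real ^ 'n) \<Rightarrow> (real ^ 'm) \<times> (real ^ 'n)) \<Rightarrow>
      ((real ^ 'm) \<times> (real ^ 'n) \<Rightarrow> real) \<Rightarrow> (real ^ 'm) \<times> (real ^ 'n) \<Rightarrow> real" where
  "deriv_along S X z q =
     (\<Sum>i\<in>UNIV. fst (X q) $ i * dir_deriv S (e_t i) z q)
     + (\<Sum>j\<in>UNIV. snd (X q) $ j * dir_deriv S (e_x j) z q)"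


section \<open>The domain and its boundary\<close>

definition time_cube :: "real \<Rightarrow> (real ^ 'm) set" where
  "time_cube T = {t. \<forall>i. - T < t $ i \<and> t $ i < T}"

definition cylinder :: "real \<Rightarrow> (real ^ 'n) set \<Rightarrow> ((real ^ 'm) \<times> (real ^ 'n)) set" where
  "cylinder T \<Omega> = time_cube T \<times> \<Omega>"

text \<open>Only the spatial part of the boundary of the cylinder.\<close>

definition lateral :: "real \<Rightarrow> (real ^ 'n) set \<Rightarrow> ((real ^ 'm) \<times> (real ^ 'n)) set" where
  "lateral T \<Omega> = time_cube T \<times> frontier \<Omega>"

text \<open>
  \<open>\<nu>\<close> is the outward unit normal of \<open>\<Omega>\<close> at \<open>y\<close>: near \<open>y\<close> the set \<open>\<Omega>\<close> is the sublevel set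
  \<open>{\<rho> < 0}\<close> of a \<open>C\<^sup>1\<close> function with nonvanishing gradient, and \<open>\<nu>\<close> is the normalised gradient.
  If this holds for some \<open>\<nu>\<close> at each \<open>y \<in> frontier \<Omega>\<close>, then \<open>\<Omega>\<close> has \<open>C\<^sup>1\<close> boundary.
\<close>

definition outward_unit_normal :: "'a::euclidean_space set \<Rightarrow> 'a \<Rightarrow> 'a \<Rightarrow> bool" where
  "outward_unit_normal \<Omega> y \<nu> \<longleftrightarrow>
     (\<exists>B \<rho> D. open B \<and> y \<in> B \<and>
        (\<forall>w\<in>B. (GDERIV \<rho> w :> D w) \<and> D w \<noteq> 0) \<and> continuous_on B D \<and>
        \<Omega> \<inter> B = {w \<in> B. \<rho> w < 0} \<and> \<rho> y = 0 \<and>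
        \<nu> = D y /\<^sub>R norm (D y))"

text \<open>
  The derivative \<open>\<N> z = (\<Sum>j. \<nu>\<^sub>j \<partial>z/\<partial>x\<^sub>j)\<close>, for a given normal field \<open>\<nu>\<close> on \<open>frontier \<Omega>\<close>.
\<close>

definition normal_deriv ::
    "((real ^ 'm) \<times> (real ^ 'n)) set \<Rightarrow> (real ^ 'n \<Rightarrow> real ^ 'n) \<Rightarrow>
      ((real ^ 'm) \<times> (real ^ 'n) \<Rightarrow> real) \<Rightarrow> (real ^ 'm) \<times> (real ^ 'n) \<Rightarrow> real" where
  "normal_deriv S \<nu> z q = (\<Sum>j\<in>UNIV. \<nu> (snd q) $ j * dir_deriv S (e_x j) z q)"


section \<open>The exterior of the null cone of \<open>p\<close>\<close>

definition cone_fun ::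
    "(real ^ 'm) \<times> (real ^ 'n) \<Rightarrow> (real ^ 'm) \<times> (real ^ 'n) \<Rightarrow> real" where
  "cone_fun p q = ((norm (snd q - snd p))\<^sup>2 - (norm (fst q - fst p))\<^sup>2) / 4"

definition cone_ext :: "(real ^ 'm) \<times> (real ^ 'n) \<Rightarrow> ((real ^ 'm) \<times> (real ^ 'n)) set" where
  "cone_ext p = {q. cone_fun p q > 0}"

definition cone_bd :: "(real ^ 'm) \<times> (real ^ 'n) \<Rightarrow> ((real ^ 'm) \<times> (real ^ 'n)) set" where
  "cone_bd p = {q. cone_fun p q = 0}"

definition obs_bd ::
    "real \<Rightarrow> (real ^ 'n) set \<Rightarrow> (real ^ 'n \<Rightarrow> real ^ 'n) \<Rightarrow> (real ^ 'm) \<times> (real ^ 'n) \<Rightarrow>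
      ((real ^ 'm) \<times> (real ^ 'n)) set" where
  "obs_bd T \<Omega> \<nu> p =
     lateral T \<Omega> \<inter> cone_ext p \<inter> {q. normal_deriv UNIV \<nu> (cone_fun p) q > 0}"

definition space_nbhd ::
    "real \<Rightarrow> ((real ^ 'm) \<times> (real ^ 'n)) set \<Rightarrow> ((real ^ 'm) \<times> (real ^ 'n)) set" where
  "space_nbhd \<sigma> \<Gamma> = (\<Union>(\<tau>, y)\<in>\<Gamma>. {\<tau>} \<times> ball y \<sigma>)"

definition nbhd_in :: "'a::topological_space set \<Rightarrow> 'a set \<Rightarrow> 'a set \<Rightarrow> bool" where
  "nbhd_in M A \<Theta> \<longleftrightarrow> \<Theta> \<subseteq> M \<and> (\<exists>Q. openin (top_of_set M) Q \<and> A \<subseteq> Q \<and> Q \<subseteq> \<Theta>)"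

text \<open>
  \<open>T\<close> is sufficiently large when the temporal part \<open>frontier G \<times> closure \<Omega>\<close> of the boundary of the
  cylinder contributes nothing to the boundary of the part of the cylinder outside the null cone of
  \<open>p\<close>. Since the cube \<open>G\<close> is centred at the origin and not at \<open>t(p)\<close>, the bound \<open>T > R\<close> gives this
  only for \<open>t(p) = 0\<close>; in general it has to be read as \<open>T > R + \<bar>t\<^sub>i(p)\<bar>\<close> for all \<open>i\<close>.
\<close>

definition T_large :: "real \<Rightarrow> (real ^ 'n) set \<Rightarrow> (real ^ 'm) \<times> (real ^ 'n) \<Rightarrow> bool" where
  "T_large T \<Omega> p \<longleftrightarrow>
     frontier (cylinder T \<Omega> \<inter> cone_ext p) \<inter> (frontier (time_cube T) \<times> closure \<Omega>) = {}"

lemma T_large_if_radius: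
  fixes p :: "(real ^ 'm) \<times> (real ^ 'n)" and \<Omega> :: "(real ^ 'n) set" and T :: real
  defines "R \<equiv> (SUP q\<in>cylinder T \<Omega> \<inter> cone_ext p. norm (snd q - snd p))"
  assumes "bounded \<Omega>" and "\<And>i. \<bar>fst p $ i\<bar> + R < T"
  shows "T_large T \<Omega> p"
proof -
  let ?A = "cylinder T \<Omega> \<inter> cone_ext p"
  obtain b where b: "\<And>x. x \<in> \<Omega> \<Longrightarrow> norm x \<le> b"
    using assms(2) by (auto simp: bounded_iff)
  have bdd: "bdd_above ((\<lambda>q. norm (snd q - snd p)) ` ?A)"
  proof (rule bdd_aboveI2)
    fix q assume "q \<in> ?A"
    then have "norm (snd q) \<le> b" by (auto simp: cylinder_def intro: b)
    then show "norm (snd q - snd p) \<le> b + norm (snd p)"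
      using norm_triangle_ineq4[of "snd q" "snd p"] by linarith
  qed
  have "norm (fst q - fst p) \<le> R" if q: "q \<in> ?A" for q
  proof -
    have *: "a \<le> b" if "0 < (b\<^sup>2 - a\<^sup>2) / 4" "0 \<le> b" for a b :: real
      using that by (auto intro: power2_le_imp_le)
    have "0 < cone_fun p q" using q by (simp add: cone_ext_def)
    then have "norm (fst q - fst p) \<le> norm (snd q - snd p)"
      unfolding cone_fun_def by (rule *) (rule norm_ge_zero)
    also have "\<dots> \<le> R" unfolding R_def by (rule cSUP_upper[OF q bdd])
    finally show ?thesis .
  qed
  then have "?A \<subseteq> {q. norm (fst q - fst p) \<le> R}" by blast
  moreover have "closed {q. norm (fst q - fst p) \<le> R}"
    by (intro closed_Collect_le continuous_intros)
  ultimately have le: "closure ?A \<subseteq> {q. norm (fst q - fst p) \<le> R}"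
    by (rule closure_minimal)
  have op: "open (time_cube T :: (real ^ 'm) set)"
  proof -
    have "time_cube T = box (\<chi> i::'m. - T) (\<chi> i. T)"
      by (auto simp: time_cube_def mem_box_cart)
    then show ?thesis by (simp only: open_box)
  qed
  have "fst q \<in> time_cube T" if "q \<in> closure ?A" for q
  proof -
    have "\<bar>fst q $ i\<bar> < T" for i
    proof -
      have "\<bar>(fst q - fst p) $ i\<bar> \<le> R"
        using component_le_norm_cart[of "fst q - fst p" i] le that by fastforce
      then show ?thesis using assms(3)[of i] by simp
    qed
    then show ?thesis by (auto simp: time_cube_def abs_less_iff minus_less_iff)
  qed
  then show ?thesis
    unfolding T_large_def frontier_def interior_open[OF op] by fastforce
qed


section \<open>Solutions\<close>

text \<open>
  \<open>C\<^sup>2\<close> in the open cylinder, and \<open>C\<^sup>1\<close> up to its spatial boundary, so that the boundary values and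
  the normal derivative there are meaningful.
\<close>

definition is_solution ::
    "real \<Rightarrow> (real ^ 'n) set \<Rightarrow> ((real ^ 'm) \<times> (real ^ 'n) \<Rightarrow> (real ^ 'm) \<times> (real ^ 'n)) \<Rightarrow>
      ((real ^ 'm) \<times> (real ^ 'n) \<Rightarrow> real) \<Rightarrow> ((real ^ 'm) \<times> (real ^ 'n) \<Rightarrow> real) \<Rightarrow>
      (real ^ 'm \<Rightarrow> real) \<Rightarrow> ((real ^ 'm) \<times> (real ^ 'n) \<Rightarrow> real) \<Rightarrow> bool" where
  "is_solution T \<Omega> X V F H z \<longleftrightarrow>
     Ck_on 2 (cylinder T \<Omega>) z \<and> Ck_on 1 (time_cube T \<times> closure \<Omega>) z \<and>
     (\<forall>q\<in>cylinder T \<Omega>.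
        ultra_box (cylinder T \<Omega>) z q + deriv_along (cylinder T \<Omega>) X z q + V q * z q = F q) \<and>
     (\<forall>(t, y)\<in>lateral T \<Omega>. z (t, y) = H t)"

end

theory Submission
  imports Defs
begin

text \<open>
  Let \<open>w\<close> be the difference of the two solutions and put \<open>p = 0\<close>. Only the vanishing of the normal
  derivative of \<open>w\<close> on \<open>\<Gamma>\<^sub>p\<close> is needed, and each of the three observations gives it.

  For \<open>0 < c < 1\<close> the weight \<open>\<theta> = |x|\<^sup>2 - c |t|\<^sup>2 - (1 - c) R\<^sup>2\<close>, with \<open>R > |x|\<close> on the closure of \<open>\<Omega>\<close>,
  is strictly pseudoconvex for \<open>\<box>\<close>, in contrast to \<open>f\<^sub>p\<close>, so that arbitrary lower-order terms can be
  absorbed. The set \<open>{\<theta> \<ge> 0}\<close> stays inside \<open>\<D>\<^sub>p\<close>, and the sets \<open>{\<theta> > 0}\<close> exhaust \<open>\<D>\<^sub>p\<close> as \<open>c\<close> tends to 1.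
  Multiplying the operator conjugated by \<open>exp (s \<theta>)\<close> by its skew part gives
  \<open>Q - A B = div P\<close> with \<open>Q\<close> positive definite in \<open>v = max 0 \<theta> ^ 3 exp (s \<theta>) w\<close> and its gradient.
  Since \<open>w\<close> vanishes on the lateral boundary, the normal component of \<open>P\<close> there has the sign of
  \<open>(\<N> f\<^sub>p) (\<N> w)\<^sup>2\<close>, which is nonpositive. Hence the integral of \<open>div P\<close> is nonpositive, and this is
  contradicted for large \<open>s\<close> if \<open>w\<close> is nonzero somewhere in \<open>{\<theta> > 0}\<close>.
\<close>


section \<open>Second derivatives and integrals of derivatives\<close>

text \<open>The obstacle is regularity: the difference of two solutions is \<open>C^2\<close> only
  inside and \<open>C^1\<close> up to the lateral boundary, so its second derivatives may be
  unbounded there. By symmetry of the Hessian, however, div P contains them only through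
  \<open>ultra_box\<close>, which the equation bounds by first-order terms. Hence P is continuous up
  to the boundary with bounded divergence, and the divergence inequality is stated for such fields.
  The multiplier contains a free constant \<kappa>; the gradient part of Q is positive definite
  exactly for \<kappa> between 4 c and 4. This interval is empty for c = 1, which is why
  \<open>f_p\<close> itself fails as a weight. The cube of max 0 \<theta> serves as the cut-off: v
  is \<open>C^2\<close> across \<theta> = 0 and no boundary term arises there. The price is an error
  that cannot be absorbed where \<theta> is small. It is of order s^2 exp (2 s \<delta>), whereas
  near a point with \<theta> = 3 \<delta> and nonzero w the divergence is at least of order s^3 exp
  (4 s \<delta>).\<close>

lemma second_difference_estimate:
  fixes v :: "'a::euclidean_space \<Rightarrow> real" and a :: "'a \<Rightarrow> 'a"
  assumes v: "\<And>x. x \<in> ball q r \<Longrightarrow> (v has_derivative (\<lambda>h. a x \<bullet> h)) (at x)"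
    and lin: "linear H"
    and H: "\<And>x. x \<in> ball q r \<Longrightarrow> norm (a x - a q - H (x - q)) \<le> e * norm (x - q)"
    and "0 \<le> e" "0 < h" "h * (norm b + norm c) < r"
  shows "\<bar>v (q + h *\<^sub>R b + h *\<^sub>R c) - v (q + h *\<^sub>R b) - v (q + h *\<^sub>R c) + v q - h\<^sup>2 * (H c \<bullet> b)\<bar>
           \<le> h\<^sup>2 * (2 * e * (norm b + norm c)\<^sup>2)"
proof -
  let ?N = "norm b + norm c"
  have near: "norm (\<tau> *\<^sub>R h *\<^sub>R b + \<sigma> *\<^sub>R h *\<^sub>R c) \<le> h * ?N" if "0 \<le> \<tau>" "\<tau> \<le> 1" "0 \<le> \<sigma>" "\<sigma> \<le> 1" for \<tau> \<sigma>
  proof -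
    have "norm (\<tau> *\<^sub>R h *\<^sub>R b + \<sigma> *\<^sub>R h *\<^sub>R c) \<le> \<tau> * (h * norm b) + \<sigma> * (h * norm c)"
      by (rule norm_triangle_le) (use that \<open>0 < h\<close> in simp)
    also have "\<dots> \<le> 1 * (h * norm b) + 1 * (h * norm c)"
      by (intro add_mono mult_right_mono) (use that \<open>0 < h\<close> in auto)
    finally show ?thesis by (simp add: algebra_simps)
  qed
  have inb: "q + \<tau> *\<^sub>R h *\<^sub>R b + \<sigma> *\<^sub>R h *\<^sub>R c \<in> ball q r" if "0 \<le> \<tau>" "\<tau> \<le> 1" "0 \<le> \<sigma>" "\<sigma> \<le> 1" for \<tau> \<sigma>
  proof -
    have "dist q (q + \<tau> *\<^sub>R h *\<^sub>R b + \<sigma> *\<^sub>R h *\<^sub>R c) = norm (\<tau> *\<^sub>R h *\<^sub>R b + \<sigma> *\<^sub>R h *\<^sub>R c)"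
      by (metis add.assoc add_diff_cancel_left' dist_norm norm_minus_commute)
    then show ?thesis using near[OF that] assms(6) by simp
  qed
  \<comment> \<open>The increment in direction \<open>c\<close> as a function of the position along
    \<open>b\<close>. Its derivative is a difference of two gradients, so one use of the mean value
    theorem reduces the second difference to the first-order expansion of \<open>a\<close> at
    \<open>q\<close>.\<close>
  define F where "F \<tau> = v (q + \<tau> *\<^sub>R h *\<^sub>R b + h *\<^sub>R c) - v (q + \<tau> *\<^sub>R h *\<^sub>R b)" for \<tau>
  define F' where "F' \<tau> = a (q + \<tau> *\<^sub>R h *\<^sub>R b + h *\<^sub>R c) \<bullet> (h *\<^sub>R b) - a (q + \<tau> *\<^sub>R h *\<^sub>R b) \<bullet> (h *\<^sub>R b)" for \<tau>
  have "(F has_real_derivative F' \<tau>) (at \<tau>)" if "0 \<le> \<tau>" "\<tau> \<le> 1" for \<tau>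
  proof -
    have 1: "(v has_derivative (\<lambda>k. a (q + \<tau> *\<^sub>R h *\<^sub>R b + h *\<^sub>R c) \<bullet> k)) (at (q + \<tau> *\<^sub>R h *\<^sub>R b + h *\<^sub>R c))"
      using v[OF inb[OF that, of 1]] by simp
    have 2: "(v has_derivative (\<lambda>k. a (q + \<tau> *\<^sub>R h *\<^sub>R b) \<bullet> k)) (at (q + \<tau> *\<^sub>R h *\<^sub>R b))"
      using v[OF inb[OF that, of 0]] by simp
    have g1: "((\<lambda>\<tau>. q + \<tau> *\<^sub>R h *\<^sub>R b + h *\<^sub>R c) has_derivative (\<lambda>k. k *\<^sub>R h *\<^sub>R b)) (at \<tau>)"
      by (auto intro!: derivative_eq_intros)
    have g2: "((\<lambda>\<tau>. q + \<tau> *\<^sub>R h *\<^sub>R b) has_derivative (\<lambda>k. k *\<^sub>R h *\<^sub>R b)) (at \<tau>)"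
      by (auto intro!: derivative_eq_intros)
    have "(F has_derivative (\<lambda>k. a (q + \<tau> *\<^sub>R h *\<^sub>R b + h *\<^sub>R c) \<bullet> (k *\<^sub>R h *\<^sub>R b) - a (q + \<tau> *\<^sub>R h *\<^sub>R b) \<bullet> (k *\<^sub>R h *\<^sub>R b))) (at \<tau>)"
      unfolding F_def
      by (rule has_derivative_diff) (rule has_derivative_compose[OF g1 1], rule has_derivative_compose[OF g2 2])
    moreover have "(\<lambda>k. a (q + \<tau> *\<^sub>R h *\<^sub>R b + h *\<^sub>R c) \<bullet> (k *\<^sub>R h *\<^sub>R b) - a (q + \<tau> *\<^sub>R h *\<^sub>R b) \<bullet> (k *\<^sub>R h *\<^sub>R b)) = (\<lambda>k. F' \<tau> * k)"
      by (simp add: fun_eq_iff F'_def algebra_simps)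
    ultimately show ?thesis unfolding has_field_derivative_def by simp
  qed
  then have "\<exists>z>0. z < 1 \<and> F 1 - F 0 = (1 - 0) * F' z" by (intro MVT2) auto
  then obtain z where z: "0 < z" "z < 1" and eq: "F 1 - F 0 = F' z" by auto
  let ?x = "q + z *\<^sub>R h *\<^sub>R b + h *\<^sub>R c" and ?y = "q + z *\<^sub>R h *\<^sub>R b"
  have nx: "norm (?x - q) \<le> h * ?N" using near[of z 1] z by (simp add: algebra_simps)
  have ny: "norm (?y - q) \<le> h * ?N" using near[of z 0] z by simp
  have ex: "norm (a ?x - a q - H (?x - q)) \<le> e * (h * ?N)"
    using H[OF inb[of z 1]] z nx mult_left_mono[OF nx \<open>0 \<le> e\<close>] by simp
  have ey: "norm (a ?y - a q - H (?y - q)) \<le> e * (h * ?N)"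
    using H[OF inb[of z 0]] z ny mult_left_mono[OF ny \<open>0 \<le> e\<close>] by simp
  have Hxy: "H (?x - q) - H (?y - q) = h *\<^sub>R H c"
    by (simp add: linear_diff[OF lin, symmetric] linear_scale[OF lin, symmetric])
  have "a ?x - a ?y - h *\<^sub>R H c = (a ?x - a q - H (?x - q)) - (a ?y - a q - H (?y - q))"
    unfolding Hxy[symmetric] by simp
  then have "norm (a ?x - a ?y - h *\<^sub>R H c) = norm ((a ?x - a q - H (?x - q)) - (a ?y - a q - H (?y - q)))"
    by (rule arg_cong)
  then have d: "norm (a ?x - a ?y - h *\<^sub>R H c) \<le> 2 * (e * (h * ?N))"
    using norm_triangle_ineq4[of "a ?x - a q - H (?x - q)" "a ?y - a q - H (?y - q)"] ex ey by linarith
  have "F 1 - F 0 - h\<^sup>2 * (H c \<bullet> b) = h * ((a ?x - a ?y - h *\<^sub>R H c) \<bullet> b)"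
    unfolding eq F'_def by (simp add: inner_diff_left algebra_simps power2_eq_square)
  also have "\<bar>\<dots>\<bar> \<le> h * (norm (a ?x - a ?y - h *\<^sub>R H c) * norm b)"
    using \<open>0 < h\<close> Cauchy_Schwarz_ineq2 by (simp add: abs_mult)
  also have "\<dots> \<le> h * ((2 * (e * (h * ?N))) * ?N)"
    using \<open>0 < h\<close> d \<open>0 \<le> e\<close> by (intro mult_left_mono mult_mono) auto
  finally show ?thesis by (simp add: F_def algebra_simps power2_eq_square)
qed

text \<open>The second difference does not change when \<open>b\<close> and \<open>c\<close> are
  swapped, and divided by \<open>h^2\<close> it approximates both \<open>H c \<bullet> b\<close> and
  \<open>H b \<bullet> c\<close> up to any prescribed error. Used to cancel the pure
  second-derivative terms in the divergence of the Carleman field.\<close>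

lemma hessian_symmetric:
  fixes v :: "'a::euclidean_space \<Rightarrow> real" and a :: "'a \<Rightarrow> 'a"
  assumes "open U" "q \<in> U"
    and v: "\<And>x. x \<in> U \<Longrightarrow> (v has_derivative (\<lambda>h. a x \<bullet> h)) (at x)"
    and H: "(a has_derivative H) (at q)"
  shows "H b \<bullet> c = H c \<bullet> b"
proof -
  let ?N = "norm b + norm c"
  have lin: "linear H" using H has_derivative_linear by blast
  have "\<bar>H c \<bullet> b - H b \<bullet> c\<bar> \<le> e * (4 * ?N\<^sup>2)" if e: "0 < e" for e
  proof -
    obtain r0 where r0: "0 < r0" "ball q r0 \<subseteq> U" using assms(1,2) open_contains_ball by blast
    obtain d where d: "0 < d" "\<And>x. norm (x - q) < d \<Longrightarrow> norm (a x - a q - H (x - q)) \<le> e * norm (x - q)"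
      using H e unfolding has_derivative_at_alt by blast
    define r where "r = min r0 d"
    define h where "h = r / (2 * (?N + 1))"
    have rp: "0 < r" using r0 d by (simp add: r_def)
    have Np: "0 < ?N + 1" by (simp add: add_nonneg_pos)
    have hp: "0 < h" using rp Np by (simp add: h_def)
    have hN: "h * ?N < r"
    proof -
      have "h * ?N \<le> h * (?N + 1)" using hp by simp
      also have "\<dots> = r / 2" using Np unfolding h_def by (simp add: field_simps)
      finally show ?thesis using rp by simp
    qed
    have 1: "(v has_derivative (\<lambda>h. a x \<bullet> h)) (at x)" if "x \<in> ball q r" for x
      using that r0 by (intro v) (auto simp: r_def)
    have 2: "norm (a x - a q - H (x - q)) \<le> e * norm (x - q)" if "x \<in> ball q r" for x
      using that by (intro d) (auto simp: r_def dist_norm norm_minus_commute)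
    have A: "\<bar>v (q + h *\<^sub>R b + h *\<^sub>R c) - v (q + h *\<^sub>R b) - v (q + h *\<^sub>R c) + v q - h\<^sup>2 * (H c \<bullet> b)\<bar>
           \<le> h\<^sup>2 * (2 * e * ?N\<^sup>2)"
      using second_difference_estimate[OF 1 lin 2 _ hp hN] e by simp
    have B: "\<bar>v (q + h *\<^sub>R c + h *\<^sub>R b) - v (q + h *\<^sub>R c) - v (q + h *\<^sub>R b) + v q - h\<^sup>2 * (H b \<bullet> c)\<bar>
           \<le> h\<^sup>2 * (2 * e * (norm c + norm b)\<^sup>2)"
      using second_difference_estimate[OF 1 lin 2 _ hp, where b = c and c = b] e hN by (simp add: add.commute)
    have "q + h *\<^sub>R c + h *\<^sub>R b = q + h *\<^sub>R b + h *\<^sub>R c" by simp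
    with A B have "\<bar>h\<^sup>2 * (H c \<bullet> b) - h\<^sup>2 * (H b \<bullet> c)\<bar> \<le> h\<^sup>2 * (4 * e * ?N\<^sup>2)"
      by (simp add: add.commute[of "norm c"])
    moreover have "\<bar>h\<^sup>2 * (H c \<bullet> b) - h\<^sup>2 * (H b \<bullet> c)\<bar> = h\<^sup>2 * \<bar>H c \<bullet> b - H b \<bullet> c\<bar>"
      by (simp add: right_diff_distrib[symmetric] abs_mult)
    ultimately have "h\<^sup>2 * \<bar>H c \<bullet> b - H b \<bullet> c\<bar> \<le> h\<^sup>2 * (e * (4 * ?N\<^sup>2))"
      by (simp add: mult_ac)
    then show ?thesis using hp by simp
  qed
  then have "((\<lambda>e. e * (4 * ?N\<^sup>2)) \<longlongrightarrow> 0 * (4 * ?N\<^sup>2)) (at_right 0) \<Longrightarrow> \<bar>H c \<bullet> b - H b \<bullet> c\<bar> \<le> 0 * (4 * ?N\<^sup>2)"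
    by (intro tendsto_lowerbound) (auto simp: eventually_at_right_less eventually_at_filter)
  moreover have "((\<lambda>e. e * (4 * ?N\<^sup>2)) \<longlongrightarrow> 0 * (4 * ?N\<^sup>2)) (at_right 0)" by (intro tendsto_intros)
  ultimately show ?thesis by simp
qed

text \<open>Translation invariance makes the integral of every difference quotient vanish, and
  dominated convergence passes to the derivative. No iterated integration along coordinates is
  involved.\<close>

lemma integral_partial_derivative_eq_0:
  fixes g :: "'a::euclidean_space \<Rightarrow> real"
  assumes g: "\<And>x. (g has_derivative g' x) (at x)"
    and cont: "continuous_on UNIV (\<lambda>x. g' x b)"
    and K: "compact (K :: 'a set)" "\<And>x. x \<notin> K \<Longrightarrow> g x = 0"
  shows "integrable lborel (\<lambda>x. g' x b)" "(LINT x|lborel. g' x b) = 0"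
proof -
  have gc: "continuous_on UNIV g"
    using g has_derivative_continuous by (metis continuous_at_imp_continuous_on)
  have intg: "integrable lborel g"
  proof -
    have "integrable lborel (\<lambda>x. indicator K x *\<^sub>R g x)"
      using borel_integrable_compact[OF K(1) continuous_on_subset[OF gc]] by auto
    also have "(\<lambda>x. indicator K x *\<^sub>R g x) = g" using K(2) by (auto simp: fun_eq_iff indicator_def)
    finally show ?thesis .
  qed
  have g'0: "g' x b = 0" if "x \<notin> K" for x
  proof -
    have "open (- K)" using K(1) compact_imp_closed by auto
    then have "((\<lambda>_. 0) has_derivative g' x) (at x)"
      using that K(2) by (intro has_derivative_transform_within_open[OF g[of x], of "- K"]) auto
    then have "g' x = (\<lambda>_. 0)" by (rule has_derivative_unique) (rule has_derivative_const)
    then show ?thesis by simp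
  qed
  have intg': "integrable lborel (\<lambda>x. g' x b)"
  proof -
    have "integrable lborel (\<lambda>x. indicator K x *\<^sub>R g' x b)"
      using borel_integrable_compact[OF K(1) continuous_on_subset[OF cont]] by auto
    also have "(\<lambda>x. indicator K x *\<^sub>R g' x b) = (\<lambda>x. g' x b)" using g'0 by (auto simp: fun_eq_iff indicator_def)
    finally show ?thesis .
  qed
  then show "integrable lborel (\<lambda>x. g' x b)" .
  \<comment> \<open>The points from which the segment to \<open>x + b\<close> meets
    \<open>K\<close>. All difference quotients vanish off this one compact set, so a multiple of its
    indicator dominates them.\<close>
  define K1 where "K1 = {x - y |x y. x \<in> K \<and> y \<in> (\<lambda>t. t *\<^sub>R b) ` {0..1::real}}"
  have K1: "compact K1" unfolding K1_def
    by (intro compact_differences K(1) compact_continuous_image continuous_intros) auto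
  obtain M where M: "\<And>x. \<bar>g' x b\<bar> \<le> M" and M0: "0 \<le> M"
  proof -
    have "bounded ((\<lambda>x. g' x b) ` K)"
      by (intro compact_imp_bounded compact_continuous_image continuous_on_subset[OF cont] K) auto
    then obtain M where "\<And>x. x \<in> K \<Longrightarrow> \<bar>g' x b\<bar> \<le> M" unfolding bounded_iff by auto
    then have "\<bar>g' x b\<bar> \<le> \<bar>M\<bar>" for x
      by (cases "x \<in> K") (auto simp: g'0 intro: order_trans[OF _ abs_ge_self])
    then show ?thesis using that[of "\<bar>M\<bar>"] by auto
  qed
  define D where "D n x = (g (x + (1 / Suc n) *\<^sub>R b) - g x) * Suc n" for n x
  have mvt: "\<exists>z. 0 < z \<and> z < 1 / Suc n \<and> D n x = g' (x + z *\<^sub>R b) b" for n x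
  proof -
    have "((\<lambda>\<tau>. g (x + \<tau> *\<^sub>R b)) has_real_derivative g' (x + \<tau> *\<^sub>R b) b) (at \<tau>)" for \<tau>
    proof -
      have "((\<lambda>\<tau>. x + \<tau> *\<^sub>R b) has_derivative (\<lambda>k. k *\<^sub>R b)) (at \<tau>)"
        by (auto intro!: derivative_eq_intros)
      from has_derivative_compose[OF this g[of "x + \<tau> *\<^sub>R b"]]
      show ?thesis unfolding has_field_derivative_def
        using linear_scale[OF has_derivative_linear[OF g]] by (simp add: mult_commute_abs)
    qed
    then have "\<exists>z>0. z < 1 / Suc n \<and> g (x + (1 / Suc n) *\<^sub>R b) - g (x + 0 *\<^sub>R b) = (1 / Suc n - 0) * g' (x + z *\<^sub>R b) b"
      by (intro MVT2) auto
    then show ?thesis unfolding D_def by (auto simp: field_simps)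
  qed
  have Dle: "norm (D n x) \<le> M * indicator K1 x" for n x
  proof (cases "x \<in> K1")
    case True
    then show ?thesis using mvt[of n x] M by auto
  next
    case False
    have "x + t *\<^sub>R b \<notin> K" if "0 \<le> t" "t \<le> 1" for t
      using False that unfolding K1_def by force
    from this[of 0] this[of "1 / Suc n"] have "D n x = 0" using K(2) unfolding D_def by simp
    then show ?thesis using M0 by simp
  qed
  have Dlim: "(\<lambda>n. D n x) \<longlonglongrightarrow> g' x b" for x
  proof -
    have "\<forall>n. \<exists>z. 0 < z \<and> z < 1 / Suc n \<and> D n x = g' (x + z *\<^sub>R b) b" using mvt by blast
    then obtain z where z: "\<And>n. 0 < z n \<and> z n < 1 / Suc n \<and> D n x = g' (x + z n *\<^sub>R b) b"
      using choice[of "\<lambda>n z. 0 < z \<and> z < 1 / Suc n \<and> D n x = g' (x + z *\<^sub>R b) b"] by blast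
    have "(\<lambda>n. 1 / real (Suc n)) \<longlonglongrightarrow> 0" using LIMSEQ_inverse_real_of_nat by (simp add: divide_inverse)
    then have "z \<longlonglongrightarrow> 0"
      by (rule tendsto_sandwich[OF _ _ tendsto_const, rotated 2])
        (use z in \<open>auto simp: less_imp_le simp del: of_nat_Suc\<close>)
    then have "(\<lambda>n. x + z n *\<^sub>R b) \<longlonglongrightarrow> x + 0 *\<^sub>R b" by (intro tendsto_intros)
    then have "(\<lambda>n. x + z n *\<^sub>R b) \<longlonglongrightarrow> x" by simp
    then have "(\<lambda>n. g' (x + z n *\<^sub>R b) b) \<longlonglongrightarrow> g' x b"
      using cont continuous_on_tendsto_compose[OF cont] by simp
    then show ?thesis using z by simp
  qed
  have shift: "integrable lborel (\<lambda>x. g (x + c))" "(LINT x|lborel. g (x + c)) = (LINT x|lborel. g x)" for c :: 'a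
  proof -
    have [measurable]: "g \<in> borel_measurable borel" using gc by (rule borel_measurable_continuous_onI)
    have e: "distr lborel borel (\<lambda>x. c + x) = lborel"
      using lborel_affine[where c = 1 and t = c] by (simp add: density_1)
    have "integrable (distr lborel borel (\<lambda>x. c + x)) g" unfolding e by (rule intg)
    then show "integrable lborel (\<lambda>x. g (x + c))"
      by (subst (asm) integrable_distr_eq) (auto simp: add.commute)
    have "(LINT x|distr lborel borel (\<lambda>x. c + x). g x) = (LINT x|lborel. g (c + x))"
      by (rule integral_distr) auto
    then show "(LINT x|lborel. g (x + c)) = (LINT x|lborel. g x)" unfolding e by (simp add: add.commute)
  qed
  have "(LINT x|lborel. D n x) = 0" for n
    unfolding D_def using shift intg by simp
  moreover have "(\<lambda>n. LINT x|lborel. D n x) \<longlonglongrightarrow> (LINT x|lborel. g' x b)"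
  proof (rule integral_dominated_convergence[where w = "\<lambda>x. M * indicator K1 x"])
    show "integrable lborel (\<lambda>x. M * indicator K1 x)"
      using K1 emeasure_compact_finite[OF K1] compact_imp_closed[OF K1]
      by (intro integrable_mult_right integrable_real_indicator) auto
    show "D n \<in> borel_measurable lborel" for n
      unfolding D_def using shift intg by measurable
    show "(\<lambda>x. g' x b) \<in> borel_measurable lborel" using intg' by simp
  qed (use Dlim Dle in auto)
  ultimately show "(LINT x|lborel. g' x b) = 0" by (simp add: LIMSEQ_const_iff)
qed



section \<open>A one-sided divergence theorem\<close>

lemma DERIV_max_0_power2: "((\<lambda>x. (max 0 x)\<^sup>2) has_real_derivative 2 * max 0 x) (at x)"
proof (cases "x = 0")
  case True
  have "((\<lambda>h. max 0 h) \<longlongrightarrow> max 0 0) (at (0::real))"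
    by (intro tendsto_intros)
  \<comment> \<open>At 0 the difference quotient is \<open>max 0 h\<close> itself.\<close>
  then have "((\<lambda>h. ((max 0 (0 + h))\<^sup>2 - (max 0 0)\<^sup>2) / h) \<longlongrightarrow> 0) (at (0::real))"
    by (rule tendsto_eq_rhs[OF Lim_transform_eventually])
       (auto simp: eventually_at_filter power2_eq_square max_def)
  then show ?thesis using True by (simp add: DERIV_def)
next
  case False
  consider "x < 0" | "x > 0" using False by linarith
  then show ?thesis
  proof cases
    case 1
    have "((\<lambda>x::real. 0) has_real_derivative 2 * max 0 x) (at x)" using 1 by simp
    then show ?thesis
      by (rule has_field_derivative_transform_within_open[of _ _ _ "{..<0}"]) (use 1 in auto)
  next
    case 2
    have "((\<lambda>x::real. x\<^sup>2) has_real_derivative 2 * max 0 x) (at x)"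
      using 2 by (auto intro!: derivative_eq_intros)
    then show ?thesis
      by (rule has_field_derivative_transform_within_open[of _ _ _ "{0<..}"]) (use 2 in auto)
  qed
qed

lemma DERIV_max_0_power3: "((\<lambda>x. (max 0 x) ^ 3) has_real_derivative 3 * (max 0 x)\<^sup>2) (at x)"
proof -
  have "((\<lambda>x. x * (max 0 x)\<^sup>2) has_real_derivative 3 * (max 0 x)\<^sup>2) (at x)"
    by (rule DERIV_max_0_power2 derivative_eq_intros refl)+ (auto simp: max_def power2_eq_square)
  moreover have "(\<lambda>x. x * (max 0 x)\<^sup>2) = (\<lambda>x::real. (max 0 x) ^ 3)"
    by (auto simp: fun_eq_iff max_def power2_eq_square power3_eq_cube)
  ultimately show ?thesis by simp
qed

text \<open>On the unit interval this is \<open>1 - (1 - s^2)^2\<close>, a \<open>C^1\<close>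
  passage from 0 to 1. Built from squared positive parts, it needs a single derivative rule; one
  continuous derivative is enough because cut-offs are differentiated only once.\<close>

definition step :: "real \<Rightarrow> real" where
  "step s = 1 - (max 0 (1 - (max 0 s)\<^sup>2))\<^sup>2"

definition step' :: "real \<Rightarrow> real" where
  "step' s = 4 * max 0 (1 - (max 0 s)\<^sup>2) * max 0 s"

lemma DERIV_step: "(step has_real_derivative step' s) (at s)"
  unfolding step_def[abs_def] step'_def
  by (rule DERIV_chain2[OF DERIV_max_0_power2] DERIV_max_0_power2 derivative_eq_intros refl)+ simp

lemma step_props:
  "0 \<le> step s" "step s \<le> 1" "0 \<le> step' s"
  "s \<le> 0 \<Longrightarrow> step s = 0" "s \<le> 0 \<Longrightarrow> step' s = 0"
  "1 \<le> s \<Longrightarrow> step s = 1" "1 \<le> s \<Longrightarrow> step' s = 0"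
proof -
  have "(max 0 (1 - (max 0 s)\<^sup>2))\<^sup>2 \<le> 1" by (rule power_le_one) auto
  then show "0 \<le> step s" by (simp add: step_def)
  have "1 \<le> s \<Longrightarrow> max 0 (1 - s\<^sup>2) = 0" by (simp add: one_le_power)
  then show "1 \<le> s \<Longrightarrow> step s = 1" "1 \<le> s \<Longrightarrow> step' s = 0" by (auto simp: step_def step'_def)
qed (auto simp: step_def step'_def)

lemma continuous_on_step' [continuous_intros]:
  "continuous_on A f \<Longrightarrow> continuous_on A (\<lambda>x. step' (f x))"
  unfolding step'_def by (intro continuous_intros)

lemma has_derivative_step:
  assumes "(f has_derivative f') (at x)"
  shows "((\<lambda>x. step (f x)) has_derivative (\<lambda>h. step' (f x) * f' h)) (at x)"
  using has_derivative_compose[OF assms DERIV_step[unfolded has_field_derivative_def]] .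

lemma continuous_on_step [continuous_intros]:
  "continuous_on A f \<Longrightarrow> continuous_on A (\<lambda>x. step (f x))"
  unfolding step_def by (intro continuous_intros)

text \<open>For the derivative of a vector field this is its divergence.\<close>

definition trace_map :: "('a::euclidean_space \<Rightarrow> 'a) \<Rightarrow> real" where
  "trace_map L = (\<Sum>b\<in>Basis. L b \<bullet> b)"

lemma trace_map_add: "trace_map (\<lambda>h. L h + M h) = trace_map L + trace_map M"
  by (simp add: trace_map_def inner_add_left sum.distrib)

lemma trace_map_diff: "trace_map (\<lambda>h. L h - M h) = trace_map L - trace_map M"
  by (simp add: trace_map_def inner_diff_left sum_subtractf)

lemma trace_map_scaleR: "trace_map (\<lambda>h. c *\<^sub>R L h) = c * trace_map L"
  by (simp add: trace_map_def sum_distrib_left)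

lemma trace_map_0 [simp]: "trace_map (\<lambda>h. 0) = 0"
  by (simp add: trace_map_def)

lemma trace_map_rank1:
  assumes "linear l"
  shows "trace_map (\<lambda>h. l h *\<^sub>R V) = l V"
proof -
  have "l V = l (\<Sum>b\<in>Basis. (V \<bullet> b) *\<^sub>R b)" by (simp add: euclidean_representation)
  also have "\<dots> = (\<Sum>b\<in>Basis. (V \<bullet> b) * l b)"
    by (simp add: linear_sum[OF assms] linear_scale[OF assms])
  finally show ?thesis by (simp add: trace_map_def mult.commute)
qed

lemma trace_map_inner_rank1: "trace_map (\<lambda>h. (u \<bullet> h) *\<^sub>R V) = u \<bullet> V"
  by (rule trace_map_rank1) (auto intro!: linearI simp: inner_add_right)

lemma continuous_on_trace_map:
  "(\<And>b. continuous_on U (\<lambda>w. L w b)) \<Longrightarrow> continuous_on U (\<lambda>w. trace_map (L w))"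
  unfolding trace_map_def by (intro continuous_intros)

text \<open>The integrand is the divergence of \<open>\<psi> P\<close>. A further cut-off in
  \<open>\<rho>\<close> that vanishes near the boundary gives a compactly supported field of zero
  total divergence; differentiating this cut-off produces a multiple of
  \<open>D \<bullet> P\<close>, whose sign is known only where \<open>\<rho> = 0\<close>. Replacing
  \<open>P\<close> by \<open>P - \<delta> e\<close> makes the sign strict there, hence valid in a
  collar. Then the cut-off is removed, and finally \<open>\<delta>\<close> tends to 0.\<close>

lemma local_divergence_le_0:
  fixes U C :: "'a::euclidean_space set" and P :: "'a \<Rightarrow> 'a"
  assumes "open U"
    and rho: "\<And>w. w \<in> ball q r \<Longrightarrow> (\<rho> has_derivative (\<lambda>h. D w \<bullet> h)) (at w)"
    and D: "continuous_on (ball q r) D"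
    and UB: "U \<inter> ball q r = {w \<in> ball q r. \<rho> w < 0}"
    and Pc: "continuous_on {w \<in> ball q r. \<rho> w \<le> 0} P"
    and P': "\<And>w. w \<in> U \<Longrightarrow> (P has_derivative P' w) (at w)"
    and P'c: "\<And>b. continuous_on U (\<lambda>w. P' w b)"
    and M: "\<And>w. w \<in> U \<Longrightarrow> \<bar>trace_map (P' w)\<bar> \<le> M"
    and sgn: "\<And>w. w \<in> ball q r \<Longrightarrow> \<rho> w = 0 \<Longrightarrow> D w \<bullet> P w \<le> 0"
    and e: "\<And>w. w \<in> ball q r \<Longrightarrow> \<rho> w = 0 \<Longrightarrow> D w \<bullet> e > 0"
    and psi: "\<And>w. (\<psi> has_derivative (\<lambda>h. \<psi>' w \<bullet> h)) (at w)" "continuous_on UNIV \<psi>'"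
      "\<And>w. 0 \<le> \<psi> w"
    and C: "compact C" "C \<subseteq> ball q r" "\<And>w. w \<notin> C \<Longrightarrow> \<psi> w = 0" "\<And>w. w \<notin> C \<Longrightarrow> \<psi>' w = 0"
  shows "(LINT w|lborel. indicator U w * (\<psi> w * trace_map (P' w) + \<psi>' w \<bullet> P w)) \<le> 0"
proof -
  let ?B = "ball q r"
  define O1 where "O1 = U \<inter> ?B"
  have O1: "open O1" unfolding O1_def using \<open>open U\<close> by auto
  have rhoc: "continuous_on ?B \<rho>"
    using rho has_derivative_continuous continuous_at_imp_continuous_on by blast
  have psic: "continuous_on UNIV \<psi>"
    using psi(1) has_derivative_continuous continuous_at_imp_continuous_on by blast
  have CB: "w \<in> C \<Longrightarrow> w \<in> ?B" for w using C(2) by auto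
  have Cle: "compact {w \<in> C. \<rho> w \<le> t}" for t
  proof -
    have "closed {w \<in> C. \<rho> w \<le> t}"
      by (intro continuous_on_closed_Collect_le continuous_on_subset[OF rhoc C(2)] compact_imp_closed[OF C(1)] continuous_on_const)
    moreover have "{w \<in> C. \<rho> w \<le> t} = C \<inter> {w \<in> C. \<rho> w \<le> t}" by auto
    ultimately show ?thesis using C(1) compact_Int_closed by metis
  qed
  define Z where "Z = {w \<in> C. \<rho> w \<le> 0}"
  have Zc: "compact Z" unfolding Z_def by (rule Cle)
  have ZB: "Z \<subseteq> {w \<in> ?B. \<rho> w \<le> 0}" using CB by (auto simp: Z_def)
  have PcZ: "continuous_on Z P" using Pc ZB by (rule continuous_on_subset)
  have DcZ: "continuous_on Z D" using D by (rule continuous_on_subset) (use ZB in auto)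
  have rcZ: "continuous_on Z \<rho>" using rhoc by (rule continuous_on_subset) (use ZB in auto)
  obtain NP where NP: "\<And>w. w \<in> Z \<Longrightarrow> norm (P w) \<le> NP"
    using compact_imp_bounded[OF compact_continuous_image[OF PcZ Zc]] unfolding bounded_iff by auto
  obtain Npsi where Npsi: "\<And>w. w \<in> C \<Longrightarrow> norm (\<psi> w) \<le> Npsi"
    using compact_imp_bounded[OF compact_continuous_image[OF continuous_on_subset[OF psic] C(1)]]
    unfolding bounded_iff by auto
  obtain Npsi' where Npsi': "\<And>w. w \<in> C \<Longrightarrow> norm (\<psi>' w) \<le> Npsi'"
    using compact_imp_bounded[OF compact_continuous_image[OF continuous_on_subset[OF psi(2)] C(1)]]
    unfolding bounded_iff by auto
  have PcO: "continuous_on O1 P" using Pc by (rule continuous_on_subset) (use UB O1_def in auto)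
  have DcO: "continuous_on O1 D" using D by (rule continuous_on_subset) (use O1_def in auto)
  have rcO: "continuous_on O1 \<rho>" using rhoc by (rule continuous_on_subset) (use O1_def in auto)
  have pcO: "continuous_on O1 \<psi>" "continuous_on O1 \<psi>'"
    using psic psi(2) continuous_on_subset by blast+
  have P'cO: "continuous_on O1 (\<lambda>w. P' w b)" for b
    using P'c by (rule continuous_on_subset) (auto simp: O1_def)
  have trcO: "continuous_on O1 (\<lambda>w. trace_map (P' w))"
    by (intro continuous_on_trace_map P'cO)
  have intC: "integrable lborel (\<lambda>x. K * indicator C x :: real)" for K
    using C(1) emeasure_compact_finite[OF C(1)] compact_imp_closed[OF C(1)]
    by (intro integrable_mult_right integrable_real_indicator) auto
  \<comment> \<open>The divergence of \<open>\<psi> (P - \<delta> e)\<close>: the constant vector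
    \<open>e\<close> contributes nothing to the trace.\<close>
  define F where "F \<delta> w = (if w \<in> O1 then \<psi> w * trace_map (P' w) + \<psi>' w \<bullet> (P w - \<delta> *\<^sub>R e) else 0)" for \<delta> w
  define N where "N \<delta> = \<bar>Npsi\<bar> * \<bar>M\<bar> + \<bar>Npsi'\<bar> * (\<bar>NP\<bar> + \<bar>\<delta>\<bar> * norm e)" for \<delta> :: real
  have Fb: "\<bar>F \<delta> w\<bar> \<le> N \<delta> * indicator C w" for \<delta> w
  proof (cases "w \<in> C \<and> w \<in> O1")
    case True
    then have w: "w \<in> U" "w \<in> Z" "w \<in> C" using UB by (auto simp: O1_def Z_def)
    have "\<bar>\<psi> w * trace_map (P' w)\<bar> \<le> \<bar>Npsi\<bar> * \<bar>M\<bar>"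
      unfolding abs_mult using M[OF w(1)] Npsi[OF w(3)] by (intro mult_mono) auto
    moreover have "\<bar>\<psi>' w \<bullet> (P w - \<delta> *\<^sub>R e)\<bar> \<le> \<bar>Npsi'\<bar> * (\<bar>NP\<bar> + \<bar>\<delta>\<bar> * norm e)"
    proof -
      have "\<bar>\<psi>' w \<bullet> (P w - \<delta> *\<^sub>R e)\<bar> \<le> norm (\<psi>' w) * norm (P w - \<delta> *\<^sub>R e)" by (rule Cauchy_Schwarz_ineq2)
      also have "\<dots> \<le> \<bar>Npsi'\<bar> * (\<bar>NP\<bar> + \<bar>\<delta>\<bar> * norm e)"
        using NP[OF w(2)] Npsi'[OF w(3)] norm_triangle_ineq4[of "P w" "\<delta> *\<^sub>R e"]
        by (intro mult_mono) auto
      finally show ?thesis .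
    qed
    ultimately show ?thesis using True unfolding F_def N_def
      by (auto intro: order_trans[OF abs_triangle_ineq add_mono])
  next
    case False
    then have "F \<delta> w = 0" using C by (auto simp: F_def)
    moreover have "0 \<le> N \<delta>" unfolding N_def by simp
    ultimately show ?thesis by (cases "w \<in> C") auto
  qed
  have Fm: "F \<delta> \<in> borel_measurable borel" for \<delta>
    unfolding F_def using O1
    by (intro borel_measurable_continuous_on_if continuous_intros PcO pcO trcO) auto
  have Fint: "integrable lborel (F \<delta>)" for \<delta>
    by (rule Bochner_Integration.integrable_bound[OF intC[of "N \<delta>"]]) (use Fm Fb in \<open>auto intro!: AE_I2 intro: order_trans[OF _ abs_ge_self]\<close>)
  have main: "(LINT w|lborel. F \<delta> w) \<le> 0" if "0 < \<delta>" for \<delta>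
  proof -
    let ?Q = "\<lambda>w. P w - \<delta> *\<^sub>R e"
    \<comment> \<open>The collar. If there were none, compactness of \<open>Z\<close> would give a
      limit point with \<open>\<rho> = 0\<close> and
      \<open>D \<bullet> (P - \<delta> e) \<ge> 0\<close>, although there
      \<open>D \<bullet> P \<le> 0\<close> and \<open>D \<bullet> e > 0\<close>.\<close>
    have "\<exists>\<epsilon>>0. \<forall>w\<in>Z. - \<epsilon> \<le> \<rho> w \<longrightarrow> D w \<bullet> ?Q w \<le> 0"
    proof (rule ccontr)
      assume "\<not> ?thesis"
      then have "\<exists>w. w \<in> Z \<and> - \<epsilon> \<le> \<rho> w \<and> D w \<bullet> ?Q w > 0" if "0 < \<epsilon>" for \<epsilon>
        using that by (meson not_le)
      from this[of "1 / Suc n" for n]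
      have "\<forall>n. \<exists>w. w \<in> Z \<and> - (1 / Suc n) \<le> \<rho> w \<and> D w \<bullet> ?Q w > 0" by simp
      from choice[OF this]
      obtain x where x: "\<And>n. x n \<in> Z" "\<And>n. - (1 / Suc n) \<le> \<rho> (x n)" "\<And>n. D (x n) \<bullet> ?Q (x n) > 0"
        by blast
      obtain l and s :: "nat \<Rightarrow> nat" where l: "l \<in> Z" "strict_mono s" "(x \<circ> s) \<longlonglongrightarrow> l"
        using Zc x(1) unfolding compact_def by metis
      have xl: "(\<lambda>n. x (s n)) \<longlonglongrightarrow> l" using l(3) by (simp add: o_def)
      have c1: "(\<lambda>n. \<rho> (x (s n))) \<longlonglongrightarrow> \<rho> l"
        using continuous_on_tendsto_compose[OF rcZ xl l(1)] x(1) by simp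
      have "continuous_on Z (\<lambda>w. D w \<bullet> ?Q w)" by (intro continuous_intros DcZ PcZ)
      then have c2: "(\<lambda>n. D (x (s n)) \<bullet> ?Q (x (s n))) \<longlonglongrightarrow> D l \<bullet> ?Q l"
        using continuous_on_tendsto_compose[OF _ xl l(1)] x(1) by fastforce
      have "0 \<le> D l \<bullet> ?Q l"
        by (rule tendsto_lowerbound[OF c2]) (auto simp: x less_imp_le)
      moreover have "(\<lambda>n. - (1 / real (Suc (s n)))) \<longlonglongrightarrow> - 0"
        using LIMSEQ_subseq_LIMSEQ[OF LIMSEQ_inverse_real_of_nat l(2)]
        by (intro tendsto_minus) (simp add: o_def divide_inverse)
      then have "0 \<le> \<rho> l"
        using tendsto_le[OF _ c1] x(2) by fastforce
      then have r0: "\<rho> l = 0" and lB: "l \<in> ?B" using l(1) CB by (auto simp: Z_def)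
      ultimately show False
        using sgn[OF lB r0] mult_pos_pos[OF that e[OF lB r0]] by (simp add: inner_diff_right)
    qed
    then obtain \<epsilon> where eps: "0 < \<epsilon>" "\<And>w. w \<in> Z \<Longrightarrow> - \<epsilon> \<le> \<rho> w \<Longrightarrow> D w \<bullet> ?Q w \<le> 0" by blast
    \<comment> \<open>From \<open>n0\<close> on, \<open>2 / n\<close> is below the width
      \<open>\<epsilon>\<close> of the collar.\<close>
    obtain n0 :: nat where n0: "2 / \<epsilon> < n0" using reals_Archimedean2 by blast
    \<comment> \<open>Equal to 0 for \<open>\<rho> \<ge> - 1 / n\<close> and to 1 for
      \<open>\<rho> \<le> - 2 / n\<close>, so it varies only in a layer that lies in the collar for
      large \<open>n\<close>. \<open>\<eta>'\<close> is its derivative with respect to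
      \<open>\<rho>\<close>.\<close>
    define \<eta> where "\<eta> n w = step (- real n * \<rho> w - 1)" for n w
    define \<eta>' where "\<eta>' n w = - real n * step' (- real n * \<rho> w - 1)" for n w
    have etac: "continuous_on O1 (\<eta> n)" "continuous_on O1 (\<eta>' n)" for n
      unfolding \<eta>_def[abs_def] \<eta>'_def[abs_def] by (intro continuous_intros rcO)+
    define Fn where "Fn n w = (if w \<in> O1 then \<eta> n w * (\<psi> w * trace_map (P' w) + \<psi>' w \<bullet> ?Q w) else 0)" for n w
    have Fnm: "Fn n \<in> borel_measurable borel" for n
      unfolding Fn_def using O1
      by (intro borel_measurable_continuous_on_if continuous_intros etac PcO pcO trcO) auto
    have FnF: "Fn n w = \<eta> n w * F \<delta> w" for n w by (simp add: Fn_def F_def)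
    have Fnb: "\<bar>Fn n w\<bar> \<le> N \<delta> * indicator C w" for n w
    proof -
      have "\<bar>Fn n w\<bar> \<le> 1 * \<bar>F \<delta> w\<bar>" unfolding FnF abs_mult
        by (intro mult_right_mono) (auto simp: \<eta>_def step_props)
      then show ?thesis using Fb[of \<delta> w] by simp
    qed
    have Fnint: "integrable lborel (Fn n)" for n
      by (rule Bochner_Integration.integrable_bound[OF intC[of "N \<delta>"]]) (use Fnm Fnb in \<open>auto intro!: AE_I2 intro: order_trans[OF _ abs_ge_self]\<close>)
    have Fnle: "(LINT w|lborel. Fn n w) \<le> 0" if n: "n \<ge> n0" for n
    proof -
      have npos: "0 < real n" and neps: "real n * \<epsilon> \<ge> 2"
      proof -
        have "2 / \<epsilon> < real n" using n0 n by linarith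
        moreover have "0 < 2 / \<epsilon>" using eps(1) by simp
        ultimately show "0 < real n" "real n * \<epsilon> \<ge> 2" using eps(1) by (linarith, simp add: field_simps)
      qed
      \<comment> \<open>A compact part of the open set \<open>O1\<close> outside which
        \<open>\<eta> n\<close> or \<open>\<psi>\<close> vanishes with its derivative; extension by
        zero therefore gives a \<open>C^1\<close> field on the whole space.\<close>
      define Kc where "Kc = {w \<in> C. \<rho> w \<le> - (1 / n)}"
      have Kc: "compact Kc" unfolding Kc_def by (rule Cle)
      have KcO: "Kc \<subseteq> O1"
      proof
        fix w assume "w \<in> Kc"
        then have "w \<in> ?B" "\<rho> w < 0" using CB npos by (auto simp: Kc_def intro: le_less_trans)
        then show "w \<in> O1" using UB by (auto simp: O1_def)
      qed
      have out: "(\<eta> n w = 0 \<and> \<eta>' n w = 0) \<or> (\<psi> w = 0 \<and> \<psi>' w = 0)" if "w \<notin> Kc" for w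
      proof (cases "w \<in> C")
        case True
        then have "- (1 / n) < \<rho> w" using that by (auto simp: Kc_def)
        then have "- real n * \<rho> w - 1 \<le> 0" using npos by (simp add: field_simps)
        then show ?thesis by (simp add: \<eta>_def \<eta>'_def step_props)
      qed (use C in auto)
      define G where "G w = (if w \<in> O1 then (\<eta> n w * \<psi> w) *\<^sub>R ?Q w else 0)" for w
      define G' where "G' w h = (if w \<in> O1 then (\<eta>' n w * (D w \<bullet> h) * \<psi> w + \<eta> n w * (\<psi>' w \<bullet> h)) *\<^sub>R ?Q w
          + (\<eta> n w * \<psi> w) *\<^sub>R P' w h else 0)" for w h
      have G0: "G w = 0" if "w \<notin> Kc" for w using out[OF that] by (auto simp: G_def)
      have G'0: "G' w h = 0" if "w \<notin> Kc" for w h using out[OF that] by (auto simp: G'_def)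
      have opK: "open (- Kc)" using compact_imp_closed[OF Kc] by auto
      have G': "(G has_derivative G' w) (at w)" for w
      proof (cases "w \<in> O1")
        case True
        then have wU: "w \<in> U" "w \<in> ?B" by (auto simp: O1_def)
        have "((\<lambda>w. - real n * \<rho> w - 1) has_derivative (\<lambda>h. - real n * (D w \<bullet> h) - 0)) (at w)"
          by (intro derivative_intros rho wU)
        from has_derivative_step[OF this]
        have d1: "(\<eta> n has_derivative (\<lambda>h. \<eta>' n w * (D w \<bullet> h))) (at w)"
          by (simp add: \<eta>_def[abs_def] \<eta>'_def mult_ac)
        have "((\<lambda>w. (\<eta> n w * \<psi> w) *\<^sub>R ?Q w) has_derivative
            (\<lambda>h. (\<eta> n w * \<psi> w) *\<^sub>R (P' w h - 0) + (\<eta> n w * (\<psi>' w \<bullet> h) + \<eta>' n w * (D w \<bullet> h) * \<psi> w) *\<^sub>R ?Q w)) (at w)"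
          by (intro derivative_intros d1 psi P' wU)
        then have "((\<lambda>w. (\<eta> n w * \<psi> w) *\<^sub>R ?Q w) has_derivative G' w) (at w)"
          by (rule has_derivative_eq_rhs) (use True in \<open>auto simp: G'_def fun_eq_iff add_ac\<close>)
        then show ?thesis
          by (rule has_derivative_transform_within_open[OF _ O1 True]) (simp add: G_def)
      next
        case False
        then have w: "w \<in> - Kc" using KcO by auto
        have "G' w = (\<lambda>h. 0)" using G'0 w by (auto simp: fun_eq_iff)
        then have "((\<lambda>w. 0) has_derivative G' w) (at w)" by simp
        then show ?thesis
          by (rule has_derivative_transform_within_open[OF _ opK w]) (simp add: G0)
      qed
      have G'c: "continuous_on UNIV (\<lambda>w. G' w b)" for b
      proof -
        have "continuous_on O1 (\<lambda>w. (\<eta>' n w * (D w \<bullet> b) * \<psi> w + \<eta> n w * (\<psi>' w \<bullet> b)) *\<^sub>R ?Q w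
          + (\<eta> n w * \<psi> w) *\<^sub>R P' w b)"
          by (intro continuous_intros etac DcO pcO PcO P'cO)
        then have 1: "continuous_on O1 (\<lambda>w. G' w b)"
          by (rule continuous_on_eq) (simp add: G'_def)
        have 2: "continuous_on (- Kc) (\<lambda>w. G' w b)"
          by (rule continuous_on_eq[of _ "\<lambda>_. 0"]) (auto simp: G'0)
        have "O1 \<union> - Kc = UNIV" using KcO by auto
        then show ?thesis using continuous_on_open_Un[OF O1 opK 1 2] by simp
      qed
      have I: "integrable lborel (\<lambda>w. G' w b \<bullet> b) \<and> (LINT w|lborel. G' w b \<bullet> b) = 0" for b
      proof -
        have d: "((\<lambda>w. G w \<bullet> b) has_derivative (\<lambda>h. G' w h \<bullet> b)) (at w)" for w
          by (intro has_derivative_inner_left G')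
        show ?thesis
          using integral_partial_derivative_eq_0[of "\<lambda>w. G w \<bullet> b" "\<lambda>w h. G' w h \<bullet> b" b Kc, OF d _ Kc]
            continuous_on_inner[OF G'c[of b] continuous_on_const[of UNIV b]] G0 by simp
      qed
      have trI: "integrable lborel (\<lambda>w. trace_map (G' w))" "(LINT w|lborel. trace_map (G' w)) = 0"
        unfolding trace_map_def using I by (auto intro!: integrable_sum simp: integral_sum)
      have le: "Fn n w \<le> trace_map (G' w)" for w
      proof (cases "w \<in> O1")
        case True
        have linP: "linear (P' w)" using P'[of w] True has_derivative_linear by (auto simp: O1_def)
        have "G' w = (\<lambda>h. ((\<eta>' n w * \<psi> w) * (D w \<bullet> h) + \<eta> n w * (\<psi>' w \<bullet> h)) *\<^sub>R ?Q w
          + (\<eta> n w * \<psi> w) *\<^sub>R P' w h)"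
          using True by (auto simp: G'_def fun_eq_iff mult_ac)
        then have "trace_map (G' w) = (\<eta>' n w * \<psi> w) * (D w \<bullet> ?Q w) + \<eta> n w * (\<psi>' w \<bullet> ?Q w) + (\<eta> n w * \<psi> w) * trace_map (P' w)"
          by (simp only: trace_map_add trace_map_scaleR trace_map_inner_rank1 scaleR_left_distrib scaleR_scaleR[symmetric])
        \<comment> \<open>The cut-off decreases towards the boundary, so
          \<open>\<eta>' \<le> 0\<close>; where it varies and \<open>\<psi>\<close> does not vanish,
          the collar gives \<open>D \<bullet> ?Q \<le> 0\<close> as well.\<close>
        moreover have "0 \<le> (\<eta>' n w * \<psi> w) * (D w \<bullet> ?Q w)"
        proof (cases "w \<in> C \<and> - \<epsilon> \<le> \<rho> w")
          case t: True
          then have "w \<in> Z" using True UB by (auto simp: Z_def O1_def)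
          then have "D w \<bullet> ?Q w \<le> 0" using eps(2) t by auto
          moreover have "\<eta>' n w * \<psi> w \<le> 0"
            unfolding \<eta>'_def using psi(3)[of w] by (intro mult_nonpos_nonneg) (auto simp: step_props)
          ultimately show ?thesis by (rule mult_nonpos_nonpos[rotated])
        next
          case False
          have "\<eta>' n w = 0 \<or> \<psi> w = 0"
          proof (cases "w \<in> C")
            case True
            then have "\<rho> w < - \<epsilon>" using False by auto
            then have "real n * \<rho> w \<le> real n * (- \<epsilon>)" using npos by (intro mult_left_mono) auto
            then have "1 \<le> - real n * \<rho> w - 1" using neps by simp
            then show ?thesis by (simp add: \<eta>'_def step_props)
          qed (use C in auto)
          then show ?thesis by auto
        qed
        ultimately show ?thesis using True by (simp add: Fn_def algebra_simps)
      next
        case False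
        then show ?thesis by (simp add: Fn_def G'_def[abs_def])
      qed
      show ?thesis using integral_mono[OF Fnint trI(1) le] trI(2) by simp
    qed
    have "(\<lambda>n. LINT w|lborel. Fn n w) \<longlonglongrightarrow> (LINT w|lborel. F \<delta> w)"
    proof (rule integral_dominated_convergence[where w = "\<lambda>x. N \<delta> * indicator C x"])
      show "AE w in lborel. (\<lambda>n. Fn n w) \<longlonglongrightarrow> F \<delta> w"
      proof (rule AE_I2)
        fix w
        show "(\<lambda>n. Fn n w) \<longlonglongrightarrow> F \<delta> w"
        proof (cases "w \<in> O1")
          case True
          then have neg: "\<rho> w < 0" using UB by (auto simp: O1_def)
          obtain m :: nat where m: "2 / (- \<rho> w) < m" using reals_Archimedean2 by blast
          have "Fn n w = F \<delta> w" if "n \<ge> m" for n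
          proof -
            have "2 / (- \<rho> w) < real n" using m that by linarith
            then have "1 \<le> - real n * \<rho> w - 1" using neg by (simp add: field_simps)
            then show ?thesis by (simp add: FnF \<eta>_def step_props)
          qed
          then show ?thesis by (intro tendsto_eventually) (auto simp: eventually_sequentially)
        qed (simp add: Fn_def F_def)
      qed
    qed (use intC Fm Fnm Fnb in auto)
    then show ?thesis using Fnle by (intro LIMSEQ_le_const2) auto
  qed
  \<comment> \<open>\<open>F\<close> is affine in \<open>\<delta>\<close>, so the inequality for all
    positive \<open>\<delta>\<close> extends to \<open>\<delta> = 0\<close>.\<close>
  have eqF: "F \<delta> w = F 0 w - \<delta> * (F 0 w - F 1 w)" for \<delta> w
    by (simp add: F_def inner_diff_right)
  have "(LINT w|lborel. F 0 w) \<le> 0"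
  proof (rule field_le_epsilon)
    fix \<epsilon> :: real assume "0 < \<epsilon>"
    define c where "c = (LINT w|lborel. F 0 w) - (LINT w|lborel. F 1 w)"
    define \<delta> where "\<delta> = \<epsilon> / (\<bar>c\<bar> + 1)"
    have dp: "0 < \<delta>" using \<open>0 < \<epsilon>\<close> by (simp add: \<delta>_def add_nonneg_pos)
    have "(LINT w|lborel. F \<delta> w) = (LINT w|lborel. F 0 w - \<delta> * (F 0 w - F 1 w))"
      using eqF[of \<delta>] by simp
    also have "\<dots> = (LINT w|lborel. F 0 w) - \<delta> * c"
      unfolding c_def using Fint by simp
    finally have "(LINT w|lborel. F 0 w) \<le> \<delta> * c" using main[OF dp] by simp
    also have "\<dots> \<le> \<delta> * (\<bar>c\<bar> + 1)" using dp by (intro mult_left_mono) auto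
    also have "\<dots> = 0 + \<epsilon>" unfolding \<delta>_def by (simp add: add_nonneg_pos less_imp_neq[symmetric])
    finally show "(LINT w|lborel. F 0 w) \<le> 0 + \<epsilon>" .
  qed
  moreover have "F 0 w = indicator U w * (\<psi> w * trace_map (P' w) + \<psi>' w \<bullet> P w)" for w
    by (cases "w \<in> C") (use C(3,4)[of w] CB[of w] in \<open>auto simp: F_def O1_def indicator_def\<close>)
  ultimately show ?thesis by simp
qed


text \<open>Of the derivative only the trace is required to be bounded: single second derivatives of
  a solution may blow up at the boundary, but the divergence of the Carleman field does not see
  them.\<close>

definition C1_field :: "'a::euclidean_space set \<Rightarrow> 'a set \<Rightarrow> ('a \<Rightarrow> 'a) \<Rightarrow> ('a \<Rightarrow> 'a \<Rightarrow> 'a) \<Rightarrow> bool" where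
  "C1_field U S P P' \<longleftrightarrow> continuous_on S P \<and> (\<forall>w\<in>U. (P has_derivative P' w) (at w)) \<and>
     (\<forall>b. continuous_on U (\<lambda>w. P' w b)) \<and> bounded (P ` U) \<and> bounded ((\<lambda>w. trace_map (P' w)) ` U)"

text \<open>Since \<open>\<rho> < 0\<close> inside, \<open>D\<close> points outwards, and
  \<open>P\<close> is required not to. The constant vector \<open>e\<close> points outwards along
  the whole boundary piece; it is the direction of the perturbation in
  \<open>local_divergence_le_0\<close>. Interior points fit in with
  \<open>\<rho> = -1\<close>.\<close>

definition outflow_chart :: "'a::euclidean_space set \<Rightarrow> 'a set \<Rightarrow> ('a \<Rightarrow> 'a) \<Rightarrow> 'a \<Rightarrow> real \<Rightarrow> bool" where
  "outflow_chart U S P q r \<longleftrightarrow> r > 0 \<and> (\<exists>\<rho> D e.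
     (\<forall>w\<in>ball q r. (\<rho> has_derivative (\<lambda>h. D w \<bullet> h)) (at w)) \<and> continuous_on (ball q r) D \<and>
     U \<inter> ball q r = {w \<in> ball q r. \<rho> w < 0} \<and> {w \<in> ball q r. \<rho> w \<le> 0} \<subseteq> S \<and>
     (\<forall>w\<in>ball q r. \<rho> w = 0 \<longrightarrow> D w \<bullet> P w \<le> 0 \<and> D w \<bullet> e > 0))"

lemma bump_exists:
  fixes q :: "'a::euclidean_space"
  assumes "0 < r"
  shows "\<exists>\<psi> \<psi>'. (\<forall>w. (\<psi> has_derivative (\<lambda>h. \<psi>' w \<bullet> h)) (at w)) \<and> continuous_on UNIV \<psi>' \<and>
    (\<forall>w. 0 \<le> \<psi> w \<and> \<psi> w \<le> 1) \<and> (\<forall>w\<in>ball q (r / 2). \<psi> w = 1) \<and>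
    (\<forall>w. w \<notin> cball q (3 * r / 4) \<longrightarrow> \<psi> w = 0 \<and> \<psi>' w = 0)"
proof -
  \<comment> \<open>Chosen so that \<open>f \<ge> 1\<close> for distances up to
    \<open>r / 2\<close>, and \<open>f \<le> 0\<close> from distance \<open>r / sqrt 2\<close> on,
    which is less than \<open>3 * r / 4\<close>.\<close>
  define f where "f w = 2 - 4 / r\<^sup>2 * ((w - q) \<bullet> (w - q))" for w
  have f': "(f has_derivative (\<lambda>h. (- (8 / r\<^sup>2) *\<^sub>R (w - q)) \<bullet> h)) (at w)" for w
    proof -
    have "(f has_derivative (\<lambda>h. 0 - 4 / r\<^sup>2 * ((w - q) \<bullet> (h - 0) + (h - 0) \<bullet> (w - q)))) (at w)"
      unfolding f_def[abs_def] by (intro derivative_intros)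
    then show ?thesis
      by (rule has_derivative_eq_rhs) (simp add: fun_eq_iff inner_commute)
  qed
  show ?thesis
  proof (intro exI[of _ "\<lambda>w. step (f w)"] exI[of _ "\<lambda>w. step' (f w) *\<^sub>R (- (8 / r\<^sup>2) *\<^sub>R (w - q))"]
      conjI allI ballI impI)
    show "((\<lambda>w. step (f w)) has_derivative (\<lambda>h. (step' (f w) *\<^sub>R (- (8 / r\<^sup>2) *\<^sub>R (w - q))) \<bullet> h)) (at w)" for w
      using has_derivative_step[OF f'] unfolding inner_scaleR_left .
    show "continuous_on UNIV (\<lambda>w. step' (f w) *\<^sub>R (- (8 / r\<^sup>2) *\<^sub>R (w - q)))"
      unfolding f_def by (intro continuous_intros)
    fix w
    {
      assume "w \<in> ball q (r / 2)"
      then have "norm (w - q) < r / 2" by (simp add: dist_norm norm_minus_commute)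
      then have "(norm (w - q))\<^sup>2 \<le> (r / 2)\<^sup>2" by (intro power_mono) auto
      then have "1 \<le> f w" using assms by (simp add: f_def power2_norm_eq_inner[symmetric] field_simps)
      then show "step (f w) = 1" by (simp add: step_props)
    }
    {
      assume "w \<notin> cball q (3 * r / 4)"
      then have "norm (w - q) > 3 * r / 4" by (simp add: dist_norm norm_minus_commute)
      then have "(norm (w - q))\<^sup>2 \<ge> (3 * r / 4)\<^sup>2" using assms by (intro power_mono) auto
      moreover have "(3 * r / 4)\<^sup>2 \<ge> r\<^sup>2 / 2" by (simp add: power2_eq_square)
      ultimately have "(norm (w - q))\<^sup>2 \<ge> r\<^sup>2 / 2" by linarith
      then have "f w \<le> 0" using assms by (simp add: f_def power2_norm_eq_inner[symmetric] field_simps)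
      then show "step (f w) = 0" "step' (f w) *\<^sub>R (- (8 / r\<^sup>2) *\<^sub>R (w - q)) = 0" by (simp_all add: step_props)
    }
  qed (simp_all add: step_props)
qed

lemma integrable_trace_map:
  assumes "open U" "bounded U" "C1_field U S P P'"
  shows "integrable lborel (\<lambda>w. indicator U w * trace_map (P' w))"
proof -
  obtain M where M: "\<And>w. w \<in> U \<Longrightarrow> \<bar>trace_map (P' w)\<bar> \<le> M"
    using assms(3) unfolding C1_field_def bounded_iff by auto blast
  have "continuous_on U (\<lambda>w. trace_map (P' w))"
    using assms(3) by (auto simp: C1_field_def intro!: continuous_on_trace_map)
  then have "(\<lambda>w. if w \<in> U then trace_map (P' w) else 0) \<in> borel_measurable borel"
    using assms(1) by (intro borel_measurable_continuous_on_if) auto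
  moreover have "(\<lambda>w. if w \<in> U then trace_map (P' w) else 0) = (\<lambda>w. indicator U w * trace_map (P' w))"
    by (auto simp: fun_eq_iff)
  ultimately have m: "(\<lambda>w. indicator U w * trace_map (P' w)) \<in> borel_measurable borel" by simp
  have "integrable lborel (\<lambda>w. \<bar>M\<bar> * indicator U w)"
    using assms(1,2) emeasure_bounded_finite[of U]
    by (intro integrable_mult_right integrable_real_indicator) auto
  then show ?thesis
    by (rule Bochner_Integration.integrable_bound)
       (use m M in \<open>auto simp: indicator_def intro: order_trans[OF _ abs_ge_self]\<close>)
qed

text \<open>A partition of unity, peeled off one ball at a time. The part \<open>\<psi> P\<close>
  lies in one chart and is treated locally. The remainder \<open>(1 - \<psi>) P\<close> vanishes on
  the half ball of that chart, so the remaining balls suffice for it, and the factor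
  \<open>1 - \<psi> \<ge> 0\<close> preserves the boundary sign.\<close>

lemma divergence_le_0_finite_cover:
  fixes U :: "'a::euclidean_space set"
  assumes "finite I" "open U" "bounded U" "U \<subseteq> S"
    and "C1_field U S P P'"
    and "\<And>q. q \<in> I \<Longrightarrow> outflow_chart U S P q (r q)"
    and "\<And>w. w \<in> U \<Longrightarrow> w \<notin> (\<Union>q\<in>I. ball q (r q / 2)) \<Longrightarrow> P w = 0"
  shows "(LINT w|lborel. indicator U w * trace_map (P' w)) \<le> 0"
  using assms(1,5-)
proof (induction I arbitrary: P P' rule: finite_induct)
  case empty
  have "trace_map (P' w) = 0" if w: "w \<in> U" for w
  proof -
    have "(P has_derivative P' w) (at w)" using empty.prems(1) w by (auto simp: C1_field_def)
    then have "((\<lambda>_. 0) has_derivative P' w) (at w)"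
      by (rule has_derivative_transform_within_open[OF _ \<open>open U\<close> w]) (use empty.prems(3) in auto)
    then have "P' w = (\<lambda>_. 0)" by (rule has_derivative_unique) (rule has_derivative_const)
    then show ?thesis by simp
  qed
  then have "(\<lambda>w. indicator U w * trace_map (P' w)) = (\<lambda>w. 0)" by (auto simp: fun_eq_iff indicator_def)
  then show ?case by simp
next
  case (insert q I)
  note adm = insert.prems(1)[unfolded C1_field_def]
  have P': "\<And>w. w \<in> U \<Longrightarrow> (P has_derivative P' w) (at w)" and P'c: "\<And>b. continuous_on U (\<lambda>w. P' w b)"
    and Pc: "continuous_on S P"
    and bdd: "bounded ((\<lambda>w. trace_map (P' w)) ` U)" "bounded (P ` U)" using adm by auto
  obtain M where M: "\<And>w. w \<in> U \<Longrightarrow> \<bar>trace_map (P' w)\<bar> \<le> M" using bdd(1) unfolding bounded_iff by auto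
  obtain MP where MP: "\<And>w. w \<in> U \<Longrightarrow> norm (P w) \<le> MP" using bdd(2) unfolding bounded_iff by auto
  have oc: "outflow_chart U S P q (r q)" using insert.prems(2) by simp
  then have rq: "0 < r q" by (simp add: outflow_chart_def)
  from bump_exists[OF rq, of q] obtain \<psi> \<psi>' where psi: "\<And>w. (\<psi> has_derivative (\<lambda>h. \<psi>' w \<bullet> h)) (at w)" "continuous_on UNIV \<psi>'"
    "\<And>w. 0 \<le> \<psi> w" "\<And>w. \<psi> w \<le> 1" "\<And>w. w \<in> ball q (r q / 2) \<Longrightarrow> \<psi> w = 1"
    "\<And>w. w \<notin> cball q (3 * r q / 4) \<Longrightarrow> \<psi> w = 0" "\<And>w. w \<notin> cball q (3 * r q / 4) \<Longrightarrow> \<psi>' w = 0"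
    by blast
  have psic: "continuous_on UNIV \<psi>"
    using psi(1) has_derivative_continuous continuous_at_imp_continuous_on by blast
  obtain M' where M': "\<And>w. norm (\<psi>' w) \<le> M'"
  proof -
    have "bounded (\<psi>' ` cball q (3 * r q / 4))"
      by (intro compact_imp_bounded compact_continuous_image continuous_on_subset[OF psi(2)]) auto
    then obtain M' where M': "\<forall>w\<in>cball q (3 * r q / 4). norm (\<psi>' w) \<le> M'" unfolding bounded_iff by blast
    have "norm (\<psi>' w) \<le> \<bar>M'\<bar>" for w
    proof (cases "w \<in> cball q (3 * r q / 4)")
      case True
      with M' show ?thesis by (meson abs_ge_self order_trans)
    qed (simp add: psi(7))
    then show ?thesis by (rule that)
  qed
  define P1 where "P1 w = (1 - \<psi> w) *\<^sub>R P w" for w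
  define P1' where "P1' w h = (1 - \<psi> w) *\<^sub>R P' w h - (\<psi>' w \<bullet> h) *\<^sub>R P w" for w h
  have tr1: "trace_map (P1' w) = (1 - \<psi> w) * trace_map (P' w) - \<psi>' w \<bullet> P w" for w
    unfolding P1'_def by (simp add: trace_map_diff trace_map_scaleR trace_map_inner_rank1)
  have adm1: "C1_field U S P1 P1'"
    unfolding C1_field_def
  proof (intro conjI ballI allI)
    show "continuous_on S P1" unfolding P1_def
      by (intro continuous_intros Pc continuous_on_subset[OF psic]) auto
    show "(P1 has_derivative P1' w) (at w)" if "w \<in> U" for w
    proof -
      have "(P1 has_derivative (\<lambda>h. (1 - \<psi> w) *\<^sub>R P' w h + (0 - \<psi>' w \<bullet> h) *\<^sub>R P w)) (at w)"
        unfolding P1_def[abs_def] by (intro derivative_intros psi(1) P' that)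
      then show ?thesis by (rule has_derivative_eq_rhs) (simp add: P1'_def fun_eq_iff)
    qed
    show "continuous_on U (\<lambda>w. P1' w b)" for b unfolding P1'_def
      by (intro continuous_intros P'c continuous_on_subset[OF psic] continuous_on_subset[OF psi(2)]
          continuous_on_subset[OF Pc \<open>U \<subseteq> S\<close>]) auto
    have le1: "norm (P1 w) \<le> MP" if "w \<in> U" for w
    proof -
      have "norm (P1 w) \<le> 1 * norm (P w)" unfolding P1_def norm_scaleR
        by (intro mult_right_mono) (use psi(3,4)[of w] in auto)
      then show ?thesis using MP[OF that] by simp
    qed
    then show "bounded (P1 ` U)" unfolding bounded_iff by blast
    have "\<bar>trace_map (P1' w)\<bar> \<le> M + M' * MP" if "w \<in> U" for w
    proof -
      have "\<bar>(1 - \<psi> w) * trace_map (P' w)\<bar> \<le> 1 * \<bar>trace_map (P' w)\<bar>" unfolding abs_mult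
        by (intro mult_right_mono) (use psi(3,4)[of w] in auto)
      then have 1: "\<bar>(1 - \<psi> w) * trace_map (P' w)\<bar> \<le> M" using M[OF that] by simp
      have "\<bar>\<psi>' w \<bullet> P w\<bar> \<le> norm (\<psi>' w) * norm (P w)" by (rule Cauchy_Schwarz_ineq2)
      also have "\<dots> \<le> M' * MP" using M'[of w] MP[OF that]
        by (intro mult_mono) (auto intro: order_trans[OF norm_ge_zero])
      finally show ?thesis using 1 unfolding tr1 by (intro order_trans[OF abs_triangle_ineq4] add_mono)
    qed
    then show "bounded ((\<lambda>w. trace_map (P1' w)) ` U)" unfolding bounded_iff by auto
  qed
  have "(LINT w|lborel. indicator U w * trace_map (P1' w)) \<le> 0"
  proof (rule insert.IH[OF adm1])
    fix q' assume "q' \<in> I"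
    then have "outflow_chart U S P q' (r q')" using insert.prems(2) by simp
    then obtain \<rho> D e where r: "r q' > 0"
      and c: "\<forall>w\<in>ball q' (r q'). (\<rho> has_derivative (\<lambda>h. D w \<bullet> h)) (at w)" "continuous_on (ball q' (r q')) D"
        "U \<inter> ball q' (r q') = {w \<in> ball q' (r q'). \<rho> w < 0}" "{w \<in> ball q' (r q'). \<rho> w \<le> 0} \<subseteq> S"
        "\<forall>w\<in>ball q' (r q'). \<rho> w = 0 \<longrightarrow> D w \<bullet> P w \<le> 0 \<and> D w \<bullet> e > 0"
      unfolding outflow_chart_def by blast
    have "\<forall>w\<in>ball q' (r q'). \<rho> w = 0 \<longrightarrow> D w \<bullet> P1 w \<le> 0 \<and> D w \<bullet> e > 0"
      using c(5) psi(4) by (auto simp: P1_def intro!: mult_nonneg_nonpos)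
    then show "outflow_chart U S P1 q' (r q')" unfolding outflow_chart_def using r c(1-4) by blast
  next
    fix w assume "w \<in> U" "w \<notin> (\<Union>q\<in>I. ball q (r q / 2))"
    then show "P1 w = 0"
      using insert.prems(3)[of w] psi(5)[of w] by (cases "w \<in> ball q (r q / 2)") (auto simp: P1_def)
  qed
  moreover have "(LINT w|lborel. indicator U w * (\<psi> w * trace_map (P' w) + \<psi>' w \<bullet> P w)) \<le> 0"
  proof -
    obtain \<rho> D e where 
      c: "\<And>w. w\<in>ball q (r q) \<Longrightarrow> (\<rho> has_derivative (\<lambda>h. D w \<bullet> h)) (at w)" "continuous_on (ball q (r q)) D"
        "U \<inter> ball q (r q) = {w \<in> ball q (r q). \<rho> w < 0}" "{w \<in> ball q (r q). \<rho> w \<le> 0} \<subseteq> S"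
        "\<And>w. w\<in>ball q (r q) \<Longrightarrow> \<rho> w = 0 \<Longrightarrow> D w \<bullet> P w \<le> 0"
        "\<And>w. w\<in>ball q (r q) \<Longrightarrow> \<rho> w = 0 \<Longrightarrow> D w \<bullet> e > 0"
      using oc unfolding outflow_chart_def by blast
    show ?thesis
      by (rule local_divergence_le_0[where C = "cball q (3 * r q / 4)", OF \<open>open U\<close> c(1-3) continuous_on_subset[OF Pc c(4)] P' P'c M c(5,6)
            psi(1-3) _ _ psi(6,7)]) (use rq in auto)
  qed
  moreover have "(LINT w|lborel. indicator U w * trace_map (P' w)) =
      (LINT w|lborel. indicator U w * trace_map (P1' w)) +
      (LINT w|lborel. indicator U w * (\<psi> w * trace_map (P' w) + \<psi>' w \<bullet> P w))"
  proof -
    have eq: "indicator U w * (\<psi> w * trace_map (P' w) + \<psi>' w \<bullet> P w) =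
        indicator U w * trace_map (P' w) - indicator U w * trace_map (P1' w)" for w
      by (simp add: tr1 algebra_simps)
    show ?thesis unfolding eq
      using integrable_trace_map[OF assms(2,3) adm1] integrable_trace_map[OF assms(2,3) insert.prems(1)]
      by simp
  qed
  ultimately show ?case by linarith
qed

text \<open>Only the sign of the normal component of \<open>P\<close> on the
  \<open>C\<^sup>1\<close> boundary enters, so no surface measure is needed.\<close>

theorem divergence_le_0:
  fixes U :: "'a::euclidean_space set"
  assumes "open U" "bounded U" "U \<subseteq> S" "compact K"
    and "C1_field U S P P'"
    and chart: "\<And>q. q \<in> K \<Longrightarrow> \<exists>r. outflow_chart U S P q r"
    and zero: "\<And>w. w \<in> U \<Longrightarrow> w \<notin> K \<Longrightarrow> P w = 0"
  shows "(LINT w|lborel. indicator U w * trace_map (P' w)) \<le> 0"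
proof -
  have "\<forall>q\<in>K. \<exists>r. outflow_chart U S P q r" using chart by blast
  from bchoice[OF this] obtain r where r: "\<And>q. q \<in> K \<Longrightarrow> outflow_chart U S P q (r q)" by blast
  have "K \<subseteq> (\<Union>q\<in>K. ball q (r q / 2))" 
  proof
    fix q assume "q \<in> K"
    then have "q \<in> ball q (r q / 2)" using r[of q] by (simp add: outflow_chart_def)
    with \<open>q \<in> K\<close> show "q \<in> (\<Union>q\<in>K. ball q (r q / 2))" by blast
  qed
  then obtain I where I: "I \<subseteq> K" "finite I" "K \<subseteq> (\<Union>q\<in>I. ball q (r q / 2))"
    using compactE_image[OF \<open>compact K\<close>, of K "\<lambda>q. ball q (r q / 2)"] by (metis open_ball)
  show ?thesis
    by (rule divergence_le_0_finite_cover[OF I(2) assms(1-3,5)]) (use r I zero in blast)+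
qed



section \<open>The Carleman multiplier identity\<close>

text \<open>The indefinite metric: \<open>u \<bullet> refl_t u\<close> is the quadratic form whose
  zero set is the null cone.\<close>

definition refl_t :: "'a::euclidean_space \<times> 'b::euclidean_space \<Rightarrow> 'a \<times> 'b" where
  "refl_t h = (- fst h, snd h)"

text \<open>\<open>refl_t (dil_t c h)\<close> is half the Hessian of \<open>cone_weight\<close>
  applied to \<open>h\<close>.\<close>

definition dil_t :: "real \<Rightarrow> 'a::euclidean_space \<times> 'b::euclidean_space \<Rightarrow> 'a \<times> 'b" where
  "dil_t c h = (c *\<^sub>R fst h, snd h)"

text \<open>Applied to the Hessian of a function this is the ultrahyperbolic operator.\<close>

definition wave_tr :: "('a::euclidean_space \<times> 'b::euclidean_space \<Rightarrow> 'a \<times> 'b) \<Rightarrow> real" where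
  "wave_tr H = trace_map (\<lambda>h. refl_t (H h))"

lemma bounded_linear_refl_t: "bounded_linear refl_t"
  unfolding refl_t_def[abs_def]
  by (intro bounded_linear_Pair bounded_linear_minus bounded_linear_fst bounded_linear_snd)

lemma bounded_linear_dil_t: "bounded_linear (dil_t c)"
  unfolding dil_t_def[abs_def]
  by (intro bounded_linear_Pair bounded_linear_const_scaleR bounded_linear_fst bounded_linear_snd)

lemmas dil_t_linear = bounded_linear.linear[OF bounded_linear_dil_t]

lemmas has_derivative_refl_t = bounded_linear.has_derivative[OF bounded_linear_refl_t]
  and has_derivative_dil_t = bounded_linear.has_derivative[OF bounded_linear_dil_t]
  and continuous_on_refl_t = bounded_linear.continuous_on[OF bounded_linear_refl_t]
  and continuous_on_dil_t = bounded_linear.continuous_on[OF bounded_linear_dil_t]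

lemma refl_t_simps:
  "refl_t (u + v) = refl_t u + refl_t v" "refl_t (u - v) = refl_t u - refl_t v"
  "refl_t (x *\<^sub>R u) = x *\<^sub>R refl_t u" "refl_t (refl_t u) = u"
  by (auto simp: refl_t_def)

lemma refl_t_inner: "refl_t u \<bullet> v = u \<bullet> refl_t v"
  by (simp add: refl_t_def inner_prod_def)

lemma refl_t_inner_commute: "u \<bullet> refl_t v = v \<bullet> refl_t u"
  by (metis inner_commute refl_t_inner)

lemma norm_refl_t: "norm (refl_t u) = norm u"
  by (simp add: refl_t_def norm_prod_def)

lemma wave_tr_simps:
  "wave_tr (\<lambda>h. L h + M h) = wave_tr L + wave_tr M"
  "wave_tr (\<lambda>h. x *\<^sub>R L h) = x * wave_tr L"
  "wave_tr (\<lambda>h. (u \<bullet> h) *\<^sub>R V) = u \<bullet> refl_t V"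
  unfolding wave_tr_def
  by (simp_all add: refl_t_simps trace_map_add trace_map_scaleR trace_map_inner_rank1)

text \<open>The gradient of \<open>cone_weight\<close> in the indefinite metric, which is the
  first-order multiplier; \<open>refl_t\<close> turns it into the Euclidean gradient.\<close>

definition cone_field :: "real \<Rightarrow> 'a \<times> 'b \<Rightarrow> 'a::euclidean_space \<times> 'b::euclidean_space \<Rightarrow> 'a \<times> 'b" where
  "cone_field c p q = 2 *\<^sub>R dil_t c (q - p)"

definition cone_weight :: "real \<Rightarrow> real \<Rightarrow> 'a \<times> 'b \<Rightarrow> 'a::euclidean_space \<times> 'b::euclidean_space \<Rightarrow> real" where
  "cone_weight c d p q = (norm (snd (q - p)))\<^sup>2 - c * (norm (fst (q - p)))\<^sup>2 - d"

text \<open>The characteristic form at the differential of the weight, equivalently the derivative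
  of the weight along \<open>cone_field\<close>.\<close>

definition cone_speed :: "real \<Rightarrow> 'a \<times> 'b \<Rightarrow> 'a::euclidean_space \<times> 'b::euclidean_space \<Rightarrow> real" where
  "cone_speed c p q = cone_field c p q \<bullet> refl_t (cone_field c p q)"

lemma cone_field_has_derivative:
  "(cone_field c p has_derivative (\<lambda>h. 2 *\<^sub>R dil_t c h)) (at q)"
proof -
  have "(cone_field c p has_derivative (\<lambda>h. 2 *\<^sub>R dil_t c (h - 0))) (at q)"
    unfolding cone_field_def[abs_def] by (intro derivative_intros has_derivative_dil_t)
  then show ?thesis by simp
qed

lemma cone_weight_has_derivative:
  "(cone_weight c d p has_derivative (\<lambda>h. refl_t (cone_field c p q) \<bullet> h)) (at q)"
proof -
  have eq: "cone_weight c d p = (\<lambda>q. (q - p) \<bullet> refl_t (dil_t c (q - p)) - d)"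
    by (simp add: cone_weight_def fun_eq_iff refl_t_def dil_t_def inner_prod_def power2_norm_eq_inner)
  have "(cone_weight c d p has_derivative
      (\<lambda>h. (q - p) \<bullet> refl_t (dil_t c (h - 0)) + (h - 0) \<bullet> refl_t (dil_t c (q - p)) - 0)) (at q)"
    unfolding eq by (intro derivative_intros has_derivative_refl_t has_derivative_dil_t)
  then show ?thesis
    by (rule has_derivative_eq_rhs)
       (simp add: fun_eq_iff cone_field_def refl_t_def dil_t_def inner_prod_def inner_commute algebra_simps)
qed

lemma cone_speed_has_derivative:
  "(cone_speed c p has_derivative (\<lambda>h. 4 * (dil_t c h \<bullet> refl_t (cone_field c p q)))) (at q)"
proof -
  have "(cone_speed c p has_derivative (\<lambda>h. cone_field c p q \<bullet> refl_t (2 *\<^sub>R dil_t c h) +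
      (2 *\<^sub>R dil_t c h) \<bullet> refl_t (cone_field c p q))) (at q)"
    unfolding cone_speed_def[abs_def]
    by (intro derivative_intros has_derivative_refl_t cone_field_has_derivative)
  then show ?thesis
    by (rule has_derivative_eq_rhs) (simp add: fun_eq_iff refl_t_simps, metis inner_commute refl_t_inner)
qed

lemma continuous_on_cone [continuous_intros]:
  "continuous_on A (cone_field c p)" "continuous_on A (cone_weight c d p)" "continuous_on A (cone_speed c p)"
proof -
  show "continuous_on A (cone_field c p)"
    by (meson cone_field_has_derivative has_derivative_continuous continuous_at_imp_continuous_on)
  show "continuous_on A (cone_weight c d p)"
    by (meson cone_weight_has_derivative has_derivative_continuous continuous_at_imp_continuous_on)
  show "continuous_on A (cone_speed c p)"
    by (meson cone_speed_has_derivative has_derivative_continuous continuous_at_imp_continuous_on)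
qed

text \<open>The ultrahyperbolic operator applied to the weight. It is a constant that depends on the
  dimensions of both factors, hence the type argument.\<close>

definition cone_trace :: "real \<Rightarrow> ('a::euclidean_space \<times> 'b::euclidean_space) itself \<Rightarrow> real" where
  "cone_trace c _ = trace_map (\<lambda>h::'a \<times> 'b. 2 *\<^sub>R dil_t c h)"

text \<open>Gradient and Hessian are explicit parameters. So \<open>a\<close> can at the same time
  be a gradient that is continuous on a larger set up to the boundary, while \<open>H\<close> is
  controlled only on \<open>U\<close>.\<close>

definition C2_data :: "'a::euclidean_space set \<Rightarrow> ('a \<Rightarrow> real) \<Rightarrow> ('a \<Rightarrow> 'a) \<Rightarrow> ('a \<Rightarrow> 'a \<Rightarrow> 'a) \<Rightarrow> bool" where
  "C2_data U v a H \<longleftrightarrow> (\<forall>q\<in>U. (v has_derivative (\<lambda>h. a q \<bullet> h)) (at q)) \<and>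
     (\<forall>q\<in>U. (a has_derivative H q) (at q)) \<and> (\<forall>b. continuous_on U (\<lambda>q. H q b))"

lemma C2_data_continuous:
  assumes "C2_data U v a H"
  shows "continuous_on U v" "continuous_on U a"
  using assms unfolding C2_data_def
  by (meson has_derivative_continuous continuous_at_imp_continuous_on)+

text \<open>The field P. The first line is \<open>2 * s\<close> times the energy-momentum tensor of
  \<open>v\<close> contracted with \<open>cone_field\<close>; the other two terms integrate by parts
  the products with the zero-order terms \<open>s * \<beta> * v\<close> of the multiplier and
  \<open>s^2 * cone_speed * v\<close> of the operator.\<close>

definition carleman_field where
  "carleman_field s c \<beta> p v a q =
     (2 * s) *\<^sub>R ((cone_field c p q \<bullet> a q) *\<^sub>R refl_t (a q) - (1/2 * (a q \<bullet> refl_t (a q))) *\<^sub>R cone_field c p q)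
     + (s * \<beta> * v q) *\<^sub>R refl_t (a q) + (s ^ 3 * cone_speed c p q * (v q)\<^sup>2) *\<^sub>R cone_field c p q"

definition carleman_deriv where
  "carleman_deriv s c \<beta> p v a H q h =
     (2 * s) *\<^sub>R ((cone_field c p q \<bullet> a q) *\<^sub>R refl_t (H q h)
        + (cone_field c p q \<bullet> H q h + (2 *\<^sub>R dil_t c h) \<bullet> a q) *\<^sub>R refl_t (a q)
        - ((1/2 * (a q \<bullet> refl_t (a q))) *\<^sub>R (2 *\<^sub>R dil_t c h) + (H q h \<bullet> refl_t (a q)) *\<^sub>R cone_field c p q))
     + ((s * \<beta> * v q) *\<^sub>R refl_t (H q h) + (s * \<beta> * (a q \<bullet> h)) *\<^sub>R refl_t (a q))
     + ((s ^ 3 * cone_speed c p q * (v q)\<^sup>2) *\<^sub>R (2 *\<^sub>R dil_t c h)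
        + (s ^ 3 * (4 * (dil_t c h \<bullet> refl_t (cone_field c p q))) * (v q)\<^sup>2
           + s ^ 3 * cone_speed c p q * (2 * v q * (a q \<bullet> h))) *\<^sub>R cone_field c p q)"

lemma carleman_field_has_derivative:
  assumes "C2_data U v a H" "q \<in> U"
  shows "(carleman_field s c \<beta> p v a has_derivative carleman_deriv s c \<beta> p v a H q) (at q)"
proof -
  have v: "(v has_derivative (\<lambda>h. a q \<bullet> h)) (at q)" and a: "(a has_derivative H q) (at q)"
    using assms by (auto simp: C2_data_def)
  note d = v a cone_field_has_derivative cone_speed_has_derivative
  have 1: "((\<lambda>q. (cone_field c p q \<bullet> a q) *\<^sub>R refl_t (a q)) has_derivative
      (\<lambda>h. (cone_field c p q \<bullet> a q) *\<^sub>R refl_t (H q h)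
        + (cone_field c p q \<bullet> H q h + (2 *\<^sub>R dil_t c h) \<bullet> a q) *\<^sub>R refl_t (a q))) (at q)"
    by (intro derivative_intros has_derivative_refl_t d)
  have "((\<lambda>q. 1/2 * (a q \<bullet> refl_t (a q))) has_derivative
      (\<lambda>h. 1/2 * (a q \<bullet> refl_t (H q h) + H q h \<bullet> refl_t (a q)))) (at q)"
    by (intro derivative_intros has_derivative_refl_t d)
  then have 2: "((\<lambda>q. 1/2 * (a q \<bullet> refl_t (a q))) has_derivative (\<lambda>h. H q h \<bullet> refl_t (a q))) (at q)"
    by (rule has_derivative_eq_rhs) (simp add: fun_eq_iff refl_t_inner_commute[of "a q"])
  have 3: "((\<lambda>q. (1/2 * (a q \<bullet> refl_t (a q))) *\<^sub>R cone_field c p q) has_derivative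
      (\<lambda>h. (1/2 * (a q \<bullet> refl_t (a q))) *\<^sub>R (2 *\<^sub>R dil_t c h) + (H q h \<bullet> refl_t (a q)) *\<^sub>R cone_field c p q)) (at q)"
    by (intro has_derivative_scaleR 2 d)
  have 4: "((\<lambda>q. (s * \<beta> * v q) *\<^sub>R refl_t (a q)) has_derivative
      (\<lambda>h. (s * \<beta> * v q) *\<^sub>R refl_t (H q h) + (s * \<beta> * (a q \<bullet> h)) *\<^sub>R refl_t (a q))) (at q)"
    by (intro derivative_intros has_derivative_refl_t d)
  have "((\<lambda>q. s ^ 3 * cone_speed c p q * (v q * v q)) has_derivative
      (\<lambda>h. (s ^ 3 * cone_speed c p q) * (v q * (a q \<bullet> h) + (a q \<bullet> h) * v q)
         + (s ^ 3 * (4 * (dil_t c h \<bullet> refl_t (cone_field c p q)))) * (v q * v q))) (at q)"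
    by (intro derivative_intros d)
  then have 5: "((\<lambda>q. s ^ 3 * cone_speed c p q * (v q)\<^sup>2) has_derivative
      (\<lambda>h. s ^ 3 * (4 * (dil_t c h \<bullet> refl_t (cone_field c p q))) * (v q)\<^sup>2
           + s ^ 3 * cone_speed c p q * (2 * v q * (a q \<bullet> h)))) (at q)"
    unfolding power2_eq_square by (rule has_derivative_eq_rhs) (simp add: fun_eq_iff algebra_simps)
  show ?thesis
    unfolding carleman_field_def[abs_def] carleman_deriv_def[abs_def]
    by (intro has_derivative_add has_derivative_diff has_derivative_scaleR_right 1 3 4
        has_derivative_scaleR[OF 5 cone_field_has_derivative])
qed

lemma carleman_deriv_continuous:
  assumes "C2_data U v a H"
  shows "continuous_on U (\<lambda>q. carleman_deriv s c \<beta> p v a H q b)"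
proof -
  have "\<And>b. continuous_on U (\<lambda>q. H q b)" using assms unfolding C2_data_def by blast
  then show ?thesis
    unfolding carleman_deriv_def
    by (intro continuous_intros continuous_on_refl_t continuous_on_dil_t C2_data_continuous[OF assms])
qed

text \<open>Symmetry of the Hessian cancels \<open>Y \<bullet> H (refl_t a)\<close> against
  \<open>H Y \<bullet> refl_t a\<close>, leaving second derivatives only inside
  \<open>wave_tr\<close>. Taking \<beta> as the divergence of the multiplier field minus \<kappa>
  removes that divergence from both quadratic forms and leaves \<kappa> to be chosen.\<close>

lemma trace_carleman_deriv:
  fixes p :: "'a::euclidean_space \<times> 'b::euclidean_space"
  assumes "C2_data U v a H" "open U" "q \<in> U"
    and \<beta>: "\<beta> = cone_trace c TYPE('a \<times> 'b) - \<kappa>"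
  defines "Y \<equiv> cone_field c p q"
  shows "trace_map (carleman_deriv s c \<beta> p v a H q) =
     s * (4 * (dil_t c (refl_t (a q)) \<bullet> a q) - \<kappa> * (a q \<bullet> refl_t (a q)))
     + s ^ 3 * (v q)\<^sup>2 * (4 * (dil_t c Y \<bullet> refl_t Y) + \<kappa> * cone_speed c p q)
     - (wave_tr (H q) + s\<^sup>2 * cone_speed c p q * v q) * (- 2 * s * (Y \<bullet> a q) - s * \<beta> * v q)"
proof -
  have a: "(a has_derivative H q) (at q)" using assms by (auto simp: C2_data_def)
  have Hlin: "linear (H q)" using a has_derivative_linear by blast
  have sym: "Y \<bullet> H q (refl_t (a q)) = H q Y \<bullet> refl_t (a q)"
    using hessian_symmetric[OF assms(2,3) _ a, of v Y "refl_t (a q)"] assms(1)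
    by (simp add: C2_data_def inner_commute)
  have l1: "linear (\<lambda>h. Y \<bullet> H q h + (2 *\<^sub>R dil_t c h) \<bullet> a q)"
    by (intro linearI) (simp_all add: linear_add[OF Hlin] linear_scale[OF Hlin] linear_add[OF dil_t_linear]
          linear_scale[OF dil_t_linear] inner_add_right inner_add_left algebra_simps)
  have l2: "linear (\<lambda>h. H q h \<bullet> refl_t (a q))"
    by (intro linearI) (simp_all add: linear_add[OF Hlin] linear_scale[OF Hlin] inner_add_left)
  have l3: "linear (\<lambda>h. s ^ 3 * (4 * (dil_t c h \<bullet> refl_t Y)) * (v q)\<^sup>2
           + s ^ 3 * cone_speed c p q * (2 * v q * (a q \<bullet> h)))"
    by (intro linearI) (simp_all add: linear_add[OF dil_t_linear] linear_scale[OF dil_t_linear]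
          inner_add_right inner_add_left algebra_simps)
  have l4: "linear (\<lambda>h. s * \<beta> * (a q \<bullet> h))"
    by (intro linearI) (simp_all add: inner_add_right algebra_simps)
  have ta: "2 * trace_map (\<lambda>h::'a \<times> 'b. dil_t c h) = \<beta> + \<kappa>"
    using \<beta> by (simp add: cone_trace_def trace_map_scaleR)
  have "trace_map (carleman_deriv s c \<beta> p v a H q) =
     (2 * s) * ((Y \<bullet> a q) * wave_tr (H q) + (Y \<bullet> H q (refl_t (a q)) + (2 *\<^sub>R dil_t c (refl_t (a q))) \<bullet> a q)
       - ((1/2 * (a q \<bullet> refl_t (a q))) * (\<beta> + \<kappa>) + H q Y \<bullet> refl_t (a q)))
     + ((s * \<beta> * v q) * wave_tr (H q) + s * \<beta> * (a q \<bullet> refl_t (a q)))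
     + ((s ^ 3 * cone_speed c p q * (v q)\<^sup>2) * (\<beta> + \<kappa>)
        + (s ^ 3 * (4 * (dil_t c Y \<bullet> refl_t Y)) * (v q)\<^sup>2 + s ^ 3 * cone_speed c p q * (2 * v q * (a q \<bullet> Y))))"
    unfolding carleman_deriv_def[abs_def] Y_def[symmetric]
    by (simp only: trace_map_add trace_map_diff trace_map_scaleR trace_map_rank1[OF l1] trace_map_rank1[OF l2]
        trace_map_rank1[OF l3] trace_map_rank1[OF l4] ta wave_tr_def[symmetric])
  then show ?thesis
    unfolding sym by (simp add: inner_commute[of "a q" Y] algebra_simps add_divide_distrib power2_eq_square power3_eq_cube)
qed

definition mult_grad where
  "mult_grad M M' c d p w a q = M (cone_weight c d p q) *\<^sub>R a q
     + (w q * M' (cone_weight c d p q)) *\<^sub>R refl_t (cone_field c p q)"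

definition mult_hess where
  "mult_hess M M' M'' c d p w a H q h = M (cone_weight c d p q) *\<^sub>R H q h
     + (M' (cone_weight c d p q) * (refl_t (cone_field c p q) \<bullet> h)) *\<^sub>R a q
     + ((w q * M' (cone_weight c d p q)) *\<^sub>R refl_t (2 *\<^sub>R dil_t c h)
       + (w q * (M'' (cone_weight c d p q) * (refl_t (cone_field c p q) \<bullet> h))
          + (a q \<bullet> h) * M' (cone_weight c d p q)) *\<^sub>R refl_t (cone_field c p q))"

lemma C2_data_mult:
  assumes "C2_data U w a H"
    and M: "\<And>x. (M has_real_derivative M' x) (at x)" "\<And>x. (M' has_real_derivative M'' x) (at x)"
    and M'': "continuous_on UNIV M''"
  shows "C2_data U (\<lambda>q. M (cone_weight c d p q) * w q) (mult_grad M M' c d p w a) (mult_hess M M' M'' c d p w a H)"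
  unfolding C2_data_def
proof (intro conjI ballI allI)
  have c: "continuous_on UNIV M" "continuous_on UNIV M'"
    using M by (meson DERIV_isCont continuous_at_imp_continuous_on)+
  have comp: "((\<lambda>q. f (cone_weight c d p q)) has_derivative
      (\<lambda>h. f' (cone_weight c d p q) * (refl_t (cone_field c p q) \<bullet> h))) (at q)"
    if "\<And>x. (f has_real_derivative f' x) (at x)" for f f' :: "real \<Rightarrow> real" and q
    using has_derivative_compose[OF cone_weight_has_derivative that[unfolded has_field_derivative_def]] .
  fix q assume "q \<in> U"
  then have v: "(w has_derivative (\<lambda>h. a q \<bullet> h)) (at q)" and a: "(a has_derivative H q) (at q)"
    using assms by (auto simp: C2_data_def)
  have "((\<lambda>q. M (cone_weight c d p q) * w q) has_derivative
      (\<lambda>h. M (cone_weight c d p q) * (a q \<bullet> h) + M' (cone_weight c d p q) * (refl_t (cone_field c p q) \<bullet> h) * w q)) (at q)"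
    by (intro has_derivative_mult comp M v)
  then show "((\<lambda>q. M (cone_weight c d p q) * w q) has_derivative (\<lambda>h. mult_grad M M' c d p w a q \<bullet> h)) (at q)"
    by (rule has_derivative_eq_rhs) (simp add: mult_grad_def fun_eq_iff inner_add_left)
  show "(mult_grad M M' c d p w a has_derivative mult_hess M M' M'' c d p w a H q) (at q)"
    unfolding mult_grad_def[abs_def] mult_hess_def[abs_def]
    by (intro has_derivative_add has_derivative_scaleR has_derivative_mult comp M v a
        has_derivative_refl_t cone_field_has_derivative)
next
  fix b
  have c: "continuous_on UNIV M" "continuous_on UNIV M'"
    using M by (meson DERIV_isCont continuous_at_imp_continuous_on)+
  have cc: "continuous_on U (\<lambda>q. f (cone_weight c d p q))" if "continuous_on UNIV f" for f :: "real \<Rightarrow> real"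
    by (rule continuous_on_compose2[OF that]) (auto intro: continuous_on_cone)
  have "\<And>b. continuous_on U (\<lambda>q. H q b)" using assms(1) unfolding C2_data_def by blast
  then show "continuous_on U (\<lambda>q. mult_hess M M' M'' c d p w a H q b)"
    unfolding mult_hess_def
    by (intro continuous_intros continuous_on_refl_t continuous_on_dil_t cc c M'' C2_data_continuous[OF assms(1)])
qed

lemma wave_tr_mult_hess:
  fixes p :: "'a::euclidean_space \<times> 'b::euclidean_space"
  shows "wave_tr (mult_hess M M' M'' c d p w a H q) =
    M (cone_weight c d p q) * wave_tr (H q)
    + 2 * M' (cone_weight c d p q) * (cone_field c p q \<bullet> a q)
    + w q * (M'' (cone_weight c d p q) * cone_speed c p q
      + M' (cone_weight c d p q) * cone_trace c TYPE('a \<times> 'b))"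
proof -
  let ?Y = "cone_field c p q" and ?th = "cone_weight c d p q"
  have eq: "mult_hess M M' M'' c d p w a H q = (\<lambda>h. M ?th *\<^sub>R H q h + M' ?th *\<^sub>R ((refl_t ?Y \<bullet> h) *\<^sub>R a q)
     + ((w q * M' ?th) *\<^sub>R refl_t (2 *\<^sub>R dil_t c h) + ((w q * M'' ?th) *\<^sub>R ((refl_t ?Y \<bullet> h) *\<^sub>R refl_t ?Y)
      + M' ?th *\<^sub>R ((a q \<bullet> h) *\<^sub>R refl_t ?Y))))"
    by (simp add: mult_hess_def fun_eq_iff algebra_simps)
  have "wave_tr (mult_hess M M' M'' c d p w a H q) = M ?th * wave_tr (H q) + M' ?th * (refl_t ?Y \<bullet> refl_t (a q))
     + ((w q * M' ?th) * wave_tr (\<lambda>h::'a\<times>'b. refl_t (2 *\<^sub>R dil_t c h)) + ((w q * M'' ?th) * (refl_t ?Y \<bullet> refl_t (refl_t ?Y))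
      + M' ?th * (a q \<bullet> refl_t (refl_t ?Y))))"
    unfolding eq wave_tr_simps by (rule refl)
  moreover have "wave_tr (\<lambda>h::'a\<times>'b. refl_t (2 *\<^sub>R dil_t c h)) = cone_trace c TYPE('a \<times> 'b)"
    by (simp add: wave_tr_def refl_t_simps cone_trace_def)
  moreover have "refl_t ?Y \<bullet> refl_t (a q) = ?Y \<bullet> a q" by (simp add: refl_t_inner refl_t_simps)
  ultimately show ?thesis
    by (simp add: refl_t_simps cone_speed_def inner_commute[of "a q"] inner_commute[of "refl_t ?Y"] algebra_simps)
qed



section \<open>Uniqueness from the Carleman estimate\<close>

text \<open>The third power is the least that keeps the factor twice continuously differentiable at
  0, so that its product with \<open>w\<close> still has a continuous Hessian.\<close>

definition bump_weight :: "real \<Rightarrow> real \<Rightarrow> real" where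
  "bump_weight s x = (max 0 x) ^ 3 * exp (s * x)"

definition bump_weight' :: "real \<Rightarrow> real \<Rightarrow> real" where
  "bump_weight' s x = (3 * (max 0 x)\<^sup>2 + s * (max 0 x) ^ 3) * exp (s * x)"

definition bump_weight'' :: "real \<Rightarrow> real \<Rightarrow> real" where
  "bump_weight'' s x = (6 * max 0 x + 6 * s * (max 0 x)\<^sup>2 + s\<^sup>2 * (max 0 x) ^ 3) * exp (s * x)"

lemma DERIV_bump_weight:
  "(bump_weight s has_real_derivative bump_weight' s x) (at x)"
  "(bump_weight' s has_real_derivative bump_weight'' s x) (at x)"
proof -
  show "(bump_weight s has_real_derivative bump_weight' s x) (at x)"
    unfolding bump_weight_def[abs_def] bump_weight'_def
    by (rule DERIV_max_0_power2 DERIV_max_0_power3 derivative_eq_intros refl)+ (simp add: algebra_simps)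
  show "(bump_weight' s has_real_derivative bump_weight'' s x) (at x)"
    unfolding bump_weight'_def[abs_def] bump_weight''_def
    by (rule DERIV_max_0_power2 DERIV_max_0_power3 derivative_eq_intros refl)+
       (simp add: algebra_simps power2_eq_square)
qed

lemma continuous_on_bump_weight:
  "continuous_on A (bump_weight s)" "continuous_on A (bump_weight' s)" "continuous_on A (bump_weight'' s)"
  unfolding bump_weight_def[abs_def] bump_weight'_def[abs_def] bump_weight''_def[abs_def]
  by (intro continuous_intros)+

text \<open>With \<kappa> in place of \<open>2 + 2 * c\<close> the time part has coefficient
  \<open>\<kappa> - 4 * c\<close> and the space part \<open>4 - \<kappa>\<close>. The midpoint makes
  both equal to \<open>2 - 2 * c\<close>.\<close>

lemma gradient_form:
  "4 * (dil_t c (refl_t a) \<bullet> a) - (2 + 2 * c) * (a \<bullet> refl_t a) = (2 - 2 * c) * (norm a)\<^sup>2"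
  by (simp add: dil_t_def refl_t_def inner_prod_def power2_norm_eq_inner algebra_simps)

text \<open>Positive weight means that the squared spatial distance exceeds \<open>c\<close> times
  the squared temporal one by more than \<open>d\<close>. The forms here involve \<open>c^3\<close>
  and \<open>c^2\<close> instead of \<open>c\<close>, which only enlarges the difference because
  \<open>c < 1\<close>.\<close>

lemma zero_order_form:
  assumes "0 < c" "c < 1" "0 < d" "0 < cone_weight c d p q"
  shows "4 * (dil_t c (cone_field c p q) \<bullet> refl_t (cone_field c p q)) + (2 + 2 * c) * cone_speed c p q \<ge> 16 * d"
proof -
  define x t where "x = snd (q - p)" and "t = fst (q - p)"
  define X T where "X = x \<bullet> x" and "T = t \<bullet> t"
  have T0: "0 \<le> T" by (simp add: T_def)
  have XT: "X > c * T + d"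
    using assms(4) by (simp add: cone_weight_def X_def T_def x_def t_def power2_norm_eq_inner)
  have Y: "cone_field c p q = ((2 * c) *\<^sub>R t, 2 *\<^sub>R x)"
    by (simp add: cone_field_def dil_t_def x_def t_def)
  have 1: "dil_t c (cone_field c p q) \<bullet> refl_t (cone_field c p q) = 4 * (X - c ^ 3 * T)"
    unfolding Y by (simp add: dil_t_def refl_t_def inner_prod_def X_def T_def power3_eq_cube algebra_simps)
  have 2: "cone_speed c p q = 4 * (X - c\<^sup>2 * T)"
    unfolding cone_speed_def Y by (simp add: refl_t_def inner_prod_def X_def T_def power2_eq_square algebra_simps)
  have "c ^ 3 \<le> c ^ 1" "c\<^sup>2 \<le> c ^ 1" using assms by (intro power_decreasing; simp)+
  then have "c ^ 3 * T \<le> c * T" "c\<^sup>2 * T \<le> c * T" using T0 by (auto intro: mult_right_mono)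
  then have "X - c ^ 3 * T \<ge> d" "X - c\<^sup>2 * T \<ge> 0" using XT assms(3) by auto
  then have "16 * d \<le> 4 * (4 * (X - c ^ 3 * T))" "0 \<le> (2 + 2 * c) * (4 * (X - c\<^sup>2 * T))"
    using assms(1) by auto
  from add_mono[OF this] show ?thesis unfolding 1 2 by (simp only: add_0_right)
qed

text \<open>\<open>A\<close> and \<open>B\<close> are the symmetric and skew parts of the conjugated operator; their sum only
  sees first-order terms of the original operator, the top-order \<open>s\<close>-terms having cancelled.\<close>

lemma conjugated_operator:
  fixes p q :: "'a::euclidean_space \<times> 'b::euclidean_space"
    and s :: real and w :: "'a \<times> 'b \<Rightarrow> real" and a H
  assumes \<beta>: "\<beta> = cone_trace c TYPE('a \<times> 'b) - \<kappa>" and pos: "0 < cone_weight c d p q"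
  defines "\<theta> \<equiv> cone_weight c d p q" and "Y \<equiv> cone_field c p q"
    and "M \<equiv> bump_weight s" and "M' \<equiv> bump_weight' s" and "M'' \<equiv> bump_weight'' s"
  shows "(wave_tr (mult_hess M M' M'' c d p w a H q) + s\<^sup>2 * cone_speed c p q * (M \<theta> * w q))
      + (- 2 * s * (Y \<bullet> mult_grad M M' c d p w a q) - s * \<beta> * (M \<theta> * w q))
    = exp (s * \<theta>) * (\<theta> ^ 3 * wave_tr (H q) + 6 * \<theta>\<^sup>2 * (Y \<bullet> a q)
        + w q * (6 * \<theta> * cone_speed c p q + 3 * \<theta>\<^sup>2 * cone_trace c TYPE('a \<times> 'b)) + s * \<kappa> * \<theta> ^ 3 * w q)"
proof -
  have "max 0 \<theta> = \<theta>" using pos by (simp add: \<theta>_def)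
  then have M: "M \<theta> = \<theta> ^ 3 * exp (s * \<theta>)" "M' \<theta> = (3 * \<theta>\<^sup>2 + s * \<theta> ^ 3) * exp (s * \<theta>)"
    "M'' \<theta> = (6 * \<theta> + 6 * s * \<theta>\<^sup>2 + s\<^sup>2 * \<theta> ^ 3) * exp (s * \<theta>)"
    by (simp_all add: M_def M'_def M''_def bump_weight_def bump_weight'_def bump_weight''_def)
  have 1: "Y \<bullet> mult_grad M M' c d p w a q = M \<theta> * (Y \<bullet> a q) + w q * M' \<theta> * cone_speed c p q"
    by (simp add: mult_grad_def inner_add_right cone_speed_def Y_def \<theta>_def)
  show ?thesis unfolding wave_tr_mult_hess 1 \<theta>_def[symmetric] Y_def[symmetric] M \<beta>
    by (simp add: algebra_simps power2_eq_square power3_eq_cube)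
qed

text \<open>The product \<open>A * B\<close> is at most \<open>(A + B)^2 / 4\<close>, and
  \<open>A + B\<close> is given by \<open>conjugated_operator\<close>. The constants collect its
  terms: 7 = 1 + 6 for the gradient and 14 = 1 + 9 + 4 for the function, after 10 has been bounded
  by \<open>10 * s\<close>.\<close>

lemma carleman_lower_bound:
  fixes p q :: "'a::euclidean_space \<times> 'b::euclidean_space"
    and s :: real and w :: "'a \<times> 'b \<Rightarrow> real" and a H
  assumes C2: "C2_data U w a H" "open U" "q \<in> U"
    and c: "0 < c" "c < 1" and d: "0 < d" and s: "1 \<le> s" and L: "1 \<le> L"
    and pos: "0 < cone_weight c d p q"
    and bd: "norm (cone_field c p q) \<le> L" "\<bar>cone_speed c p q\<bar> \<le> L" "\<bar>cone_trace c TYPE('a \<times> 'b)\<bar> \<le> L"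
      "cone_weight c d p q \<le> L" "\<bar>wave_tr (H q)\<bar> \<le> L * (norm (a q) + \<bar>w q\<bar>)"
    and \<beta>: "\<beta> = cone_trace c TYPE('a \<times> 'b) - (2 + 2 * c)"
  defines "\<theta> \<equiv> cone_weight c d p q"
    and "v \<equiv> \<lambda>q. bump_weight s (cone_weight c d p q) * w q"
    and "av \<equiv> mult_grad (bump_weight s) (bump_weight' s) c d p w a"
    and "Hv \<equiv> mult_hess (bump_weight s) (bump_weight' s) (bump_weight'' s) c d p w a H"
  shows "trace_map (carleman_deriv s c \<beta> p v av Hv q) \<ge>
    s * (2 - 2 * c) * (norm (av q))\<^sup>2 + 16 * d * s ^ 3 * (v q)\<^sup>2
    - (exp (s * \<theta>) * (7 * L ^ 4 * norm (a q) + 14 * s * L ^ 4 * \<bar>w q\<bar>))\<^sup>2 / 4"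
proof -
  let ?Y = "cone_field c p q" and ?\<tau> = "cone_trace c TYPE('a \<times> 'b)" and ?\<gamma> = "cone_speed c p q"
  have C2v: "C2_data U v av Hv"
    unfolding v_def av_def Hv_def
    by (rule C2_data_mult[OF C2(1) DERIV_bump_weight continuous_on_bump_weight(3)])
  define A where "A = wave_tr (Hv q) + s\<^sup>2 * ?\<gamma> * v q"
  define B where "B = - 2 * s * (?Y \<bullet> av q) - s * \<beta> * v q"
  have tr: "trace_map (carleman_deriv s c \<beta> p v av Hv q) =
     s * ((2 - 2 * c) * (norm (av q))\<^sup>2) + s ^ 3 * (v q)\<^sup>2 * (4 * (dil_t c ?Y \<bullet> refl_t ?Y) + (2 + 2 * c) * ?\<gamma>) - A * B"
    unfolding A_def B_def gradient_form[symmetric] by (rule trace_carleman_deriv[OF C2v C2(2,3) \<beta>])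
  have "s ^ 3 * (v q)\<^sup>2 * (4 * (dil_t c ?Y \<bullet> refl_t ?Y) + (2 + 2 * c) * ?\<gamma>) \<ge> s ^ 3 * (v q)\<^sup>2 * (16 * d)"
    using zero_order_form[OF c d pos] s by (intro mult_left_mono) auto
  moreover have "A * B \<le> (A + B)\<^sup>2 / 4"
  proof -
    have "0 \<le> (A - B)\<^sup>2" by simp
    then show ?thesis by (simp add: power2_eq_square algebra_simps)
  qed
  moreover have "(A + B)\<^sup>2 \<le> (exp (s * \<theta>) * (7 * L ^ 4 * norm (a q) + 14 * s * L ^ 4 * \<bar>w q\<bar>))\<^sup>2"
  proof -
    have AB: "A + B = exp (s * \<theta>) * (\<theta> ^ 3 * wave_tr (H q) + 6 * \<theta>\<^sup>2 * (?Y \<bullet> a q)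
        + w q * (6 * \<theta> * ?\<gamma> + 3 * \<theta>\<^sup>2 * ?\<tau>) + s * (2 + 2 * c) * \<theta> ^ 3 * w q)"
      unfolding A_def B_def v_def av_def Hv_def \<theta>_def by (rule conjugated_operator[OF \<beta> pos])
    have th: "0 < \<theta>" "\<theta> \<le> L" using pos bd by (auto simp: \<theta>_def)
    have th23: "\<theta>\<^sup>2 \<le> L\<^sup>2" "\<theta> ^ 3 \<le> L ^ 3" using th by (auto intro: power_mono)
    have Lp: "L ^ m \<le> L ^ n" if "m \<le> n" for m n :: nat using L that by (rule power_increasing[rotated])
    have w0: "0 \<le> \<bar>w q\<bar>" and a0: "0 \<le> norm (a q)" by auto
    have 1: "\<bar>\<theta> ^ 3 * wave_tr (H q)\<bar> \<le> L ^ 4 * (norm (a q) + \<bar>w q\<bar>)"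
    proof -
      have "\<bar>\<theta> ^ 3 * wave_tr (H q)\<bar> \<le> L ^ 3 * (L * (norm (a q) + \<bar>w q\<bar>))"
        unfolding abs_mult using th th23 bd by (intro mult_mono) auto
      then show ?thesis by (simp add: power_numeral_reduce mult_ac)
    qed
    have 2: "\<bar>6 * \<theta>\<^sup>2 * (?Y \<bullet> a q)\<bar> \<le> 6 * L ^ 4 * norm (a q)"
    proof -
      have "\<bar>?Y \<bullet> a q\<bar> \<le> norm ?Y * norm (a q)" by (rule Cauchy_Schwarz_ineq2)
      also have "\<dots> \<le> L * norm (a q)" using bd by (intro mult_right_mono) auto
      finally have "\<bar>\<theta>\<^sup>2 * (?Y \<bullet> a q)\<bar> \<le> L\<^sup>2 * (L * norm (a q))"
        unfolding abs_mult using th23 by (intro mult_mono) auto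
      also have "\<dots> = L ^ 3 * norm (a q)" by (simp add: power_numeral_reduce mult_ac)
      also have "\<dots> \<le> L ^ 4 * norm (a q)" using Lp[of 3 4] by (intro mult_right_mono) auto
      finally show ?thesis by (simp add: abs_mult)
    qed
    have 3: "\<bar>w q * (6 * \<theta> * ?\<gamma> + 3 * \<theta>\<^sup>2 * ?\<tau>)\<bar> \<le> 9 * L ^ 4 * \<bar>w q\<bar>"
    proof -
      have "\<bar>\<theta> * ?\<gamma>\<bar> \<le> L * L" unfolding abs_mult using th bd L by (intro mult_mono) auto
      then have i: "\<bar>\<theta> * ?\<gamma>\<bar> \<le> L ^ 4" using Lp[of 2 4] by (simp add: power2_eq_square)
      have "\<bar>\<theta>\<^sup>2 * ?\<tau>\<bar> \<le> L\<^sup>2 * L" unfolding abs_mult using th23 bd L by (intro mult_mono) auto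
      then have ii: "\<bar>\<theta>\<^sup>2 * ?\<tau>\<bar> \<le> L ^ 4" using Lp[of 3 4] by (simp add: power_numeral_reduce mult_ac)
      have "\<bar>6 * \<theta> * ?\<gamma> + 3 * \<theta>\<^sup>2 * ?\<tau>\<bar> \<le> 9 * L ^ 4"
        using i ii unfolding mult.assoc by linarith
      then show ?thesis unfolding abs_mult by (subst mult.commute) (intro mult_right_mono; simp)
    qed
    have 4: "\<bar>s * (2 + 2 * c) * \<theta> ^ 3 * w q\<bar> \<le> 4 * s * L ^ 4 * \<bar>w q\<bar>"
    proof -
      have "\<theta> ^ 3 \<le> L ^ 4" using th23 Lp[of 3 4] by linarith
      then have "(s * (2 + 2 * c)) * \<theta> ^ 3 \<le> (s * 4) * L ^ 4"
        using s c th by (intro mult_mono) auto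
      moreover have "0 \<le> s * (2 + 2 * c) * \<theta> ^ 3" using s c th by simp
      ultimately show ?thesis
        by (simp only: abs_mult[of _ "w q"] abs_of_nonneg) (intro mult_right_mono; simp add: mult_ac)
    qed
    have 5: "10 * L ^ 4 * \<bar>w q\<bar> \<le> 10 * s * L ^ 4 * \<bar>w q\<bar>" using s L by (intro mult_right_mono) auto
    have "\<bar>A + B\<bar> \<le> exp (s * \<theta>) * (7 * L ^ 4 * norm (a q) + 14 * s * L ^ 4 * \<bar>w q\<bar>)"
      unfolding AB abs_mult[of "exp _"] abs_exp_cancel
    proof (rule mult_left_mono)
      show "\<bar>\<theta> ^ 3 * wave_tr (H q) + 6 * \<theta>\<^sup>2 * (?Y \<bullet> a q)
        + w q * (6 * \<theta> * ?\<gamma> + 3 * \<theta>\<^sup>2 * ?\<tau>) + s * (2 + 2 * c) * \<theta> ^ 3 * w q\<bar>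
        \<le> 7 * L ^ 4 * norm (a q) + 14 * s * L ^ 4 * \<bar>w q\<bar>"
        using 1 2 3 4 5 by (simp only: distrib_left) linarith
    qed simp
    then show ?thesis using power_mono[of "\<bar>A + B\<bar>" _ 2] by simp
  qed
  ultimately show ?thesis unfolding tr by (simp add: mult_ac)
qed


lemma compact_bound:
  fixes f :: "'a::metric_space \<Rightarrow> 'b::real_normed_vector"
  assumes "compact K" "continuous_on K f"
  shows "\<exists>B\<ge>0. \<forall>q\<in>K. norm (f q) \<le> B"
proof -
  have "bounded (f ` K)" using assms by (intro compact_imp_bounded compact_continuous_image)
  then obtain B where "\<forall>q\<in>K. norm (f q) \<le> B" unfolding bounded_iff by auto
  then show ?thesis by (intro exI[of _ "\<bar>B\<bar>"]) (auto intro: order_trans[OF _ abs_ge_self])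
qed

text \<open>At a boundary point with positive weight \<open>w\<close> vanishes and its gradient is a
  spatial multiple of \<open>D\<close>, which \<open>refl_t\<close> fixes. Only the energy-momentum
  part survives, and it equals a nonnegative factor times
  \<open>\<mu>^2 * (D \<bullet> cone_field c p x)\<close>. Elsewhere the field is zero.\<close>

lemma carleman_outflow:
  fixes D :: "'a::euclidean_space \<times> 'b::euclidean_space"
  assumes "0 < s" "fst D = 0"
    and "0 < cone_weight c d p x \<Longrightarrow> w x = 0 \<and> (\<exists>\<mu>. a x = \<mu> *\<^sub>R D \<and> \<mu>\<^sup>2 * (D \<bullet> cone_field c p x) \<le> 0)"
  shows "D \<bullet> carleman_field s c \<beta> p (\<lambda>q. bump_weight s (cone_weight c d p q) * w q)
    (mult_grad (bump_weight s) (bump_weight' s) c d p w a) x \<le> 0"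
proof (cases "0 < cone_weight c d p x")
  case True
  then obtain \<mu> where w: "w x = 0" and a: "a x = \<mu> *\<^sub>R D" and \<mu>: "\<mu>\<^sup>2 * (D \<bullet> cone_field c p x) \<le> 0"
    using assms(3) by blast
  have rD: "refl_t D = D" using assms(2) by (simp add: refl_t_def prod_eq_iff)
  let ?m = "bump_weight s (cone_weight c d p x)"
  have "D \<bullet> carleman_field s c \<beta> p (\<lambda>q. bump_weight s (cone_weight c d p q) * w q)
    (mult_grad (bump_weight s) (bump_weight' s) c d p w a) x = s * ?m\<^sup>2 * (D \<bullet> D) * (\<mu>\<^sup>2 * (D \<bullet> cone_field c p x))"
    unfolding carleman_field_def mult_grad_def w a
    by (simp add: refl_t_simps rD inner_diff_right inner_add_right inner_commute[of "cone_field c p x"]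
        power2_eq_square algebra_simps)
  also have "\<dots> \<le> 0" by (rule mult_nonneg_nonpos[OF _ \<mu>]) (use assms(1) in auto)
  finally show ?thesis .
next
  case False
  then have "bump_weight s (cone_weight c d p x) = 0" "bump_weight' s (cone_weight c d p x) = 0"
    by (simp_all add: bump_weight_def bump_weight'_def)
  then show ?thesis by (simp add: carleman_field_def mult_grad_def refl_t_def zero_prod_def[symmetric])
qed

text \<open>Where the weight exceeds \<open>\<delta>\<close>, the cut-off factor is bounded below, so all error terms are
  controlled by the conjugated function itself and are absorbed for large \<open>s\<close>.\<close>

lemma error_absorption:
  fixes p q :: "'a::euclidean_space \<times> 'b::euclidean_space"
    and s :: real and w :: "'a \<times> 'b \<Rightarrow> real" and a
  assumes L: "1 \<le> L" "norm (cone_field c p q) \<le> L" and s: "1 \<le> s"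
    and \<delta>: "0 < \<delta>" "\<delta> \<le> cone_weight c d p q"
  defines "\<theta> \<equiv> cone_weight c d p q"
    and "v \<equiv> \<lambda>q. bump_weight s (cone_weight c d p q) * w q"
    and "av \<equiv> mult_grad (bump_weight s) (bump_weight' s) c d p w a"
    and "N \<equiv> 7 * L ^ 4 / \<delta> ^ 3 * (1 + (3 / \<delta> + 1) * L) + 14 * L ^ 4 / \<delta> ^ 3"
  shows "exp (s * \<theta>) * (7 * L ^ 4 * norm (a q) + 14 * s * L ^ 4 * \<bar>w q\<bar>) \<le> N * (norm (av q) + s * \<bar>v q\<bar>)"
proof -
  have th: "0 < \<theta>" "\<delta> \<le> \<theta>" using \<delta> by (auto simp: \<theta>_def)
  then have mx: "max 0 \<theta> = \<theta>" by simp
  define E where "E = exp (s * \<theta>)"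
  have E: "0 < E" by (simp add: E_def)
  have k: "\<delta> ^ 3 \<le> \<theta> ^ 3" "0 < \<delta> ^ 3" using \<delta> th by (auto intro: power_mono)
  have v: "v q = \<theta> ^ 3 * E * w q" by (simp add: v_def bump_weight_def \<theta>_def[symmetric] mx E_def)
  have av: "av q = (\<theta> ^ 3 * E) *\<^sub>R a q + (w q * ((3 * \<theta>\<^sup>2 + s * \<theta> ^ 3) * E)) *\<^sub>R refl_t (cone_field c p q)"
    by (simp add: av_def mult_grad_def bump_weight_def bump_weight'_def \<theta>_def[symmetric] mx E_def)
  have "\<delta> ^ 3 * (E * \<bar>w q\<bar>) \<le> \<theta> ^ 3 * (E * \<bar>w q\<bar>)" using k E by (intro mult_right_mono) auto
  also have "\<dots> = \<bar>v q\<bar>" using th E by (simp add: v abs_mult)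
  finally have wv: "E * \<bar>w q\<bar> \<le> \<bar>v q\<bar> / \<delta> ^ 3" using k by (simp add: field_simps)
  \<comment> \<open>Solves the product rule for the gradient of \<open>w\<close>: the logarithmic
    derivative of the weight factor is \<open>3 / \<theta> + s\<close>, and it is at most
    \<open>s * (3 / \<delta> + 1)\<close> since \<open>\<theta> \<ge> \<delta>\<close> and
    \<open>s \<ge> 1\<close>.\<close>
  have "w q * ((3 * \<theta>\<^sup>2 + s * \<theta> ^ 3) * E) = (3 / \<theta> + s) * v q"
    using th by (simp add: v field_simps power2_eq_square power3_eq_cube)
  then have "(\<theta> ^ 3 * E) *\<^sub>R a q = av q - ((3 / \<theta> + s) * v q) *\<^sub>R refl_t (cone_field c p q)"
    unfolding av by simp
  then have "norm ((\<theta> ^ 3 * E) *\<^sub>R a q) \<le> norm (av q) + norm (((3 / \<theta> + s) * v q) *\<^sub>R refl_t (cone_field c p q))"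
    by (simp only: norm_triangle_ineq4)
  also have "norm (((3 / \<theta> + s) * v q) *\<^sub>R refl_t (cone_field c p q)) \<le> (s * (3 / \<delta> + 1) * \<bar>v q\<bar>) * L"
  proof -
    have "3 / \<theta> \<le> 3 / \<delta>" using th \<delta> by (intro divide_left_mono) auto
    also have "\<dots> \<le> s * (3 / \<delta>)" using s \<delta> by (simp add: field_simps)
    finally have "3 / \<theta> + s \<le> s * (3 / \<delta> + 1)" by (simp add: algebra_simps)
    then have "\<bar>(3 / \<theta> + s) * v q\<bar> \<le> s * (3 / \<delta> + 1) * \<bar>v q\<bar>"
      using th s by (simp add: abs_mult mult_right_mono)
    then show ?thesis unfolding norm_scaleR norm_refl_t using L s \<delta> by (intro mult_mono) auto
  qed
  finally have "\<theta> ^ 3 * (E * norm (a q)) \<le> norm (av q) + s * (3 / \<delta> + 1) * \<bar>v q\<bar> * L"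
    using th E by (simp add: abs_mult)
  moreover have "\<delta> ^ 3 * (E * norm (a q)) \<le> \<theta> ^ 3 * (E * norm (a q))" using k E by (intro mult_right_mono) auto
  ultimately have "\<delta> ^ 3 * (E * norm (a q)) \<le> norm (av q) + s * (3 / \<delta> + 1) * \<bar>v q\<bar> * L" by linarith
  then have aa: "E * norm (a q) \<le> (norm (av q) + s * (3 / \<delta> + 1) * \<bar>v q\<bar> * L) / \<delta> ^ 3"
    using k by (simp add: field_simps)
  define X where "X = norm (av q) + s * \<bar>v q\<bar>"
  have X: "norm (av q) \<le> X" "s * \<bar>v q\<bar> \<le> X" "0 \<le> X" using s by (auto simp: X_def)
  have C: "0 \<le> (3 / \<delta> + 1) * L" using \<delta> L by simp
  have "norm (av q) + s * (3 / \<delta> + 1) * \<bar>v q\<bar> * L = norm (av q) + (3 / \<delta> + 1) * L * (s * \<bar>v q\<bar>)"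
    by (simp add: algebra_simps)
  also have "\<dots> \<le> X + (3 / \<delta> + 1) * L * X" by (intro add_mono mult_left_mono X C)
  also have "\<dots> = (1 + (3 / \<delta> + 1) * L) * X" by (simp add: algebra_simps)
  finally have "E * norm (a q) \<le> (1 + (3 / \<delta> + 1) * L) * X / \<delta> ^ 3"
    using order_trans[OF aa divide_right_mono] k by auto
  then have i: "7 * L ^ 4 * (E * norm (a q)) \<le> 7 * L ^ 4 * ((1 + (3 / \<delta> + 1) * L) * X / \<delta> ^ 3)"
    using L by (intro mult_left_mono) auto
  have "s * (E * \<bar>w q\<bar>) \<le> s * (\<bar>v q\<bar> / \<delta> ^ 3)" using wv s by (intro mult_left_mono) auto
  also have "\<dots> = (s * \<bar>v q\<bar>) / \<delta> ^ 3" by simp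
  also have "\<dots> \<le> X / \<delta> ^ 3" using X k by (intro divide_right_mono) auto
  finally have ii: "14 * L ^ 4 * (s * (E * \<bar>w q\<bar>)) \<le> 14 * L ^ 4 * (X / \<delta> ^ 3)"
    using L by (intro mult_left_mono) auto
  have "exp (s * \<theta>) * (7 * L ^ 4 * norm (a q) + 14 * s * L ^ 4 * \<bar>w q\<bar>)
      = 7 * L ^ 4 * (E * norm (a q)) + 14 * L ^ 4 * (s * (E * \<bar>w q\<bar>))"
    by (simp add: E_def algebra_simps)
  also have "\<dots> \<le> 7 * L ^ 4 * ((1 + (3 / \<delta> + 1) * L) * X / \<delta> ^ 3) + 14 * L ^ 4 * (X / \<delta> ^ 3)"
    using i ii by linarith
  also have "\<dots> = N * X" unfolding N_def by (simp add: algebra_simps)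
  finally show ?thesis by (simp add: X_def)
qed


lemma carleman_field_eq_0:
  fixes p q :: "'a::euclidean_space \<times> 'b::euclidean_space"
    and s :: real and w :: "'a \<times> 'b \<Rightarrow> real" and a H
  assumes "cone_weight c d p q \<le> 0"
  defines "v \<equiv> \<lambda>q. bump_weight s (cone_weight c d p q) * w q"
    and "av \<equiv> mult_grad (bump_weight s) (bump_weight' s) c d p w a"
  shows "carleman_field s c \<beta> p v av q = 0" "carleman_deriv s c \<beta> p v av H q = (\<lambda>h. 0)"
proof -
  have "bump_weight s (cone_weight c d p q) = 0" "bump_weight' s (cone_weight c d p q) = 0"
    using assms(1) by (simp_all add: bump_weight_def bump_weight'_def)
  then have "v q = 0" "av q = 0" by (simp_all add: v_def av_def mult_grad_def)
  moreover have "refl_t 0 = (0 :: 'a \<times> 'b)" by (simp add: refl_t_def zero_prod_def)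
  ultimately show "carleman_field s c \<beta> p v av q = 0" "carleman_deriv s c \<beta> p v av H q = (\<lambda>h. 0)"
    by (simp_all add: carleman_field_def carleman_deriv_def fun_eq_iff)
qed

text \<open>Outside the compact set where the weight is nonnegative the field is zero. On it, all
  first-order data are bounded by continuity up to the boundary, and \<open>box\<close> bounds the
  one second-order quantity that enters the divergence.\<close>

lemma C1_field_carleman:
  fixes p :: "'a::euclidean_space \<times> 'b::euclidean_space" and U S :: "('a \<times> 'b) set"
    and s :: real and w :: "'a \<times> 'b \<Rightarrow> real" and a H
  assumes U: "open U" "U \<subseteq> S"
    and w: "C2_data U w a H" "continuous_on S w" "continuous_on S a"
    and K: "compact {q \<in> S. 0 \<le> cone_weight c d p q}"
    and box: "\<And>q. q \<in> U \<Longrightarrow> 0 < cone_weight c d p q \<Longrightarrow> \<bar>wave_tr (H q)\<bar> \<le> CX * (norm (a q) + \<bar>w q\<bar>)"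
  defines "v \<equiv> \<lambda>q. bump_weight s (cone_weight c d p q) * w q"
    and "av \<equiv> mult_grad (bump_weight s) (bump_weight' s) c d p w a"
    and "Hv \<equiv> mult_hess (bump_weight s) (bump_weight' s) (bump_weight'' s) c d p w a H"
  shows "C1_field U S (carleman_field s c \<beta> p v av) (carleman_deriv s c \<beta> p v av Hv)"
proof -
  define K where "K = {q \<in> S. 0 \<le> cone_weight c d p q}"
  have Kc: "compact K" and KS: "K \<subseteq> S" using K by (auto simp: K_def)
  have C2v: "C2_data U v av Hv"
    unfolding v_def av_def Hv_def
    by (rule C2_data_mult[OF w(1) DERIV_bump_weight continuous_on_bump_weight(3)])
  have cc: "continuous_on A (\<lambda>q. f (cone_weight c d p q))" if "continuous_on UNIV f" for f :: "real \<Rightarrow> real" and A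
    by (rule continuous_on_compose2[OF that]) (auto intro: continuous_on_cone)
  have vc: "continuous_on S v" unfolding v_def
    by (intro continuous_intros cc continuous_on_bump_weight w)
  have avc: "continuous_on S av" unfolding av_def mult_grad_def
    by (intro continuous_intros cc continuous_on_bump_weight w continuous_on_refl_t)
  have Pc: "continuous_on S (carleman_field s c \<beta> p v av)" unfolding carleman_field_def
    by (intro continuous_intros vc avc continuous_on_refl_t)
  show ?thesis
    unfolding C1_field_def
  proof (intro conjI ballI allI)
    show "continuous_on S (carleman_field s c \<beta> p v av)" by (rule Pc)
    show "(carleman_field s c \<beta> p v av has_derivative carleman_deriv s c \<beta> p v av Hv q) (at q)" if "q \<in> U" for q
      by (rule carleman_field_has_derivative[OF C2v that])
    show "continuous_on U (\<lambda>q. carleman_deriv s c \<beta> p v av Hv q b)" for b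
      by (rule carleman_deriv_continuous[OF C2v])
    have "bounded (insert 0 (carleman_field s c \<beta> p v av ` K))"
      using compact_imp_bounded[OF compact_continuous_image[OF continuous_on_subset[OF Pc KS] Kc]] by simp
    moreover have "carleman_field s c \<beta> p v av q \<in> insert 0 (carleman_field s c \<beta> p v av ` K)" if "q \<in> U" for q
    proof (cases "0 \<le> cone_weight c d p q")
      case True
      then show ?thesis using that U by (auto simp: K_def)
    next
      case False
      then have "carleman_field s c \<beta> p v av q = 0" unfolding v_def av_def by (intro carleman_field_eq_0) simp
      then show ?thesis by simp
    qed
    ultimately show "bounded (carleman_field s c \<beta> p v av ` U)" by (meson bounded_subset image_subsetI)
    define \<kappa> where "\<kappa> = cone_trace c TYPE('a \<times> 'b) - \<beta>"
    have \<beta>: "\<beta> = cone_trace c TYPE('a \<times> 'b) - \<kappa>" by (simp add: \<kappa>_def)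
    \<comment> \<open>The divergence becomes \<open>g1 - (g4 * wave_tr H + g2) * g3\<close> with
      \<open>g1\<close> to \<open>g4\<close> continuous on \<open>S\<close>; \<open>g5\<close> is
      the bound for \<open>wave_tr H\<close>, continuous there too.\<close>
    define g1 where "g1 q = s * (4 * (dil_t c (refl_t (av q)) \<bullet> av q) - \<kappa> * (av q \<bullet> refl_t (av q)))
     + s ^ 3 * (v q)\<^sup>2 * (4 * (dil_t c (cone_field c p q) \<bullet> refl_t (cone_field c p q)) + \<kappa> * cone_speed c p q)" for q
    define g2 where "g2 q = 2 * bump_weight' s (cone_weight c d p q) * (cone_field c p q \<bullet> a q)
      + w q * (bump_weight'' s (cone_weight c d p q) * cone_speed c p q
      + bump_weight' s (cone_weight c d p q) * cone_trace c TYPE('a \<times> 'b)) + s\<^sup>2 * cone_speed c p q * v q" for q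
    define g3 where "g3 q = - 2 * s * (cone_field c p q \<bullet> av q) - s * \<beta> * v q" for q
    define g4 where "g4 q = bump_weight s (cone_weight c d p q)" for q
    define g5 where "g5 q = CX * (norm (a q) + \<bar>w q\<bar>)" for q
    have tr: "trace_map (carleman_deriv s c \<beta> p v av Hv q) = g1 q - (g4 q * wave_tr (H q) + g2 q) * g3 q" if "q \<in> U" for q
      unfolding trace_carleman_deriv[OF C2v U(1) that \<beta>] g1_def g2_def g3_def g4_def
      unfolding Hv_def wave_tr_mult_hess by (simp add: add.assoc)
    note onS = cc continuous_on_bump_weight vc avc w(2,3) continuous_on_refl_t continuous_on_dil_t
    have "continuous_on S g1" unfolding g1_def[abs_def] by (intro continuous_intros onS)
    from compact_bound[OF Kc continuous_on_subset[OF this KS]]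
    obtain B1 where B1: "0 \<le> B1" "\<forall>q\<in>K. \<bar>g1 q\<bar> \<le> B1" by auto
    have "continuous_on S g2" unfolding g2_def[abs_def] by (intro continuous_intros onS)
    from compact_bound[OF Kc continuous_on_subset[OF this KS]]
    obtain B2 where B2: "0 \<le> B2" "\<forall>q\<in>K. \<bar>g2 q\<bar> \<le> B2" by auto
    have "continuous_on S g3" unfolding g3_def[abs_def] by (intro continuous_intros onS)
    from compact_bound[OF Kc continuous_on_subset[OF this KS]]
    obtain B3 where B3: "0 \<le> B3" "\<forall>q\<in>K. \<bar>g3 q\<bar> \<le> B3" by auto
    have "continuous_on S g4" unfolding g4_def[abs_def] by (intro continuous_intros onS)
    from compact_bound[OF Kc continuous_on_subset[OF this KS]]
    obtain B4 where B4: "0 \<le> B4" "\<forall>q\<in>K. \<bar>g4 q\<bar> \<le> B4" by auto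
    have "continuous_on S g5" unfolding g5_def[abs_def] by (intro continuous_intros onS)
    from compact_bound[OF Kc continuous_on_subset[OF this KS]]
    obtain B5 where B5: "0 \<le> B5" "\<forall>q\<in>K. \<bar>g5 q\<bar> \<le> B5" by auto
    have "\<bar>trace_map (carleman_deriv s c \<beta> p v av Hv q)\<bar> \<le> B1 + (B4 * B5 + B2) * B3" if qU: "q \<in> U" for q
    proof (cases "0 < cone_weight c d p q")
      case True
      then have q: "q \<in> K" using qU U by (auto simp: K_def)
      have "\<bar>wave_tr (H q)\<bar> \<le> B5" using box[OF qU True] B5(2) q by (force simp: g5_def)
      then have "\<bar>g4 q * wave_tr (H q)\<bar> \<le> B4 * B5" unfolding abs_mult using B4 q by (intro mult_mono) auto
      then have "\<bar>g4 q * wave_tr (H q) + g2 q\<bar> \<le> B4 * B5 + B2"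
        using B2 q by (intro order_trans[OF abs_triangle_ineq] add_mono) auto
      then have "\<bar>(g4 q * wave_tr (H q) + g2 q) * g3 q\<bar> \<le> (B4 * B5 + B2) * B3"
        unfolding abs_mult[of _ "g3 q"] using B2 B3 B4 B5 q by (intro mult_mono) auto
      then show ?thesis
        unfolding tr[OF qU] using B1 q by (intro order_trans[OF abs_triangle_ineq4] add_mono) auto
    next
      case False
      then have "carleman_deriv s c \<beta> p v av Hv q = (\<lambda>h. 0)"
        unfolding v_def av_def by (intro carleman_field_eq_0) simp
      then show ?thesis using B1 B2 B3 B4 B5 by simp
    qed
    then show "bounded ((\<lambda>q. trace_map (carleman_deriv s c \<beta> p v av Hv q)) ` U)"
      by (intro boundedI[of _ "B1 + (B4 * B5 + B2) * B3"]) (elim imageE, simp)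
  qed
qed


text \<open>The charts become outflow charts of the Carleman field by
  \<open>carleman_outflow\<close>, so the integral of its divergence is nonpositive for every
  \<open>s \<ge> 1\<close>. Lower bounds on three ranges of the weight, below \<delta>, above
  \<delta> and near \<open>q0\<close>, contradict this for large \<open>s\<close> unless
  \<open>w q0 = 0\<close>.\<close>

theorem carleman_uniqueness:
  fixes p :: "'a::euclidean_space \<times> 'b::euclidean_space" and U S :: "('a \<times> 'b) set"
    and w :: "'a \<times> 'b \<Rightarrow> real" and a H
  assumes U: "open U" "bounded U" "U \<subseteq> S" and c: "0 < c" "c < 1" and d: "0 < d"
    and w: "C2_data U w a H" "continuous_on S w" "continuous_on S a"
    and K: "compact {q \<in> S. 0 \<le> cone_weight c d p q}"
    and box: "\<And>q. q \<in> U \<Longrightarrow> 0 < cone_weight c d p q \<Longrightarrow> \<bar>wave_tr (H q)\<bar> \<le> CX * (norm (a q) + \<bar>w q\<bar>)"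
    and chart: "\<And>q. q \<in> S \<Longrightarrow> 0 \<le> cone_weight c d p q \<Longrightarrow> \<exists>r \<rho> D e. 0 < r \<and>
      (\<forall>x\<in>ball q r. (\<rho> has_derivative (\<lambda>h. D x \<bullet> h)) (at x)) \<and> continuous_on (ball q r) D \<and>
      U \<inter> ball q r = {x \<in> ball q r. \<rho> x < 0} \<and> {x \<in> ball q r. \<rho> x \<le> 0} \<subseteq> S \<and>
      (\<forall>x\<in>ball q r. \<rho> x = 0 \<longrightarrow> D x \<bullet> e > 0 \<and> fst (D x) = 0 \<and>
        (0 < cone_weight c d p x \<longrightarrow> w x = 0 \<and> (\<exists>\<mu>. a x = \<mu> *\<^sub>R D x \<and> \<mu>\<^sup>2 * (D x \<bullet> cone_field c p x) \<le> 0)))"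
    and q0: "q0 \<in> U" "0 < cone_weight c d p q0"
  shows "w q0 = 0"
proof (rule ccontr)
  assume w0: "w q0 \<noteq> 0"
  define \<theta> where "\<theta> = cone_weight c d p"
  define K' where "K' = {q \<in> S. 0 \<le> \<theta> q}"
  have Kc: "compact K'" and KS: "K' \<subseteq> S" using K by (auto simp: K'_def \<theta>_def)
  define \<beta> where "\<beta> = cone_trace c TYPE('a \<times> 'b) - (2 + 2 * c)"
  define v where "v s = (\<lambda>q. bump_weight s (cone_weight c d p q) * w q)" for s
  define av where "av s = mult_grad (bump_weight s) (bump_weight' s) c d p w a" for s
  define Hv where "Hv s = mult_hess (bump_weight s) (bump_weight' s) (bump_weight'' s) c d p w a H" for s
  define tr where "tr s q = trace_map (carleman_deriv s c \<beta> p (v s) (av s) (Hv s) q)" for s q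
  have C1: "C1_field U S (carleman_field s c \<beta> p (v s) (av s)) (carleman_deriv s c \<beta> p (v s) (av s) (Hv s))" for s
    unfolding v_def av_def Hv_def
    by (rule C1_field_carleman[OF U(1,3) w K box])
  have le0: "(LINT q|lborel. indicator U q * tr s q) \<le> 0" if s: "1 \<le> s" for s
    unfolding tr_def
  proof (rule divergence_le_0[OF U Kc C1])
    fix q assume "q \<in> K'"
    then have q: "q \<in> S" "0 \<le> cone_weight c d p q" by (auto simp: K'_def \<theta>_def)
    from chart[OF this] obtain r \<rho> D e where r: "0 < r"
      "\<forall>x\<in>ball q r. (\<rho> has_derivative (\<lambda>h. D x \<bullet> h)) (at x)" "continuous_on (ball q r) D"
      "U \<inter> ball q r = {x \<in> ball q r. \<rho> x < 0}" "{x \<in> ball q r. \<rho> x \<le> 0} \<subseteq> S"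
      and bd: "\<forall>x\<in>ball q r. \<rho> x = 0 \<longrightarrow> D x \<bullet> e > 0 \<and> fst (D x) = 0 \<and>
        (0 < cone_weight c d p x \<longrightarrow> w x = 0 \<and> (\<exists>\<mu>. a x = \<mu> *\<^sub>R D x \<and> \<mu>\<^sup>2 * (D x \<bullet> cone_field c p x) \<le> 0))"
      by blast
    have "\<forall>x\<in>ball q r. \<rho> x = 0 \<longrightarrow> D x \<bullet> carleman_field s c \<beta> p (v s) (av s) x \<le> 0 \<and> D x \<bullet> e > 0"
    proof (intro ballI impI conjI)
      fix x assume x: "x \<in> ball q r" "\<rho> x = 0"
      show "D x \<bullet> e > 0" using bd x by blast
      show "D x \<bullet> carleman_field s c \<beta> p (v s) (av s) x \<le> 0"
        unfolding v_def av_def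
        by (rule carleman_outflow) (use s bd x in auto)
    qed
    then have "outflow_chart U S (carleman_field s c \<beta> p (v s) (av s)) q r"
      unfolding outflow_chart_def using r by blast
    then show "\<exists>r. outflow_chart U S (carleman_field s c \<beta> p (v s) (av s)) q r" ..
  next
    fix q assume q: "q \<in> U" "q \<notin> K'"
    then have "\<theta> q \<le> 0" using U by (auto simp: K'_def)
    then show "carleman_field s c \<beta> p (v s) (av s) q = 0"
      unfolding v_def av_def \<theta>_def by (intro carleman_field_eq_0)
  qed
  obtain L where L: "1 \<le> L" and Lb: "\<And>q. q \<in> K' \<Longrightarrow> norm (cone_field c p q) \<le> L"
      "\<And>q. q \<in> K' \<Longrightarrow> \<bar>cone_speed c p q\<bar> \<le> L" "\<bar>cone_trace c TYPE('a \<times> 'b)\<bar> \<le> L"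
      "\<And>q. q \<in> K' \<Longrightarrow> \<theta> q \<le> L" "\<And>q. q \<in> K' \<Longrightarrow> norm (a q) \<le> L" "\<And>q. q \<in> K' \<Longrightarrow> \<bar>w q\<bar> \<le> L" "CX \<le> L"
  proof -
    have "continuous_on K' (cone_field c p)" by (rule continuous_on_cone)
    from compact_bound[OF Kc this] obtain B1 where B1: "0 \<le> B1" "\<forall>q\<in>K'. norm (cone_field c p q) \<le> B1" by blast
    have "continuous_on K' (cone_speed c p)" by (rule continuous_on_cone)
    from compact_bound[OF Kc this] obtain B2 where B2: "0 \<le> B2" "\<forall>q\<in>K'. norm (cone_speed c p q) \<le> B2" by blast
    have "continuous_on K' \<theta>" unfolding \<theta>_def by (rule continuous_on_cone)
    from compact_bound[OF Kc this] obtain B3 where B3: "0 \<le> B3" "\<forall>q\<in>K'. norm (\<theta> q) \<le> B3" by blast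
    from compact_bound[OF Kc continuous_on_subset[OF w(3) KS]] obtain B4 where B4: "0 \<le> B4" "\<forall>q\<in>K'. norm (a q) \<le> B4" by blast
    from compact_bound[OF Kc continuous_on_subset[OF w(2) KS]] obtain B5 where B5: "0 \<le> B5" "\<forall>q\<in>K'. norm (w q) \<le> B5" by blast
    let ?L = "1 + B1 + B2 + B3 + B4 + B5 + \<bar>CX\<bar> + \<bar>cone_trace c TYPE('a \<times> 'b)\<bar>"
    show ?thesis
      by (rule that[of ?L]) (use B1 B2 B3 B4 B5 in \<open>force\<close>)+
  qed
  have lower: "tr s q \<ge> s * (2 - 2 * c) * (norm (av s q))\<^sup>2 + 16 * d * s ^ 3 * (v s q)\<^sup>2
    - (exp (s * \<theta> q) * (7 * L ^ 4 * norm (a q) + 14 * s * L ^ 4 * \<bar>w q\<bar>))\<^sup>2 / 4"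
    if q: "q \<in> U" "0 < \<theta> q" and s: "1 \<le> s" for s q
  proof -
    have qK: "q \<in> K'" using q U by (auto simp: K'_def)
    have pos: "0 < cone_weight c d p q" using q by (simp add: \<theta>_def)
    have "\<bar>wave_tr (H q)\<bar> \<le> CX * (norm (a q) + \<bar>w q\<bar>)" using box q by (simp add: \<theta>_def)
    also have "\<dots> \<le> L * (norm (a q) + \<bar>w q\<bar>)" using Lb(7) by (intro mult_right_mono) auto
    finally have bx: "\<bar>wave_tr (H q)\<bar> \<le> L * (norm (a q) + \<bar>w q\<bar>)" .
    show ?thesis
      unfolding tr_def v_def av_def Hv_def \<theta>_def
      by (rule carleman_lower_bound[OF w(1) U(1) q(1) c d s L pos Lb(1)[OF qK] Lb(2)[OF qK] Lb(3) _ bx \<beta>_def])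
         (use Lb(4)[OF qK] in \<open>simp add: \<theta>_def\<close>)
  qed
  \<comment> \<open>Leaves a gap of exponential size: absorption fails only for weights below
    \<open>\<delta>\<close>, while the weight is \<open>3 * \<delta>\<close> at \<open>q0\<close>
    and so stays above \<open>2 * \<delta>\<close> on a ball around it.\<close>
  define \<delta> where "\<delta> = \<theta> q0 / 3"
  have \<delta>: "0 < \<delta>" using q0 by (simp add: \<delta>_def \<theta>_def)
  \<comment> \<open>\<open>196 = 28^2 / 4\<close>, where 28 is a rounded-up 21 = 7 + 14 from the
    error term, and \<open>L^10\<close> is the square of \<open>L^5\<close>.\<close>
  define G where "G = 196 * L ^ 10"
  have G: "0 < G" using L by (simp add: G_def)
  \<comment> \<open>The cubic factor may be arbitrarily small here, so nothing can be absorbed: the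
    positive terms are dropped and the error is bounded by suprema.\<close>
  have low: "tr s q \<ge> - (G * s\<^sup>2 * exp (2 * s * \<delta>))" if q: "q \<in> U" "0 < \<theta> q" "\<theta> q \<le> \<delta>" and s: "1 \<le> s" for s q
  proof -
    have qK: "q \<in> K'" using q U by (auto simp: K'_def)
    have "7 * L ^ 4 * norm (a q) \<le> 7 * L ^ 4 * L" using Lb(5)[OF qK] L by (intro mult_left_mono) auto
    also have "\<dots> \<le> s * (7 * L ^ 4 * L)" using s L by simp
    finally have 1: "7 * L ^ 4 * norm (a q) \<le> s * (7 * L ^ 4 * L)" .
    have 2: "14 * s * L ^ 4 * \<bar>w q\<bar> \<le> 14 * s * L ^ 4 * L" using Lb(6)[OF qK] L s by (intro mult_left_mono) auto
    have "7 * L ^ 4 * norm (a q) + 14 * s * L ^ 4 * \<bar>w q\<bar> \<le> s * (7 * L ^ 4 * L) + 14 * s * L ^ 4 * L"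
      using 1 2 by (rule add_mono)
    also have "\<dots> = 21 * s * L ^ 5" by (simp add: power_numeral_reduce algebra_simps)
    also have "\<dots> \<le> 28 * s * L ^ 5" using s L by (intro mult_right_mono) auto
    finally have 3: "7 * L ^ 4 * norm (a q) + 14 * s * L ^ 4 * \<bar>w q\<bar> \<le> 28 * s * L ^ 5" .
    have 4: "0 \<le> 7 * L ^ 4 * norm (a q) + 14 * s * L ^ 4 * \<bar>w q\<bar>" using L s by simp
    have "exp (s * \<theta> q) \<le> exp (s * \<delta>)" using q s by (simp add: mult_left_mono)
    then have "exp (s * \<theta> q) * (7 * L ^ 4 * norm (a q) + 14 * s * L ^ 4 * \<bar>w q\<bar>) \<le> exp (s * \<delta>) * (28 * s * L ^ 5)"
      using 3 4 by (intro mult_mono) auto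
    then have "(exp (s * \<theta> q) * (7 * L ^ 4 * norm (a q) + 14 * s * L ^ 4 * \<bar>w q\<bar>))\<^sup>2 \<le> (exp (s * \<delta>) * (28 * s * L ^ 5))\<^sup>2"
      using 4 by (intro power_mono) auto
    also have "\<dots> = 4 * (G * s\<^sup>2 * exp (2 * s * \<delta>))"
      by (simp add: G_def power_mult_distrib power_mult[symmetric] exp_double[symmetric] mult_ac)
    finally have "(exp (s * \<theta> q) * (7 * L ^ 4 * norm (a q) + 14 * s * L ^ 4 * \<bar>w q\<bar>))\<^sup>2 / 4 \<le> G * s\<^sup>2 * exp (2 * s * \<delta>)"
      by simp
    moreover have "0 \<le> s * (2 - 2 * c) * (norm (av s q))\<^sup>2" "0 \<le> 16 * d * s ^ 3 * (v s q)\<^sup>2"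
      using s c d by auto
    ultimately show ?thesis using lower[OF q(1,2) s] by linarith
  qed
  define N where "N = 7 * L ^ 4 / \<delta> ^ 3 * (1 + (3 / \<delta> + 1) * L) + 14 * L ^ 4 / \<delta> ^ 3"
  \<comment> \<open>The two fractions are the thresholds for
    \<open>N^2 / 2 \<le> s * (2 - 2 * c)\<close> and \<open>N^2 / 2 \<le> 8 * d * s\<close>. The
    gradient error is then absorbed completely, and the zero-order error by half of
    \<open>16 * d * s^3 * v^2\<close>.\<close>
  define s0 where "s0 = 1 + N\<^sup>2 / (2 * (2 - 2 * c)) + N\<^sup>2 / (16 * d)"
  have s0: "1 \<le> s0" using c d by (simp add: s0_def)
  have high: "tr s q \<ge> 8 * d * s ^ 3 * (v s q)\<^sup>2" if q: "q \<in> U" "\<delta> \<le> \<theta> q" and s: "s0 \<le> s" for s q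
  proof -
    have s1: "1 \<le> s" using s s0 by linarith
    have pos: "0 < \<theta> q" using q \<delta> by linarith
    have qK: "q \<in> K'" using q pos U by (auto simp: K'_def)
    have "exp (s * \<theta> q) * (7 * L ^ 4 * norm (a q) + 14 * s * L ^ 4 * \<bar>w q\<bar>) \<le> N * (norm (av s q) + s * \<bar>v s q\<bar>)"
      unfolding v_def av_def \<theta>_def N_def
      by (rule error_absorption[OF L Lb(1)[OF qK] s1 \<delta>]) (use q in \<open>simp add: \<theta>_def\<close>)
    then have "(exp (s * \<theta> q) * (7 * L ^ 4 * norm (a q) + 14 * s * L ^ 4 * \<bar>w q\<bar>))\<^sup>2 \<le> (N * (norm (av s q) + s * \<bar>v s q\<bar>))\<^sup>2"
      using L s1 by (intro power_mono) auto
    also have "\<dots> \<le> N\<^sup>2 * (2 * (norm (av s q))\<^sup>2 + 2 * (s\<^sup>2 * (v s q)\<^sup>2))"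
    proof -
      have "(x + y)\<^sup>2 \<le> 2 * x\<^sup>2 + 2 * y\<^sup>2" for x y :: real
        using sum_squares_ge_zero[of "x - y" 0] by (simp add: power2_eq_square algebra_simps)
      from this[of "norm (av s q)" "s * \<bar>v s q\<bar>"] show ?thesis
        unfolding power_mult_distrib by (intro mult_left_mono) (simp_all add: power_mult_distrib)
    qed
    finally have 1: "(exp (s * \<theta> q) * (7 * L ^ 4 * norm (a q) + 14 * s * L ^ 4 * \<bar>w q\<bar>))\<^sup>2 / 4
        \<le> N\<^sup>2 / 2 * (norm (av s q))\<^sup>2 + N\<^sup>2 / 2 * (s\<^sup>2 * (v s q)\<^sup>2)"
      by (simp add: algebra_simps)
    have "N\<^sup>2 / (2 * (2 - 2 * c)) \<le> s" "N\<^sup>2 / (16 * d) \<le> s"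
    proof -
      have "0 \<le> N\<^sup>2 / (2 * (2 - 2 * c))" "0 \<le> N\<^sup>2 / (16 * d)" using c d by auto
      then show "N\<^sup>2 / (2 * (2 - 2 * c)) \<le> s" "N\<^sup>2 / (16 * d) \<le> s" using s unfolding s0_def by linarith+
    qed
    then have n: "N\<^sup>2 / 2 \<le> s * (2 - 2 * c)" "N\<^sup>2 / 2 \<le> 8 * d * s"
      using c d by (simp_all add: field_simps)
    have 2: "N\<^sup>2 / 2 * (norm (av s q))\<^sup>2 \<le> s * (2 - 2 * c) * (norm (av s q))\<^sup>2"
      using n(1) by (rule mult_right_mono) simp
    have "N\<^sup>2 / 2 * (s\<^sup>2 * (v s q)\<^sup>2) \<le> 8 * d * s * (s\<^sup>2 * (v s q)\<^sup>2)"
      using n(2) by (rule mult_right_mono) simp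
    also have "\<dots> = 8 * d * s ^ 3 * (v s q)\<^sup>2" by (simp add: power2_eq_square power3_eq_cube)
    finally show ?thesis using 1 2 lower[OF q(1) pos s1] by linarith
  qed
  obtain r where r: "0 < r" "ball q0 r \<subseteq> U" "\<And>x. x \<in> ball q0 r \<Longrightarrow> 2 * \<delta> \<le> \<theta> x"
    "\<And>x. x \<in> ball q0 r \<Longrightarrow> \<bar>w q0\<bar> / 2 \<le> \<bar>w x\<bar>"
  proof -
    have wc: "continuous_on U w" using w(2) U(3) by (rule continuous_on_subset)
    have "open (U \<inter> \<theta> -` {2 * \<delta><..})" unfolding \<theta>_def
      by (intro continuous_open_preimage U(1) continuous_on_cone) auto
    moreover have "open (U \<inter> (\<lambda>x. \<bar>w x\<bar>) -` {\<bar>w q0\<bar> / 2<..})"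
      by (intro continuous_open_preimage U(1) continuous_on_rabs wc open_greaterThan)
    ultimately have op: "open ((U \<inter> \<theta> -` {2 * \<delta><..}) \<inter> (U \<inter> (\<lambda>x. \<bar>w x\<bar>) -` {\<bar>w q0\<bar> / 2<..}))" by (rule open_Int)
    have "q0 \<in> (U \<inter> \<theta> -` {2 * \<delta><..}) \<inter> (U \<inter> (\<lambda>x. \<bar>w x\<bar>) -` {\<bar>w q0\<bar> / 2<..})"
      using q0 \<delta> w0 by (auto simp: \<delta>_def)
    with op obtain r where "0 < r" "ball q0 r \<subseteq> (U \<inter> \<theta> -` {2 * \<delta><..}) \<inter> (U \<inter> (\<lambda>x. \<bar>w x\<bar>) -` {\<bar>w q0\<bar> / 2<..})"
      unfolding open_contains_ball by blast
    then show ?thesis by (intro that[of r]) (auto dest!: subsetD)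
  qed
  \<comment> \<open>From \<open>high\<close> on the ball, where the weight is at least
    \<open>2 * \<delta>\<close> and \<open>w\<close> is at least half its value at \<open>q0\<close>
    in modulus.\<close>
  define g where "g = 8 * d * (\<delta> ^ 3 * (\<bar>w q0\<bar> / 2))\<^sup>2"
  have g: "0 < g" using d \<delta> w0 by (simp add: g_def)
  have ball: "tr s q \<ge> g * s ^ 3 * exp (4 * s * \<delta>)" if q: "q \<in> ball q0 r" and s: "s0 \<le> s" for s q
  proof -
    have s1: "1 \<le> s" using s s0 by linarith
    have th: "2 * \<delta> \<le> \<theta> q" "\<delta> \<le> \<theta> q" using r(3)[OF q] \<delta> by auto
    have "\<delta> ^ 3 \<le> \<theta> q ^ 3" using th \<delta> by (intro power_mono) auto
    moreover have "exp (2 * s * \<delta>) \<le> exp (s * \<theta> q)"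
      using mult_left_mono[OF th(1), of s] s1 by (simp add: mult_ac)
    ultimately have "\<delta> ^ 3 * exp (2 * s * \<delta>) * (\<bar>w q0\<bar> / 2) \<le> \<theta> q ^ 3 * exp (s * \<theta> q) * \<bar>w q\<bar>"
      using r(4)[OF q] \<delta> th by (intro mult_mono) auto
    also have "\<dots> = \<bar>v s q\<bar>"
      using th \<delta> unfolding v_def bump_weight_def \<theta>_def[symmetric] by (simp add: abs_mult)
    finally have "(\<delta> ^ 3 * exp (2 * s * \<delta>) * (\<bar>w q0\<bar> / 2))\<^sup>2 \<le> \<bar>v s q\<bar>\<^sup>2"
      using \<delta> by (intro power_mono) auto
    then have "8 * d * s ^ 3 * (\<delta> ^ 3 * exp (2 * s * \<delta>) * (\<bar>w q0\<bar> / 2))\<^sup>2 \<le> 8 * d * s ^ 3 * (v s q)\<^sup>2"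
      using d s1 by (intro mult_left_mono) auto
    moreover have "8 * d * s ^ 3 * (\<delta> ^ 3 * exp (2 * s * \<delta>) * (\<bar>w q0\<bar> / 2))\<^sup>2 = g * s ^ 3 * exp (4 * s * \<delta>)"
    proof -
      have "exp (4 * s * \<delta>) = (exp (2 * s * \<delta>))\<^sup>2" by (simp add: exp_double[symmetric])
      then show ?thesis by (simp add: g_def power_mult_distrib power_divide)
    qed
    moreover have "q \<in> U" using q r(2) by blast
    ultimately show ?thesis using high[OF _ th(2) s] by linarith
  qed
  define mB where "mB = measure lborel (ball q0 r)"
  define mU where "mU = measure lborel U"
  have mB: "0 < mB" using r(1) by (simp add: mB_def content_ball_pos)
  have iB: "integrable lborel (indicator (ball q0 r) :: _ \<Rightarrow> real)"
    using emeasure_bounded_finite[of "ball q0 r"] by (intro integrable_real_indicator) auto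
  have iU: "integrable lborel (indicator U :: _ \<Rightarrow> real)"
    using U emeasure_bounded_finite[of U] by (intro integrable_real_indicator) auto
  \<comment> \<open>Integrating the lower bounds and dividing by
    \<open>s^2 * exp (2 * s * \<delta>)\<close> leaves one factor \<open>s\<close> and one
    exponential on the left; bounding the latter below by 1 still leaves a left side that grows
    linearly in \<open>s\<close>.\<close>
  have main: "g * s * mB \<le> G * mU" if s: "s0 \<le> s" for s
  proof -
    have s1: "1 \<le> s" using s s0 by linarith
    define A where "A = g * s ^ 3 * exp (4 * s * \<delta>)"
    define B where "B = G * s\<^sup>2 * exp (2 * s * \<delta>)"
    have A0: "0 \<le> A" and B0: "0 \<le> B" using g G s1 by (auto simp: A_def B_def)
    have "A * indicator (ball q0 r) q - B * indicator U q \<le> indicator U q * tr s q" for q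
    proof (cases "q \<in> U")
      case qU: True
      consider "q \<in> ball q0 r" | "q \<notin> ball q0 r" "\<delta> \<le> \<theta> q" | "q \<notin> ball q0 r" "\<theta> q < \<delta>" "0 < \<theta> q" | "q \<notin> ball q0 r" "\<theta> q \<le> 0"
        by linarith
      then show ?thesis
      proof cases
        case 1
        then show ?thesis using ball[OF 1 s] qU B0 by (simp add: A_def[symmetric])
      next
        case 2
        have "0 \<le> 8 * d * s ^ 3 * (v s q)\<^sup>2" using d s1 by simp
        then show ?thesis using high[OF qU 2(2) s] 2(1) qU B0 by simp
      next
        case 3
        then show ?thesis using low[OF qU 3(3) less_imp_le[OF 3(2)] s1] qU by (simp add: B_def)
      next
        case 4
        have "carleman_deriv s c \<beta> p (v s) (av s) (Hv s) q = (\<lambda>h. 0)"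
          unfolding v_def av_def using 4 by (intro carleman_field_eq_0) (simp add: \<theta>_def)
        then have "tr s q = 0" by (simp add: tr_def)
        then show ?thesis using 4(1) qU B0 by simp
      qed
    next
      case False
      then have "q \<notin> ball q0 r" using r(2) by auto
      then show ?thesis using False by simp
    qed
    then have "(LINT q|lborel. A * indicator (ball q0 r) q - B * indicator U q) \<le> (LINT q|lborel. indicator U q * tr s q)"
      by (intro integral_mono) (use iB iU integrable_trace_map[OF U(1,2) C1] in \<open>auto simp: tr_def\<close>)
    then have "A * mB - B * mU \<le> 0"
      using le0[OF s1] iB iU by (simp add: mB_def mU_def)
    moreover have "A * mB = (s\<^sup>2 * exp (2 * s * \<delta>)) * (g * s * exp (2 * s * \<delta>) * mB)"
    proof -
      have "exp (4 * s * \<delta>) = exp (2 * s * \<delta>) * exp (2 * s * \<delta>)" by (simp add: exp_add[symmetric])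
      then show ?thesis by (simp add: A_def power2_eq_square power3_eq_cube)
    qed
    moreover have "B * mU = (s\<^sup>2 * exp (2 * s * \<delta>)) * (G * mU)" by (simp add: B_def)
    ultimately have "(s\<^sup>2 * exp (2 * s * \<delta>)) * (g * s * exp (2 * s * \<delta>) * mB) \<le> (s\<^sup>2 * exp (2 * s * \<delta>)) * (G * mU)"
      by linarith
    moreover have "0 < s\<^sup>2 * exp (2 * s * \<delta>)" using s1 by simp
    ultimately have "g * s * exp (2 * s * \<delta>) * mB \<le> G * mU" by (rule mult_left_le_imp_le)
    moreover have "g * s * 1 * mB \<le> g * s * exp (2 * s * \<delta>) * mB"
      using g s1 mB \<delta> by (intro mult_right_mono mult_left_mono) auto
    ultimately show ?thesis by simp
  qed
  \<comment> \<open>Makes the left side of \<open>main\<close> exceed the right one by exactly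
    \<open>g * mB * s0\<close>.\<close>
  define s where "s = s0 + G * mU / (g * mB)"
  have mU: "0 \<le> mU" by (simp add: mU_def)
  have "s0 \<le> s" using G mU g mB by (simp add: s_def)
  from main[OF this] have "g * mB * s \<le> G * mU" by (simp add: mult_ac)
  moreover have "g * mB * s = g * mB * s0 + G * mU" using g mB by (simp add: s_def field_simps)
  moreover have "0 < g * mB * s0" using g mB s0 by simp
  ultimately show False by linarith
qed



section \<open>Boundary charts and normals\<close>

text \<open>The secant directions \<open>d n\<close> may vary, because a curved boundary contains no
  straight segment in the limit direction \<open>D\<close>. The derivative is taken within
  \<open>S\<close>, so \<open>q\<close> may lie on the boundary of \<open>S\<close>.\<close>

lemma derivative_zero_along:
  assumes f: "(f has_derivative L) (at q within S)"
    and h: "h \<longlonglongrightarrow> 0" "\<And>n::nat. 0 < h n" and d: "d \<longlonglongrightarrow> D"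
    and S: "\<And>n. q + h n *\<^sub>R d n \<in> S" "\<And>n. f (q + h n *\<^sub>R d n) = f q"
  shows "L D = 0"
proof -
  have lin: "bounded_linear L" using f has_derivative_bounded_linear by blast
  have Ld: "(\<lambda>n. L (d n)) \<longlonglongrightarrow> L D" by (rule bounded_linear.tendsto[OF lin d])
  have "norm (L D) \<le> e * norm D" if e: "0 < e" for e
  proof -
    obtain r where r: "0 < r" "\<And>y. y \<in> S \<Longrightarrow> norm (y - q) < r \<Longrightarrow> norm (f y - f q - L (y - q)) \<le> e * norm (y - q)"
      using f e unfolding has_derivative_within_alt by blast
    have "(\<lambda>n. h n *\<^sub>R d n) \<longlonglongrightarrow> 0 *\<^sub>R D" by (intro tendsto_intros h d)
    then have "(\<lambda>n. norm (h n *\<^sub>R d n)) \<longlonglongrightarrow> 0" unfolding scaleR_zero_left by (rule tendsto_norm_zero)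
    then have "\<forall>\<^sub>F n in sequentially. norm (h n *\<^sub>R d n) < r" using r(1) by (rule order_tendstoD)
    then have "\<forall>\<^sub>F n in sequentially. norm (L (d n)) \<le> e * norm (d n)"
    proof (rule eventually_mono)
      fix n assume "norm (h n *\<^sub>R d n) < r"
      then have "norm (L (h n *\<^sub>R d n)) \<le> e * norm (h n *\<^sub>R d n)"
        using r(2)[OF S(1), of n] S(2)[of n] by simp
      then have "h n * norm (L (d n)) \<le> h n * (e * norm (d n))"
        using h(2)[of n] by (simp add: linear_scale[OF bounded_linear.linear[OF lin]] mult_ac)
      then show "norm (L (d n)) \<le> e * norm (d n)" using h(2)[of n] by simp
    qed
    moreover have "(\<lambda>n. norm (L (d n))) \<longlonglongrightarrow> norm (L D)" by (intro tendsto_norm Ld)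
    moreover have "(\<lambda>n. e * norm (d n)) \<longlonglongrightarrow> e * norm D" by (intro tendsto_intros d)
    ultimately show ?thesis by (intro tendsto_le[OF sequentially_bot]) auto
  qed
  then have "norm (L D) \<le> 0 + e" if "0 < e" for e
  proof -
    have "norm (L D) \<le> e / (norm D + 1) * norm D"
      using that by (intro \<open>\<And>e. 0 < e \<Longrightarrow> norm (L D) \<le> e * norm D\<close>) (simp add: add_nonneg_pos)
    also have "\<dots> = e * (norm D / (norm D + 1))" by simp
    also have "\<dots> \<le> e * 1" using that
      by (intro mult_left_mono) (auto simp: divide_le_eq_1 add_nonneg_pos)
    finally show ?thesis by simp
  qed
  then have "norm (L D) \<le> 0" by (rule field_le_epsilon)
  then show ?thesis by simp
qed

lemma gradient_direction_sign:
  assumes \<rho>: "(\<rho> has_derivative (\<lambda>h. D \<bullet> h)) (at y)" and d: "D \<bullet> d > 0"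
  shows "\<exists>e>0. \<forall>h. 0 < h \<longrightarrow> h < e \<longrightarrow> \<rho> (y + h *\<^sub>R d) > \<rho> y \<and> \<rho> (y - h *\<^sub>R d) < \<rho> y"
proof -
  have der: "((\<lambda>h. \<rho> (y + h *\<^sub>R u)) has_real_derivative D \<bullet> u) (at 0)" for u
  proof -
    have "((\<lambda>h. y + h *\<^sub>R u) has_derivative (\<lambda>k. k *\<^sub>R u)) (at 0)"
      by (auto intro!: derivative_eq_intros)
    from has_derivative_compose[OF this, of \<rho> "\<lambda>h. D \<bullet> h"] \<rho>
    show ?thesis by (simp add: has_field_derivative_def mult_commute_abs)
  qed
  obtain e1 where e1: "0 < e1" "\<And>h. 0 < h \<Longrightarrow> h < e1 \<Longrightarrow> \<rho> y < \<rho> (y + h *\<^sub>R d)"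
    using DERIV_pos_inc_right[OF der d] by auto
  have "D \<bullet> (- d) < 0" using d by simp
  from DERIV_neg_dec_right[OF der this]
  obtain e2 where e2: "0 < e2" "\<And>h. 0 < h \<Longrightarrow> h < e2 \<Longrightarrow> \<rho> (y - h *\<^sub>R d) < \<rho> y" by auto
  show ?thesis by (rule exI[of _ "min e1 e2"]) (use e1 e2 in auto)
qed

text \<open>The local part of \<open>outward_unit_normal\<close> without its base point, so that one
  chart serves all nearby boundary points.\<close>

definition C1_chart where
  "C1_chart \<Omega> B \<rho> D \<longleftrightarrow> open B \<and> (\<forall>w\<in>B. (\<rho> has_derivative (\<lambda>h. D w \<bullet> h)) (at w) \<and> D w \<noteq> 0) \<and>
     continuous_on B D \<and> \<Omega> \<inter> B = {w \<in> B. \<rho> w < 0}"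

lemma C1_chart_mem: "C1_chart \<Omega> B \<rho> D \<Longrightarrow> x \<in> B \<Longrightarrow> x \<in> \<Omega> \<longleftrightarrow> \<rho> x < 0"
proof -
  assume "C1_chart \<Omega> B \<rho> D" and x: "x \<in> B"
  then have "\<Omega> \<inter> B = {w \<in> B. \<rho> w < 0}" by (simp add: C1_chart_def)
  then have "x \<in> \<Omega> \<inter> B \<longleftrightarrow> x \<in> {w \<in> B. \<rho> w < 0}" by (rule arg_cong)
  then show ?thesis using x by simp
qed

text \<open>Where \<open>\<rho> > 0\<close> there is a neighbourhood free of points of
  \<open>\<Omega>\<close>; where \<open>\<rho> = 0\<close>, a small step against the nonzero
  gradient leads into \<open>\<Omega>\<close>.\<close>

lemma C1_chart_frontier:
  fixes \<Omega> :: "'a::euclidean_space set"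
  assumes "C1_chart \<Omega> B \<rho> D" "open \<Omega>" "x \<in> B"
  shows "x \<in> frontier \<Omega> \<longleftrightarrow> \<rho> x = 0"
proof -
  have B: "open B" "(\<rho> has_derivative (\<lambda>h. D x \<bullet> h)) (at x)" "D x \<noteq> 0" and OB: "\<Omega> \<inter> B = {w \<in> B. \<rho> w < 0}"
    and cont: "continuous_on B \<rho>"
    using assms unfolding C1_chart_def
    by (auto intro!: continuous_at_imp_continuous_on dest: has_derivative_continuous)
  have pos: "D x \<bullet> D x > 0" using B by simp
  show ?thesis
  proof
    assume x: "x \<in> frontier \<Omega>"
    then have "x \<notin> \<Omega>" using assms(2) by (simp add: frontier_def interior_open)
    then have "\<not> \<rho> x < 0" using OB assms(3) by auto
    moreover have "\<not> \<rho> x > 0"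
    proof
      assume "\<rho> x > 0"
      then have "x \<in> B \<inter> \<rho> -` {0<..}" using assms(3) by auto
      moreover have "open (B \<inter> \<rho> -` {0<..})" using cont B(1) by (intro continuous_open_preimage) auto
      moreover have "x \<in> closure \<Omega>" using x by (simp add: frontier_def)
      ultimately obtain z where "z \<in> \<Omega>" "z \<in> B \<inter> \<rho> -` {0<..}"
        using closure_iff_nhds_not_empty[of x \<Omega>] by blast
      then show False using C1_chart_mem[OF assms(1), of z] by auto
    qed
    ultimately show "\<rho> x = 0" by simp
  next
    assume 0: "\<rho> x = 0"
    then have nO: "x \<notin> \<Omega>" using C1_chart_mem[OF assms(1,3)] by simp
    obtain e where e: "0 < e" "\<forall>h. 0 < h \<longrightarrow> h < e \<longrightarrow> \<rho> (x - h *\<^sub>R D x) < \<rho> x"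
      using gradient_direction_sign[OF B(2) pos] by blast
    have "x \<in> closure \<Omega>"
      unfolding closure_approachable
    proof (intro allI impI)
      fix \<epsilon> :: real assume "0 < \<epsilon>"
      obtain r where r: "0 < r" "ball x r \<subseteq> B" using B(1) assms(3) open_contains_ball by blast
      define h where "h = min (e / 2) (min r \<epsilon> / (2 * norm (D x)))"
      have h: "0 < h" "h < e" using e r \<open>0 < \<epsilon>\<close> B(3) by (auto simp: h_def)
      have "h * norm (D x) \<le> min r \<epsilon> / (2 * norm (D x)) * norm (D x)" by (intro mult_right_mono) (auto simp: h_def)
      also have "\<dots> < min r \<epsilon>" using B(3) r \<open>0 < \<epsilon>\<close> by (simp add: min_def)
      finally have dist: "dist (x - h *\<^sub>R D x) x < min r \<epsilon>" using h by (simp add: dist_norm)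
      then have "x - h *\<^sub>R D x \<in> B" using r by (auto simp: dist_commute)
      then have "x - h *\<^sub>R D x \<in> \<Omega>" using e(2)[rule_format, OF h] 0 C1_chart_mem[OF assms(1)] by auto
      moreover have "dist (x - h *\<^sub>R D x) x < \<epsilon>" using dist by (simp only: min_less_iff_conj)
      ultimately show "\<exists>z\<in>\<Omega>. dist z x < \<epsilon>" by blast
    qed
    then show "x \<in> frontier \<Omega>" using nO assms(2) by (simp add: frontier_def interior_open)
  qed
qed

text \<open>Tangent directions are limits of secants: between \<open>y + h(\<xi> - \<epsilon>D)\<close> and \<open>y + h(\<xi> + \<epsilon>D)\<close> the
  defining function changes sign.\<close>

lemma frontier_secants:
  fixes \<Omega> :: "'a::euclidean_space set"
  assumes ch: "C1_chart \<Omega> B \<rho> D" "open \<Omega>" and y: "y \<in> B" "\<rho> y = 0" and \<xi>: "D y \<bullet> \<xi> = 0"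
    and N: "open N" "y \<in> N"
  shows "\<exists>h d. h \<longlonglongrightarrow> 0 \<and> (\<forall>n::nat. 0 < h n) \<and> d \<longlonglongrightarrow> \<xi> \<and> (\<forall>n. y + h n *\<^sub>R d n \<in> frontier \<Omega> \<inter> N)"
proof -
  have B: "open B" "(\<rho> has_derivative (\<lambda>h. D y \<bullet> h)) (at y)" "D y \<noteq> 0" and cont: "continuous_on B \<rho>"
    using assms unfolding C1_chart_def
    by (auto intro!: continuous_at_imp_continuous_on dest: has_derivative_continuous)
  have pos: "D y \<bullet> D y > 0" using B by simp
  obtain r where r: "0 < r" "ball y r \<subseteq> B \<inter> N"
    using open_contains_ball[of "B \<inter> N"] B(1) N y by blast
  have ex: "\<exists>h d. 0 < h \<and> h < 1 / Suc n \<and> norm (d - \<xi>) \<le> norm (D y) / Suc n \<and> y + h *\<^sub>R d \<in> frontier \<Omega> \<inter> N" for n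
  proof -
    define \<epsilon> where "\<epsilon> = 1 / real (Suc n)"
    have \<epsilon>: "0 < \<epsilon>" by (simp add: \<epsilon>_def)
    have p1: "D y \<bullet> (\<xi> + \<epsilon> *\<^sub>R D y) > 0" and p2: "D y \<bullet> (\<epsilon> *\<^sub>R D y - \<xi>) > 0"
      using \<xi> pos \<epsilon> by (simp_all add: inner_add_right inner_diff_right)
    obtain e1 where e1: "0 < e1" "\<forall>h. 0 < h \<longrightarrow> h < e1 \<longrightarrow> \<rho> (y + h *\<^sub>R (\<xi> + \<epsilon> *\<^sub>R D y)) > \<rho> y"
      using gradient_direction_sign[OF B(2) p1] by blast
    obtain e2 where e2: "0 < e2" "\<forall>h. 0 < h \<longrightarrow> h < e2 \<longrightarrow> \<rho> (y - h *\<^sub>R (\<epsilon> *\<^sub>R D y - \<xi>)) < \<rho> y"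
      using gradient_direction_sign[OF B(2) p2] by blast
    define C where "C = norm \<xi> + \<epsilon> * norm (D y)"
    have C: "0 < C" using \<epsilon> B(3) by (simp add: C_def add_nonneg_pos)
    \<comment> \<open>\<open>h < e1\<close> and \<open>h < e2\<close> give opposite signs at the two
      ends of the segment, \<open>h < \<epsilon>\<close> forces the step lengths to 0, and the last
      bound keeps the whole segment in the ball.\<close>
    define h where "h = min (min (e1 / 2) (e2 / 2)) (min (\<epsilon> / 2) (r / (2 * C)))"
    have h: "0 < h" "h < e1" "h < e2" "h < \<epsilon>" "h \<le> r / (2 * C)"
      using e1(1) e2(1) \<epsilon> r(1) C by (auto simp: h_def)
    have hC: "h * C < r"
    proof -
      have "h * C \<le> r / (2 * C) * C" using h(5) C by (intro mult_right_mono) auto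
      also have "\<dots> < r" using C r(1) by simp
      finally show ?thesis .
    qed
    have inb: "y + h *\<^sub>R (\<xi> + \<theta> *\<^sub>R D y) \<in> ball y r" if "\<bar>\<theta>\<bar> \<le> \<epsilon>" for \<theta>
    proof -
      have "norm (\<xi> + \<theta> *\<^sub>R D y) \<le> norm \<xi> + \<bar>\<theta>\<bar> * norm (D y)" by (rule norm_triangle_le) simp
      also have "\<dots> \<le> C" unfolding C_def using that by (intro add_mono mult_right_mono) auto
      finally have "h * norm (\<xi> + \<theta> *\<^sub>R D y) \<le> h * C" using h(1) by (intro mult_left_mono) auto
      then have "h * norm (\<xi> + \<theta> *\<^sub>R D y) < r" using hC by (rule le_less_trans)
      then have "norm (h *\<^sub>R (\<xi> + \<theta> *\<^sub>R D y)) < r" using h(1) by simp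
      then show ?thesis by (simp add: dist_norm)
    qed
    have "\<exists>\<theta>\<ge>- \<epsilon>. \<theta> \<le> \<epsilon> \<and> \<rho> (y + h *\<^sub>R (\<xi> + \<theta> *\<^sub>R D y)) = 0"
    proof (rule IVT')
      have eq: "y - h *\<^sub>R (\<epsilon> *\<^sub>R D y - \<xi>) = y + h *\<^sub>R (\<xi> + (- \<epsilon>) *\<^sub>R D y)" by (simp add: algebra_simps)
      have "\<rho> (y - h *\<^sub>R (\<epsilon> *\<^sub>R D y - \<xi>)) < \<rho> y" using e2(2) h by blast
      then show "\<rho> (y + h *\<^sub>R (\<xi> + (- \<epsilon>) *\<^sub>R D y)) \<le> 0" unfolding eq y(2) by (rule less_imp_le)
      show "0 \<le> \<rho> (y + h *\<^sub>R (\<xi> + \<epsilon> *\<^sub>R D y))" using e1(2)[rule_format, of h] h y(2) by simp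
      show "- \<epsilon> \<le> \<epsilon>" using \<epsilon> by simp
      show "continuous_on {- \<epsilon>..\<epsilon>} (\<lambda>\<theta>. \<rho> (y + h *\<^sub>R (\<xi> + \<theta> *\<^sub>R D y)))"
        by (rule continuous_on_compose2[OF cont]) (use inb r(2) in \<open>force intro!: continuous_intros\<close>)+
    qed
    then obtain \<theta> where \<theta>: "\<bar>\<theta>\<bar> \<le> \<epsilon>" "\<rho> (y + h *\<^sub>R (\<xi> + \<theta> *\<^sub>R D y)) = 0" by (auto simp: abs_le_iff intro: minus_le_iff[THEN iffD1])
    have "norm ((\<xi> + \<theta> *\<^sub>R D y) - \<xi>) \<le> norm (D y) / Suc n"
      using mult_right_mono[OF \<theta>(1), of "norm (D y)"] by (simp add: \<epsilon>_def)
    moreover have "y + h *\<^sub>R (\<xi> + \<theta> *\<^sub>R D y) \<in> frontier \<Omega> \<inter> N"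
      using C1_chart_frontier[OF ch] inb[OF \<theta>(1)] r(2) \<theta>(2) by auto
    ultimately show ?thesis using h(1,4) unfolding \<epsilon>_def by blast
  qed
  then have "\<forall>n. \<exists>hd. 0 < fst hd \<and> fst hd < 1 / Suc n \<and> norm (snd hd - \<xi>) \<le> norm (D y) / Suc n
      \<and> y + fst hd *\<^sub>R snd hd \<in> frontier \<Omega> \<inter> N" by auto
  from choice[OF this] obtain g where g: "\<And>n. 0 < fst (g n)" "\<And>n. fst (g n) < 1 / Suc n"
    "\<And>n. norm (snd (g n) - \<xi>) \<le> norm (D y) / Suc n" "\<And>n. y + fst (g n) *\<^sub>R snd (g n) \<in> frontier \<Omega> \<inter> N" by blast
  have lim: "(\<lambda>n. 1 / real (Suc n)) \<longlonglongrightarrow> 0"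
    using LIMSEQ_inverse_real_of_nat by (simp add: divide_inverse)
  show ?thesis
  proof (intro exI[of _ "\<lambda>n. fst (g n)"] exI[of _ "\<lambda>n. snd (g n)"] conjI allI)
    show "(\<lambda>n. fst (g n)) \<longlonglongrightarrow> 0"
      by (rule tendsto_sandwich[OF _ _ tendsto_const lim]) (use g in \<open>auto simp: less_imp_le simp del: of_nat_Suc\<close>)
    have "(\<lambda>n. norm (D y) * (1 / real (Suc n))) \<longlonglongrightarrow> norm (D y) * 0" by (intro tendsto_mult tendsto_const lim)
    then have lim': "(\<lambda>n. norm (D y) / real (Suc n)) \<longlonglongrightarrow> 0" by simp
    have "(\<lambda>n. norm (snd (g n) - \<xi>)) \<longlonglongrightarrow> 0"
      by (rule tendsto_sandwich[OF _ _ tendsto_const lim']) (use g in \<open>auto simp del: of_nat_Suc\<close>)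
    then have "(\<lambda>n. snd (g n) - \<xi>) \<longlonglongrightarrow> 0" by (rule tendsto_norm_zero_cancel)
    then show "(\<lambda>n. snd (g n)) \<longlonglongrightarrow> \<xi>" by (rule LIM_zero_cancel)
  qed (use g in auto)
qed

text \<open>The part \<xi> of \<open>A\<close> orthogonal to \<open>D y\<close> is a tangent
  direction, hence a limit of secants along which \<open>f\<close> is constant. So
  \<open>A \<bullet> \<xi> = 0\<close>, while this inner product is also the squared norm of \<xi>.
  Applied to solutions within the closed domain, and to a second defining function.\<close>

lemma gradient_normal_if_vanishes_on_frontier:
  fixes \<Omega> :: "'a::euclidean_space set"
  assumes ch: "C1_chart \<Omega> B \<rho> D" "open \<Omega>" and y: "y \<in> B" "\<rho> y = 0"
    and f: "(f has_derivative (\<lambda>h. A \<bullet> h)) (at y within S)"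
    and N: "open N" "y \<in> N" "\<And>x. x \<in> frontier \<Omega> \<inter> N \<Longrightarrow> x \<in> S \<and> f x = f y"
  obtains \<mu> where "A = \<mu> *\<^sub>R D y"
proof -
  have D0: "D y \<noteq> 0" using ch y unfolding C1_chart_def by auto
  define \<mu> where "\<mu> = (A \<bullet> D y) / (D y \<bullet> D y)"
  define \<xi> where "\<xi> = A - \<mu> *\<^sub>R D y"
  have "D y \<bullet> \<xi> = 0" using D0 by (simp add: \<xi>_def \<mu>_def inner_diff_right inner_commute)
  from frontier_secants[OF ch y this N(1,2)] obtain h d where
    hd: "h \<longlonglongrightarrow> 0" "\<forall>n::nat. 0 < h n" "d \<longlonglongrightarrow> \<xi>" "\<forall>n. y + h n *\<^sub>R d n \<in> frontier \<Omega> \<inter> N" by blast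
  have "A \<bullet> \<xi> = 0"
  proof (rule derivative_zero_along[OF f hd(1) _ hd(3)])
    show "0 < h n" for n using hd(2) by blast
    show "y + h n *\<^sub>R d n \<in> S" "f (y + h n *\<^sub>R d n) = f y" for n using N(3) hd(4) by blast+
  qed
  moreover have "\<xi> \<bullet> \<xi> = A \<bullet> \<xi> - \<mu> * (D y \<bullet> \<xi>)" by (subst (1) \<xi>_def) (simp add: inner_diff_left)
  ultimately have "\<xi> \<bullet> \<xi> = 0" using \<open>D y \<bullet> \<xi> = 0\<close> by simp
  then have "A = \<mu> *\<^sub>R D y" by (simp add: \<xi>_def)
  then show ?thesis by (rule that)
qed

lemma outward_unit_normal_chart:
  assumes "outward_unit_normal \<Omega> y \<nu>"
  obtains B \<rho> D where "C1_chart \<Omega> B \<rho> D" "y \<in> B" "\<rho> y = 0" "\<nu> = D y /\<^sub>R norm (D y)"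
proof -
  obtain B \<rho> D where "open B" "y \<in> B" "\<forall>w\<in>B. (GDERIV \<rho> w :> D w) \<and> D w \<noteq> 0" "continuous_on B D"
    "\<Omega> \<inter> B = {w \<in> B. \<rho> w < 0}" "\<rho> y = 0" "\<nu> = D y /\<^sub>R norm (D y)"
    using assms unfolding outward_unit_normal_def by blast
  then show ?thesis
    by (intro that[of B \<rho> D]) (simp_all add: C1_chart_def gderiv_def inner_commute[of _ "D _"])
qed

text \<open>Different boundary points may have their normals defined by different charts, whereas
  the divergence argument uses one chart on a whole ball. Both gradients are normal, hence
  proportional; a negative factor would put the points \<open>y - h *\<^sub>R D1 y\<close> inside
  \<open>\<Omega>\<close> for one chart and outside for the other.\<close>

lemma outward_unit_normal_unique:
  fixes \<Omega> :: "'a::euclidean_space set"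
  assumes "open \<Omega>" "outward_unit_normal \<Omega> y \<nu>" and ch: "C1_chart \<Omega> B \<rho> D" and y: "y \<in> B" "\<rho> y = 0"
  shows "D y = norm (D y) *\<^sub>R \<nu>"
proof -
  obtain B1 \<rho>1 D1 where c1: "C1_chart \<Omega> B1 \<rho>1 D1" "y \<in> B1" "\<rho>1 y = 0" and \<nu>: "\<nu> = D1 y /\<^sub>R norm (D1 y)"
    using outward_unit_normal_chart[OF assms(2)] by metis
  have B1: "open B1" "(\<rho>1 has_derivative (\<lambda>h. D1 y \<bullet> h)) (at y)" "D1 y \<noteq> 0" using c1 by (auto simp: C1_chart_def)
  have B: "open B" "(\<rho> has_derivative (\<lambda>h. D y \<bullet> h)) (at y)" "D y \<noteq> 0" and OB: "\<Omega> \<inter> B = {w \<in> B. \<rho> w < 0}"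
    using ch y by (auto simp: C1_chart_def)
  obtain \<mu> where \<mu>: "D y = \<mu> *\<^sub>R D1 y"
    by (rule gradient_normal_if_vanishes_on_frontier[OF c1(1) assms(1) c1(2,3) B(2) B(1) y(1)])
       (use C1_chart_frontier[OF ch assms(1)] y in auto)
  have "\<not> \<mu> < 0"
  proof
    assume "\<mu> < 0"
    then have p: "D y \<bullet> (- D1 y) > 0" using B1 \<mu> by (simp add: mult_neg_pos)
    have p1: "D1 y \<bullet> D1 y > 0" using B1 by simp
    obtain e where e: "0 < e" "\<forall>h. 0 < h \<longrightarrow> h < e \<longrightarrow> \<rho> (y + h *\<^sub>R (- D1 y)) > \<rho> y"
      using gradient_direction_sign[OF B(2) p] by blast
    obtain e1 where e1: "0 < e1" "\<forall>h. 0 < h \<longrightarrow> h < e1 \<longrightarrow> \<rho>1 (y - h *\<^sub>R D1 y) < \<rho>1 y"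
      using gradient_direction_sign[OF B1(2) p1] by blast
    obtain r where r: "0 < r" "ball y r \<subseteq> B \<inter> B1" using open_contains_ball[of "B \<inter> B1"] B(1) B1(1) y c1 by blast
    define h where "h = min (min (e / 2) (e1 / 2)) (r / (2 * norm (D1 y)))"
    have h: "0 < h" "h < e" "h < e1" "h \<le> r / (2 * norm (D1 y))" using e e1 r B1(3) by (auto simp: h_def)
    have "h * norm (D1 y) \<le> r / (2 * norm (D1 y)) * norm (D1 y)" using h(4) by (intro mult_right_mono) auto
    also have "\<dots> < r" using B1(3) r(1) by simp
    finally have "y - h *\<^sub>R D1 y \<in> ball y r" using h(1) by (simp add: dist_norm)
    then have "y - h *\<^sub>R D1 y \<in> B \<inter> B1" using r by auto
    moreover have "\<rho> (y - h *\<^sub>R D1 y) > 0" "\<rho>1 (y - h *\<^sub>R D1 y) < 0"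
      using e(2)[rule_format, OF h(1,2)] e1(2)[rule_format, OF h(1,3)] y c1(3) by simp_all
    ultimately show False
      using C1_chart_mem[OF ch, of "y - h *\<^sub>R D1 y"] C1_chart_mem[OF c1(1), of "y - h *\<^sub>R D1 y"] by simp
  qed
  then have "0 < \<mu>" using \<mu> B(3) by (cases "\<mu> = 0") auto
  then show ?thesis using B1(3) by (simp add: \<mu> \<nu>)
qed


section \<open>Solutions of the ultrahyperbolic equation\<close>

lemma sum_Basis_cart:
  fixes f :: "real ^ 'n \<Rightarrow> 'b::comm_monoid_add"
  shows "(\<Sum>b\<in>Basis. f b) = (\<Sum>i\<in>UNIV. f (axis i 1))"
proof -
  have B: "(Basis :: (real ^ 'n) set) = range (\<lambda>i. axis i 1)" by (auto simp: Basis_vec_def)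
  have "inj (\<lambda>i::'n. axis i (1::real))" by (auto simp: inj_on_def axis_eq_axis)
  then show ?thesis unfolding B by (simp add: sum.reindex)
qed

text \<open>Taken within \<open>S\<close>, so that it has a meaning at lateral boundary points; at
  points of an open subset of \<open>S\<close> it is the ordinary gradient.\<close>

definition grad_on :: "'a::euclidean_space set \<Rightarrow> ('a \<Rightarrow> real) \<Rightarrow> 'a \<Rightarrow> 'a" where
  "grad_on S z q = (\<Sum>b\<in>Basis. dir_deriv S b z q *\<^sub>R b)"

definition hess_on :: "'a::euclidean_space set \<Rightarrow> ('a \<Rightarrow> real) \<Rightarrow> 'a \<Rightarrow> 'a \<Rightarrow> 'a" where
  "hess_on U z q h = (\<Sum>b\<in>Basis. dir_deriv U h (dir_deriv U b z) q *\<^sub>R b)"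

lemma has_derivative_grad_on:
  assumes "z differentiable_on S" "q \<in> S"
  shows "(z has_derivative (\<lambda>h. grad_on S z q \<bullet> h)) (at q within S)"
proof -
  define L where "L = frechet_derivative z (at q within S)"
  have L: "(z has_derivative L) (at q within S)"
    unfolding L_def using assms frechet_derivative_works differentiable_on_def by blast
  then have lin: "linear L" using has_derivative_linear by blast
  have "L h = grad_on S z q \<bullet> h" for h
  proof -
    have "L h = L (\<Sum>b\<in>Basis. (h \<bullet> b) *\<^sub>R b)" by (simp add: euclidean_representation)
    also have "\<dots> = (\<Sum>b\<in>Basis. (h \<bullet> b) * L b)"
      by (simp add: linear_sum[OF lin] linear_scale[OF lin])
    also have "\<dots> = grad_on S z q \<bullet> h"
      unfolding grad_on_def inner_sum_left dir_deriv_def L_def inner_scaleR_left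
      by (simp only: inner_commute[of h] mult.commute)
    finally show ?thesis .
  qed
  then have "L = (\<lambda>h. grad_on S z q \<bullet> h)" by (rule ext)
  with L show ?thesis by simp
qed

lemma Ck_on_1_grad:
  assumes "Ck_on 1 S z"
  shows "z differentiable_on S" "continuous_on S z" "continuous_on S (grad_on S z)"
proof -
  show d: "z differentiable_on S" using assms by simp
  then show "continuous_on S z" by (rule differentiable_imp_continuous_on)
  show "continuous_on S (grad_on S z)" unfolding grad_on_def[abs_def]
    using assms by (intro continuous_intros) simp
qed

lemma dir_deriv_open_subset:
  assumes "open U" "U \<subseteq> S" "q \<in> U"
  shows "dir_deriv S v z q = dir_deriv U v z q"
proof -
  have "q \<in> interior S" using assms interior_maximal by blast
  then have "at q within S = at q within U"
    using at_within_interior[of q S] at_within_open[OF assms(3,1)] by simp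
  then show ?thesis unfolding dir_deriv_def by simp
qed

lemma C2_data_Ck_on:
  assumes U: "open U" "U \<subseteq> S" and z: "Ck_on 2 U z" "Ck_on 1 S z"
  shows "C2_data U z (grad_on S z) (hess_on U z)"
  unfolding C2_data_def
proof (intro conjI ballI allI)
  have d2: "\<And>b. Ck_on 1 U (dir_deriv U b z)" using z(1) by (simp add: numeral_2_eq_2)
  fix q assume q: "q \<in> U"
  have "q \<in> interior S" using U q interior_maximal by blast
  then have "at q within S = at q" by (rule at_within_interior)
  with has_derivative_grad_on[OF Ck_on_1_grad(1)[OF z(2)], of q] q U(2)
  show "(z has_derivative (\<lambda>h. grad_on S z q \<bullet> h)) (at q)" by auto
  have "(dir_deriv U b z has_derivative (\<lambda>h. dir_deriv U h (dir_deriv U b z) q)) (at q)" for b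
  proof -
    have "dir_deriv U b z differentiable (at q within U)"
      using Ck_on_1_grad(1)[OF d2[of b]] q unfolding differentiable_on_def by blast
    then have "(dir_deriv U b z has_derivative frechet_derivative (dir_deriv U b z) (at q within U)) (at q within U)"
      by (simp add: frechet_derivative_works)
    then show ?thesis using at_within_open[OF q U(1)] by (simp add: dir_deriv_def)
  qed
  then have "((\<lambda>q. \<Sum>b\<in>Basis. dir_deriv U b z q *\<^sub>R b) has_derivative hess_on U z q) (at q)"
    unfolding hess_on_def[abs_def] by (intro has_derivative_sum has_derivative_scaleR_left)
  then show "(grad_on S z has_derivative hess_on U z q) (at q)"
    by (rule has_derivative_transform_within_open[OF _ U(1) q])
       (simp add: grad_on_def dir_deriv_open_subset[OF U])
next
  fix b
  have "\<And>e. continuous_on U (dir_deriv U b (dir_deriv U e z))" using z(1) by (simp add: numeral_2_eq_2)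
  then show "continuous_on U (\<lambda>q. hess_on U z q b)" unfolding hess_on_def
    by (intro continuous_intros)
qed

lemma C2_data_diff:
  assumes "C2_data U z1 a1 H1" "C2_data U z2 a2 H2"
  shows "C2_data U (\<lambda>q. z1 q - z2 q) (\<lambda>q. a1 q - a2 q) (\<lambda>q h. H1 q h - H2 q h)"
  unfolding C2_data_def
proof (intro conjI ballI allI)
  fix q assume q: "q \<in> U"
  have "((\<lambda>q. z1 q - z2 q) has_derivative (\<lambda>h. a1 q \<bullet> h - a2 q \<bullet> h)) (at q)"
    using assms q by (intro has_derivative_diff) (auto simp: C2_data_def)
  then show "((\<lambda>q. z1 q - z2 q) has_derivative (\<lambda>h. (a1 q - a2 q) \<bullet> h)) (at q)"
    by (simp add: inner_diff_left)
  show "((\<lambda>q. a1 q - a2 q) has_derivative (\<lambda>h. H1 q h - H2 q h)) (at q)"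
    using assms q by (intro has_derivative_diff) (auto simp: C2_data_def)
next
  fix b
  have "continuous_on U (\<lambda>q. H1 q b)" "continuous_on U (\<lambda>q. H2 q b)"
    using assms unfolding C2_data_def by blast+
  then show "continuous_on U (\<lambda>q. H1 q b - H2 q b)" by (rule continuous_on_diff)
qed

lemma wave_tr_diff: "wave_tr (\<lambda>h. L h - M h) = wave_tr L - wave_tr M"
  by (simp add: wave_tr_def refl_t_simps trace_map_diff)

lemma Basis_prod_cart:
  fixes i :: "'m::finite" and j :: "'n::finite"
  shows "(axis i (1::real), 0 :: real ^ 'n) \<in> Basis" "(0 :: real ^ 'm, axis j (1::real)) \<in> Basis"
  by (auto simp: Basis_prod_def)

lemma sum_Basis_prod_cart:
  fixes f :: "(real ^ 'm) \<times> (real ^ 'n) \<Rightarrow> 'b::comm_monoid_add"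
  shows "(\<Sum>b\<in>Basis. f b) = (\<Sum>i\<in>UNIV. f (axis i 1, 0)) + (\<Sum>j\<in>UNIV. f (0, axis j 1))"
proof -
  have "inj_on (\<lambda>u. (u, 0 :: real ^ 'n)) (Basis :: (real ^ 'm) set)" "inj_on (\<lambda>u. (0 :: real ^ 'm, u)) (Basis :: (real ^ 'n) set)"
    by (auto intro!: inj_onI)
  then have "(\<Sum>b\<in>Basis. f b) = (\<Sum>i\<in>Basis. f (i, 0)) + (\<Sum>j\<in>Basis. f (0, j))"
    unfolding Basis_prod_def by (subst sum.union_disjoint) (auto simp: sum.reindex)
  then show ?thesis by (simp add: sum_Basis_cart)
qed

lemma ultra_box_eq_wave_tr: "ultra_box U z q = wave_tr (hess_on U z q)"
proof -
  have "wave_tr (hess_on U z q) = (\<Sum>b\<in>Basis. hess_on U z q b \<bullet> refl_t b)"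
    by (simp add: wave_tr_def trace_map_def refl_t_inner)
  also have "\<dots> = (\<Sum>i\<in>UNIV. hess_on U z q (e_t i) \<bullet> (- e_t i)) + (\<Sum>j\<in>UNIV. hess_on U z q (e_x j) \<bullet> e_x j)"
    unfolding sum_Basis_prod_cart by (simp add: refl_t_def)
  also have "\<dots> = ultra_box U z q"
    by (simp only: inner_minus_right hess_on_def inner_sum_left_Basis[OF Basis_prod_cart(1)]
        inner_sum_left_Basis[OF Basis_prod_cart(2)] ultra_box_def sum_negf)
  finally show ?thesis by simp
qed

lemma inner_grad_on:
  fixes S :: "((real ^ 'm) \<times> (real ^ 'n)) set"
  shows "u \<bullet> grad_on S z q = (\<Sum>i\<in>UNIV. fst u $ i * dir_deriv S (e_t i) z q)
     + (\<Sum>j\<in>UNIV. snd u $ j * dir_deriv S (e_x j) z q)"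
proof -
  have "u \<bullet> grad_on S z q = (\<Sum>b\<in>Basis. dir_deriv S b z q * (u \<bullet> b))"
    by (simp add: grad_on_def inner_sum_right)
  also have "\<dots> = (\<Sum>i\<in>UNIV. fst u $ i * dir_deriv S (e_t i) z q)
     + (\<Sum>j\<in>UNIV. snd u $ j * dir_deriv S (e_x j) z q)"
    unfolding sum_Basis_prod_cart by (simp add: inner_prod_def inner_axis mult.commute)
  finally show ?thesis .
qed

lemma deriv_along_eq: "deriv_along U X z q = X q \<bullet> grad_on U z q"
  by (simp add: deriv_along_def inner_grad_on)

lemma normal_deriv_eq: "normal_deriv S \<nu> z q = (0, \<nu> (snd q)) \<bullet> grad_on S z q"
  by (simp add: normal_deriv_def inner_grad_on)

lemma cone_fun_eq: "cone_fun p q = cone_weight 1 0 p q / 4"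
  by (simp add: cone_fun_def cone_weight_def)

lemma normal_deriv_cone_fun:
  "normal_deriv UNIV \<nu> (cone_fun p) q = \<nu> (snd q) \<bullet> (snd q - snd p) / 2"
proof -
  have "((\<lambda>q. cone_weight 1 0 p q / 4) has_derivative (\<lambda>h. (refl_t (cone_field 1 p q) \<bullet> h) / 4)) (at q)"
    by (rule bounded_linear.has_derivative[OF bounded_linear_divide cone_weight_has_derivative])
  then have "frechet_derivative (cone_fun p) (at q) = (\<lambda>h. (refl_t (cone_field 1 p q) \<bullet> h) / 4)"
    by (intro frechet_derivative_at[symmetric]) (simp add: cone_fun_eq[abs_def])
  then have "dir_deriv UNIV v (cone_fun p) q = (refl_t (cone_field 1 p q) \<bullet> v) / 4" for v
    by (simp add: dir_deriv_def)
  then have eq: "dir_deriv UNIV (e_x j) (cone_fun p) q = (snd q - snd p) $ j / 2" for j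
    unfolding \<open>\<And>v. dir_deriv UNIV v (cone_fun p) q = _\<close>
    by (simp add: refl_t_def cone_field_def dil_t_def inner_prod_def inner_axis)
  have "normal_deriv UNIV \<nu> (cone_fun p) q = (\<Sum>j\<in>UNIV. \<nu> (snd q) $ j * ((snd q - snd p) $ j / 2))"
    unfolding normal_deriv_def eq by (rule refl)
  then show ?thesis by (simp add: inner_vec_def sum_divide_distrib)
qed



section \<open>Geometry of the cylinder and the exterior of the null cone\<close>

lemma open_time_cube: "open (time_cube T :: (real ^ 'm) set)"
  and bounded_time_cube: "bounded (time_cube T :: (real ^ 'm) set)"
proof -
  have "time_cube T = box (\<chi> i::'m. - T) (\<chi> i. T)"
    by (auto simp: time_cube_def mem_box_cart)
  then show "open (time_cube T :: (real ^ 'm) set)" "bounded (time_cube T :: (real ^ 'm) set)"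
    by (simp_all only: open_box bounded_box)
qed

text \<open>\<open>cone_ext p\<close> is open, so a point of it in the closed cylinder lies in the
  closure of the intersection. On the temporal boundary it would be a frontier point of the kind
  excluded by \<open>T_large\<close>. This makes the region of nonnegative weight compact although
  the time cube is open.\<close>

lemma T_large_cone_ext:
  fixes p :: "(real ^ 'm) \<times> (real ^ 'n)"
  assumes "T_large T \<Omega> p" "q \<in> cone_ext p" "fst q \<in> closure (time_cube T)" "snd q \<in> closure \<Omega>"
  shows "fst q \<in> time_cube T"
proof (rule ccontr)
  assume n: "fst q \<notin> time_cube T"
  have "open (cone_ext p)"
  proof -
    have "cone_ext p = (\<lambda>q. cone_weight 1 0 p q) -` {0<..}" by (auto simp: cone_ext_def cone_fun_eq)
    then show ?thesis by (simp add: open_vimage continuous_on_cone)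
  qed
  moreover have "q \<in> closure (cylinder T \<Omega>)"
    using assms(3,4) unfolding cylinder_def closure_Times by (simp add: mem_Times_iff)
  ultimately have "q \<in> closure (cone_ext p \<inter> cylinder T \<Omega>)"
    using assms(2) open_Int_closure_subset by blast
  then have cl: "q \<in> closure (cylinder T \<Omega> \<inter> cone_ext p)" by (simp add: Int_commute)
  have "q \<notin> interior (cylinder T \<Omega> \<inter> cone_ext p)"
    using n interior_subset by (fastforce simp: cylinder_def)
  then have "q \<in> frontier (cylinder T \<Omega> \<inter> cone_ext p)" using cl by (simp add: frontier_def)
  moreover have "q \<in> frontier (time_cube T) \<times> closure \<Omega>"
    using assms(3,4) n by (simp add: frontier_def interior_open[OF open_time_cube] mem_Times_iff)
  ultimately show False using assms(1) unfolding T_large_def by blast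
qed

text \<open>The choice \<open>d = (1 - c) R\<^sup>2\<close> places the region of positive weight inside the exterior of
  the null cone; these regions exhaust the exterior as \<open>c\<close> tends to 1.\<close>

lemma cone_weight_nonneg_imp_cone_ext:
  assumes "0 < c" "c < 1" "norm (snd q - snd p) < R" "0 \<le> cone_weight c ((1 - c) * R\<^sup>2) p q"
  shows "q \<in> cone_ext p"
proof -
  define x t where "x = (norm (snd q - snd p))\<^sup>2" and "t = (norm (fst q - fst p))\<^sup>2"
  have xR: "x < R\<^sup>2" unfolding x_def using assms(3) by (intro power_strict_mono) auto
  have w: "c * t \<le> x - (1 - c) * R\<^sup>2" using assms(4) by (simp add: cone_weight_def x_def t_def)
  then have "c * t < c * R\<^sup>2" using xR by (simp add: algebra_simps)
  then have "t < R\<^sup>2" using assms(1) by simp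
  then have "(1 - c) * t < (1 - c) * R\<^sup>2" using assms(2) by simp
  then have "t < x" using w by (simp add: algebra_simps)
  then show ?thesis by (simp add: cone_ext_def cone_fun_def x_def t_def)
qed

lemma cone_ext_imp_cone_weight_pos:
  assumes "q \<in> cone_ext p" "0 < R"
  shows "\<exists>c. 0 < c \<and> c < 1 \<and> 0 < cone_weight c ((1 - c) * R\<^sup>2) p q"
proof -
  define x t where "x = (norm (snd q - snd p))\<^sup>2" and "t = (norm (fst q - fst p))\<^sup>2"
  have xt: "0 < x - t" using assms(1) by (simp add: cone_ext_def cone_fun_def x_def t_def)
  \<comment> \<open>\<open>e\<close> is \<open>1 - c\<close>. Passing from the cone function to the
    weight costs \<open>e * R^2\<close>, which is kept to at most half of
    \<open>x - t\<close>.\<close>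
  define e where "e = min (1/2) ((x - t) / (2 * R\<^sup>2))"
  have e: "0 < e" "e < 1" using xt assms(2) by (auto simp: e_def)
  have "e * R\<^sup>2 \<le> (x - t) / (2 * R\<^sup>2) * R\<^sup>2" by (intro mult_right_mono) (auto simp: e_def)
  also have "\<dots> = (x - t) / 2" using assms(2) by simp
  finally have "e * R\<^sup>2 < x - t" using xt by simp
  moreover have "0 \<le> e * t" using e by (simp add: t_def)
  moreover have "cone_weight (1 - e) ((1 - (1 - e)) * R\<^sup>2) p q = (x - t) + e * t - e * R\<^sup>2"
    by (simp add: cone_weight_def x_def t_def algebra_simps)
  ultimately show ?thesis using e by (intro exI[of _ "1 - e"]) auto
qed

text \<open>Moving in time alone stays on the lateral boundary, where \<open>w\<close> vanishes, so
  the temporal part of the gradient is zero; the spatial part is normal by the slice at fixed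
  \<open>t\<close>.\<close>

lemma spatial_normal_gradient:
  fixes \<Omega> :: "(real ^ 'n) set" and a :: "(real ^ 'm) \<times> (real ^ 'n)"
  assumes "open \<Omega>" and ch: "C1_chart \<Omega> B \<rho> D" and y: "y \<in> B" "\<rho> y = 0" and t: "t \<in> time_cube T"
    and w: "(w has_derivative (\<lambda>h. a \<bullet> h)) (at (t, y) within (time_cube T \<times> closure \<Omega>))"
    and w0: "\<And>t y. t \<in> time_cube T \<Longrightarrow> y \<in> frontier \<Omega> \<Longrightarrow> w (t, y) = 0"
  obtains \<mu> where "a = \<mu> *\<^sub>R (0, D y)"
proof -
  have yf: "y \<in> frontier \<Omega>" using C1_chart_frontier[OF ch assms(1) y(1)] y(2) by simp
  then have yc: "y \<in> closure \<Omega>" by (simp add: frontier_def)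
  obtain r where r: "0 < r" "ball t r \<subseteq> time_cube T"
    using open_contains_ball open_time_cube t by blast
  \<comment> \<open>The test direction is the temporal part of \<open>a\<close> itself, for which
    \<open>a \<bullet> (\<tau>, 0)\<close> is its squared norm. The scaling of \<open>h\<close>
    keeps \<open>t + h n *\<^sub>R \<tau>\<close> in the cube however long it is.\<close>
  define \<tau> where "\<tau> = fst a"
  define h where "h n = r / (2 * (norm \<tau> + 1)) * (1 / real (Suc n))" for n
  have np: "0 < norm \<tau> + 1" by (simp add: add_nonneg_pos)
  have hpos: "0 < h n" for n using r(1) np by (simp add: h_def)
  have inT: "t + h n *\<^sub>R \<tau> \<in> time_cube T" for n
  proof -
    have "h n \<le> r / (2 * (norm \<tau> + 1)) * 1" unfolding h_def using r(1) np by (intro mult_left_mono) auto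
    then have "h n * norm \<tau> \<le> r / (2 * (norm \<tau> + 1)) * (norm \<tau> + 1)"
      using r(1) np hpos[of n] by (intro mult_mono) auto
    also have "\<dots> = r / 2" using np by (simp add: field_simps)
    finally have "h n * norm \<tau> < r" using r(1) by linarith
    then have "t + h n *\<^sub>R \<tau> \<in> ball t r" using hpos[of n] by (simp add: dist_norm)
    then show ?thesis using r(2) by blast
  qed
  have "a \<bullet> (\<tau>, 0) = 0"
  proof (rule derivative_zero_along[OF w])
    have "(\<lambda>n. 1 / real (Suc n)) \<longlonglongrightarrow> 0"
      using LIMSEQ_inverse_real_of_nat by (simp add: divide_inverse)
    then have "h \<longlonglongrightarrow> r / (2 * (norm \<tau> + 1)) * 0" unfolding h_def[abs_def] by (intro tendsto_mult tendsto_const)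
    then show "h \<longlonglongrightarrow> 0" by simp
    show "0 < h n" for n by (rule hpos)
    show "(\<lambda>n. (\<tau>, 0)) \<longlonglongrightarrow> (\<tau>, 0)" by (rule tendsto_const)
    show "(t, y) + h n *\<^sub>R (\<tau>, 0) \<in> time_cube T \<times> closure \<Omega>" for n using inT yc by simp
    show "w ((t, y) + h n *\<^sub>R (\<tau>, 0)) = w (t, y)" for n using inT yf t by (simp add: w0)
  qed
  then have fa: "fst a = 0" by (simp add: \<tau>_def inner_prod_def)
  have "((\<lambda>x. w (t, x)) has_derivative (\<lambda>k. a \<bullet> (0, k))) (at y within closure \<Omega>)"
  proof -
    have g: "((\<lambda>x. (t, x)) has_derivative (\<lambda>k. (0, k))) (at y within closure \<Omega>)"
      by (intro derivative_intros)
    have "(w has_derivative (\<lambda>h. a \<bullet> h)) (at (t, y) within (\<lambda>x. (t, x)) ` closure \<Omega>)"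
      by (rule has_derivative_subset[OF w]) (use t in auto)
    from has_derivative_in_compose[OF g this] show ?thesis .
  qed
  then have d: "((\<lambda>x. w (t, x)) has_derivative (\<lambda>k. snd a \<bullet> k)) (at y within closure \<Omega>)"
    by (simp add: inner_prod_def)
  obtain \<mu> where "snd a = \<mu> *\<^sub>R D y"
    by (rule gradient_normal_if_vanishes_on_frontier[OF ch assms(1) y d open_UNIV])
       (use yf t in \<open>auto simp: w0 frontier_def\<close>)
  then have "a = \<mu> *\<^sub>R (0, D y)" using fa by (simp add: prod_eq_iff)
  then show ?thesis by (rule that)
qed

text \<open>The points \<open>y - h *\<^sub>R D y\<close> approach \<open>y\<close> from inside
  within the slice of fixed \<open>t\<close>, and \<open>w\<close> vanishes at all of them. This is
  how an observation on a spatial neighbourhood yields the boundary observation.\<close>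

lemma inward_normal_derivative_zero:
  fixes \<Omega> :: "(real ^ 'n) set" and a :: "(real ^ 'm) \<times> (real ^ 'n)"
  assumes nu: "outward_unit_normal \<Omega> y \<nu>" and "open \<Omega>" and t: "t \<in> time_cube T" and y: "y \<in> frontier \<Omega>"
    and w: "(w has_derivative (\<lambda>h. a \<bullet> h)) (at (t, y) within (time_cube T \<times> closure \<Omega>))"
    and w0: "w (t, y) = 0" "\<And>x. x \<in> ball y \<sigma> \<inter> \<Omega> \<Longrightarrow> w (t, x) = 0" and "0 < \<sigma>"
  shows "a \<bullet> (0, \<nu>) = 0"
proof -
  obtain B \<rho> D where ch: "C1_chart \<Omega> B \<rho> D" "y \<in> B" "\<rho> y = 0" and \<nu>: "\<nu> = D y /\<^sub>R norm (D y)"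
    using outward_unit_normal_chart[OF nu] by metis
  have B: "open B" "(\<rho> has_derivative (\<lambda>h. D y \<bullet> h)) (at y)" "D y \<noteq> 0" using ch by (auto simp: C1_chart_def)
  have p: "D y \<bullet> D y > 0" using B(3) by simp
  obtain e where e: "0 < e" "\<forall>h. 0 < h \<longrightarrow> h < e \<longrightarrow> \<rho> (y - h *\<^sub>R D y) < \<rho> y"
    using gradient_direction_sign[OF B(2) p] by blast
  obtain r where r: "0 < r" "ball y r \<subseteq> B" using B(1) ch(2) open_contains_ball by blast
  define k where "k = min (e / 2) (min r \<sigma> / (2 * norm (D y)))"
  have k: "0 < k" "k < e" "k \<le> min r \<sigma> / (2 * norm (D y))" using e r B(3) \<open>0 < \<sigma>\<close> by (auto simp: k_def)
  define h where "h n = k * (1 / real (Suc n))" for n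
  have hpos: "0 < h n" for n using k by (simp add: h_def)
  have hk: "h n \<le> k" for n
  proof -
    have "h n \<le> k * 1" unfolding h_def using k by (intro mult_left_mono) auto
    then show ?thesis by simp
  qed
  have inO: "y - h n *\<^sub>R D y \<in> ball y \<sigma> \<inter> \<Omega>" for n
  proof -
    have "h n * norm (D y) \<le> min r \<sigma> / (2 * norm (D y)) * norm (D y)"
      using order_trans[OF hk k(3)] by (rule mult_right_mono) simp
    also have "\<dots> = min r \<sigma> / 2" using B(3) by simp
    also have "\<dots> < min r \<sigma>" using r(1) \<open>0 < \<sigma>\<close> by (simp add: min_def)
    finally have "norm (h n *\<^sub>R D y) < min r \<sigma>" using hpos[of n] by simp
    then have 1: "y - h n *\<^sub>R D y \<in> ball y r" "y - h n *\<^sub>R D y \<in> ball y \<sigma>"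
      unfolding mem_ball dist_norm by simp_all
    have "\<rho> (y - h n *\<^sub>R D y) < 0" using e(2) hpos[of n] hk[of n] k(2) ch(3) by fastforce
    then have "y - h n *\<^sub>R D y \<in> \<Omega>" using C1_chart_mem[OF ch(1)] 1 r(2) by blast
    then show ?thesis using 1 by blast
  qed
  have "a \<bullet> (0, - D y) = 0"
  proof (rule derivative_zero_along[OF w])
    have "(\<lambda>n. 1 / real (Suc n)) \<longlonglongrightarrow> 0"
      using LIMSEQ_inverse_real_of_nat by (simp add: divide_inverse)
    then have "h \<longlonglongrightarrow> k * 0" unfolding h_def[abs_def] by (intro tendsto_mult tendsto_const)
    then show "h \<longlonglongrightarrow> 0" by simp
    show "0 < h n" for n by (rule hpos)
    show "(\<lambda>n. (0, - D y)) \<longlonglongrightarrow> (0, - D y)" by (rule tendsto_const)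
    have eq: "(t, y) + h n *\<^sub>R (0, - D y) = (t, y - h n *\<^sub>R D y)" for n by simp
    show "(t, y) + h n *\<^sub>R (0, - D y) \<in> time_cube T \<times> closure \<Omega>" for n
      unfolding eq using inO[of n] t closure_subset by blast
    show "w ((t, y) + h n *\<^sub>R (0, - D y)) = w (t, y)" for n
      unfolding eq using w0(2)[OF inO] w0(1) by simp
  qed
  then show ?thesis by (simp add: \<nu> inner_prod_def)
qed

text \<open>In each of the three cases the observation yields that the normal derivative of the difference
  vanishes on \<open>\<Gamma>\<^sub>p\<close>; this already suffices.\<close>

theorem uniqueness_from_normal_derivative:
  fixes p :: "(real ^ 'm) \<times> (real ^ 'n)" and \<Omega> :: "(real ^ 'n) set" and T :: real
    and X :: "(real ^ 'm) \<times> (real ^ 'n) \<Rightarrow> (real ^ 'm) \<times> (real ^ 'n)"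
    and V F z1 z2 :: "(real ^ 'm) \<times> (real ^ 'n) \<Rightarrow> real"
  defines "U \<equiv> cylinder T \<Omega>" and "S \<equiv> time_cube T \<times> closure \<Omega>"
  assumes \<Omega>: "open \<Omega>" "bounded \<Omega>" and nu: "\<forall>y\<in>frontier \<Omega>. outward_unit_normal \<Omega> y (\<nu> y)"
    and T: "T_large T \<Omega> p"
    and X: "continuous_on (closure U) X" and V: "continuous_on (closure U) V"
    and z: "is_solution T \<Omega> X V F H z1" "is_solution T \<Omega> X V F H z2"
    and obs: "\<And>q. q \<in> obs_bd T \<Omega> \<nu> p \<Longrightarrow> (grad_on S z1 q - grad_on S z2 q) \<bullet> (0, \<nu> (snd q)) = 0"
    and q0: "q0 \<in> U" "q0 \<in> cone_ext p"
  shows "z1 q0 = z2 q0"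
proof -
  have U: "open U" "bounded U" "U \<subseteq> S"
    using \<Omega> closure_subset unfolding U_def S_def cylinder_def
    by (auto intro: open_Times open_time_cube bounded_Times bounded_time_cube)
  define w where "w = (\<lambda>q. z1 q - z2 q)"
  define a where "a = (\<lambda>q. grad_on S z1 q - grad_on S z2 q)"
  define h where "h = (\<lambda>q h. hess_on U z1 q h - hess_on U z2 q h)"
  have Ck: "Ck_on 2 U z1" "Ck_on 1 S z1" "Ck_on 2 U z2" "Ck_on 1 S z2"
    using z by (auto simp: is_solution_def U_def S_def)
  have C2: "C2_data U w a h"
    unfolding w_def a_def h_def by (intro C2_data_diff C2_data_Ck_on U Ck)
  have wc: "continuous_on S w" and ac: "continuous_on S a"
    unfolding w_def a_def by (intro continuous_intros Ck_on_1_grad Ck)+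
  have wd: "(w has_derivative (\<lambda>h. a q \<bullet> h)) (at q within S)" if "q \<in> S" for q
  proof -
    have "(w has_derivative (\<lambda>h. grad_on S z1 q \<bullet> h - grad_on S z2 q \<bullet> h)) (at q within S)"
      unfolding w_def by (intro has_derivative_diff has_derivative_grad_on Ck_on_1_grad Ck that)
    then show ?thesis by (simp add: a_def inner_diff_left)
  qed
  have w0: "w (t, y) = 0" if "t \<in> time_cube T" "y \<in> frontier \<Omega>" for t y
    using z that by (auto simp: is_solution_def lateral_def w_def)
  have Uc: "compact (closure U)" using U(2) by (simp add: compact_closure)
  obtain BX where BX: "0 \<le> BX" "\<forall>q\<in>closure U. norm (X q) \<le> BX" using compact_bound[OF Uc X] by blast
  obtain BV where BV: "0 \<le> BV" "\<forall>q\<in>closure U. norm (V q) \<le> BV" using compact_bound[OF Uc V] by blast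
  have box: "\<bar>wave_tr (h q)\<bar> \<le> (BX + BV) * (norm (a q) + \<bar>w q\<bar>)" if q: "q \<in> U" for q
  proof -
    have gU: "grad_on U f q = grad_on S f q" for f
      by (simp add: grad_on_def dir_deriv_open_subset[OF U(1,3) q])
    have "wave_tr (hess_on U z1 q) + X q \<bullet> grad_on S z1 q + V q * z1 q = F q"
      "wave_tr (hess_on U z2 q) + X q \<bullet> grad_on S z2 q + V q * z2 q = F q"
      unfolding gU[symmetric] using z q
      by (simp_all add: is_solution_def U_def[symmetric] ultra_box_eq_wave_tr deriv_along_eq)
    then have "wave_tr (h q) = - (X q \<bullet> a q) - V q * w q"
      by (simp add: h_def wave_tr_diff a_def w_def inner_diff_right algebra_simps)
    then have "\<bar>wave_tr (h q)\<bar> \<le> \<bar>X q \<bullet> a q\<bar> + \<bar>V q * w q\<bar>" by linarith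
    also have "\<dots> \<le> norm (X q) * norm (a q) + \<bar>V q\<bar> * \<bar>w q\<bar>"
      by (intro add_mono Cauchy_Schwarz_ineq2) (simp add: abs_mult)
    also have "\<dots> \<le> (BX + BV) * norm (a q) + (BX + BV) * \<bar>w q\<bar>"
    proof -
      have "q \<in> closure U" using q closure_subset by blast
      then have "norm (X q) \<le> BX + BV" "\<bar>V q\<bar> \<le> BX + BV" using BX BV by fastforce+
      then show ?thesis by (intro add_mono mult_right_mono) auto
    qed
    finally show ?thesis by (simp add: distrib_left)
  qed
  obtain R where R: "0 < R" "\<And>x. x \<in> closure \<Omega> \<Longrightarrow> norm (x - snd p) < R"
  proof -
    have "bounded (closure \<Omega>)" using \<Omega>(2) by (rule bounded_closure)
    then obtain B where B: "\<And>x. x \<in> closure \<Omega> \<Longrightarrow> norm x \<le> B" by (auto simp: bounded_iff)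
    have "norm (x - snd p) < \<bar>B\<bar> + norm (snd p) + 1" if "x \<in> closure \<Omega>" for x
      using B[OF that] norm_triangle_ineq4[of x "snd p"] by linarith
    then show ?thesis by (intro that[of "\<bar>B\<bar> + norm (snd p) + 1"]) (auto simp: add_nonneg_pos)
  qed
  obtain c where c: "0 < c" "c < 1" and pos0: "0 < cone_weight c ((1 - c) * R\<^sup>2) p q0"
    using cone_ext_imp_cone_weight_pos[OF q0(2) R(1)] by blast
  define d where "d = (1 - c) * R\<^sup>2"
  have d: "0 < d" using c R by (simp add: d_def)
  have ext: "q \<in> cone_ext p" if "snd q \<in> closure \<Omega>" "0 \<le> cone_weight c d p q" for q
    using cone_weight_nonneg_imp_cone_ext[OF c R(2)[OF that(1)]] that(2) by (simp add: d_def)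
  \<comment> \<open>\<open>S\<close> omits the temporal ends, but no point of nonnegative weight
    lies there, so the closed time cube gives the same set.\<close>
  have K: "compact {q \<in> S. 0 \<le> cone_weight c d p q}"
  proof -
    have "{q \<in> S. 0 \<le> cone_weight c d p q} =
        (closure (time_cube T) \<times> closure \<Omega>) \<inter> {q. 0 \<le> cone_weight c d p q}"
      using T_large_cone_ext[OF T ext] closure_subset by (fastforce simp: S_def)
    moreover have "compact (closure (time_cube T :: (real ^ 'm) set) \<times> closure \<Omega>)"
      using bounded_time_cube \<Omega>(2) by (intro compact_Times) (simp_all add: compact_closure)
    moreover have "closed {q. 0 \<le> cone_weight c d p q}"
      by (intro closed_Collect_le continuous_on_const continuous_on_cone)
    ultimately show ?thesis by (simp add: compact_Int_closed)
  qed
  have "w q0 = 0"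
  proof (rule carleman_uniqueness[OF U c d C2 wc ac K])
    show "\<bar>wave_tr (h q)\<bar> \<le> (BX + BV) * (norm (a q) + \<bar>w q\<bar>)" if "q \<in> U" for q
      using box[OF that] .
    show "q0 \<in> U" "0 < cone_weight c d p q0" using q0 pos0 by (simp_all add: d_def)
  next
    fix q assume q: "q \<in> S" "0 \<le> cone_weight c d p q"
    obtain t x where tx: "q = (t, x)" "t \<in> time_cube T" "x \<in> closure \<Omega>" using q(1) by (auto simp: S_def)
    show "\<exists>r \<rho> D e. 0 < r \<and>
      (\<forall>x\<in>ball q r. (\<rho> has_derivative (\<lambda>h. D x \<bullet> h)) (at x)) \<and> continuous_on (ball q r) D \<and>
      U \<inter> ball q r = {x \<in> ball q r. \<rho> x < 0} \<and> {x \<in> ball q r. \<rho> x \<le> 0} \<subseteq> S \<and>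
      (\<forall>x\<in>ball q r. \<rho> x = 0 \<longrightarrow> D x \<bullet> e > 0 \<and> fst (D x) = 0 \<and>
        (0 < cone_weight c d p x \<longrightarrow> w x = 0 \<and> (\<exists>\<mu>. a x = \<mu> *\<^sub>R D x \<and> \<mu>\<^sup>2 * (D x \<bullet> cone_field c p x) \<le> 0)))"
    proof (cases "x \<in> \<Omega>")
      case True
      then have "q \<in> U" using tx by (simp add: U_def cylinder_def)
      then obtain r where "0 < r" "ball q r \<subseteq> U" using U(1) open_contains_ball by blast
      \<comment> \<open>Interior point: a ball inside \<open>U\<close> with constant
        \<open>\<rho> = -1\<close>, so that the boundary conditions are void.\<close>
      then show ?thesis
        using U(3) by (intro exI[of _ r] exI[of _ "\<lambda>_. -1"] exI[of _ "\<lambda>_. 0"] exI[of _ 0]) auto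
    next
      case False
      then have xf: "x \<in> frontier \<Omega>" using tx(3) \<Omega>(1) by (simp add: frontier_def interior_open)
      obtain B \<rho> D where ch: "C1_chart \<Omega> B \<rho> D" "x \<in> B"
        using outward_unit_normal_chart nu xf by metis
      have B: "open B" "\<And>y. y \<in> B \<Longrightarrow> (\<rho> has_derivative (\<lambda>h. D y \<bullet> h)) (at y)" "D x \<noteq> 0" "continuous_on B D"
        "\<And>y. y \<in> B \<Longrightarrow> D y \<noteq> 0"
        using ch by (auto simp: C1_chart_def)
      \<comment> \<open>Shrinks the chart until all gradients have positive inner product with
        \<open>D x\<close>, which provides the constant outward vector
        \<open>(0, D x)\<close>.\<close>
      define B' where "B' = B \<inter> (\<lambda>y. D y \<bullet> D x) -` {0<..}"
      have "open B'" unfolding B'_def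
        by (rule continuous_open_preimage[OF _ B(1) open_greaterThan]) (intro continuous_on_inner B(4) continuous_on_const)
      then have "open (time_cube T \<times> B')" by (intro open_Times open_time_cube)
      moreover have "q \<in> time_cube T \<times> B'" using tx ch(2) B(3) by (simp add: B'_def)
      ultimately obtain r where r: "0 < r" "ball q r \<subseteq> time_cube T \<times> B'" using open_contains_ball by blast
      have inb: "fst z \<in> time_cube T" "snd z \<in> B" "D (snd z) \<bullet> D x > 0" if "z \<in> ball q r" for z
        using subsetD[OF r(2) that] by (auto simp: B'_def)
      have 1: "((\<lambda>z. \<rho> (snd z)) has_derivative (\<lambda>h. (0, D (snd z)) \<bullet> h)) (at z)" if "z \<in> ball q r" for z
      proof -
        have "((\<lambda>z. \<rho> (snd z)) has_derivative (\<lambda>h. D (snd z) \<bullet> snd h)) (at z)"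
          by (rule has_derivative_compose[where f = snd and g = \<rho>, OF _ B(2)[OF inb(2)[OF that]]])
             (intro derivative_intros)
        then show ?thesis by (simp add: inner_prod_def)
      qed
      have 2: "continuous_on (ball q r) (\<lambda>z. (0, D (snd z)))"
        by (intro continuous_on_Pair continuous_on_const continuous_on_compose2[OF B(4)] continuous_on_snd continuous_on_id)
           (use inb(2) in blast)
      have 3: "U \<inter> ball q r = {z \<in> ball q r. \<rho> (snd z) < 0}"
      proof -
        have "z \<in> U \<longleftrightarrow> \<rho> (snd z) < 0" if "z \<in> ball q r" for z
          using inb[OF that] C1_chart_mem[OF ch(1)] by (simp add: U_def cylinder_def mem_Times_iff)
        then show ?thesis by blast
      qed
      have 4: "{z \<in> ball q r. \<rho> (snd z) \<le> 0} \<subseteq> S"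
      proof clarify
        fix t y assume z: "(t, y) \<in> ball q r" "\<rho> (snd (t, y)) \<le> 0"
        then have "y \<in> \<Omega> \<or> y \<in> frontier \<Omega>"
          using C1_chart_mem[OF ch(1)] C1_chart_frontier[OF ch(1) \<Omega>(1)] inb(2)[OF z(1)] by fastforce
        then show "(t, y) \<in> S" using inb(1)[OF z(1)] closure_subset by (auto simp: S_def frontier_def)
      qed
      have 5: "w z = 0 \<and> (\<exists>\<mu>. a z = \<mu> *\<^sub>R (0, D (snd z)) \<and> \<mu>\<^sup>2 * ((0, D (snd z)) \<bullet> cone_field c p z) \<le> 0)"
        if z: "z \<in> ball q r" "\<rho> (snd z) = 0" and pos: "0 < cone_weight c d p z" for z
      proof -
        obtain t' y where ty: "z = (t', y)" by (cases z)
        have tT: "t' \<in> time_cube T" and yB: "y \<in> B" and \<rho>y: "\<rho> y = 0" using inb[OF z(1)] z ty by auto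
        have yf: "y \<in> frontier \<Omega>" using C1_chart_frontier[OF ch(1) \<Omega>(1) yB] \<rho>y by simp
        then have yc: "y \<in> closure \<Omega>" by (simp add: frontier_def)
        have wz: "w z = 0" using w0 tT yf ty by simp
        have "(t', y) \<in> S" using tT yc by (simp add: S_def)
        from spatial_normal_gradient[OF \<Omega>(1) ch(1) yB \<rho>y tT wd[OF this, unfolded S_def] w0]
        obtain \<mu> where \<mu>: "a (t', y) = \<mu> *\<^sub>R (0, D y)" by blast
        have Y: "(0, D y) \<bullet> cone_field c p z = 2 * (D y \<bullet> (y - snd p))"
          by (simp add: ty cone_field_def dil_t_def inner_prod_def)
        \<comment> \<open>Either the geometric factor already has the right sign, or the point
          belongs to \<open>obs_bd\<close>: positive weight puts it into \<open>cone_ext p\<close>.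
          In that case the observation forces \<open>\<mu> = 0\<close>.\<close>
        have "\<mu>\<^sup>2 * (D y \<bullet> (y - snd p)) \<le> 0"
        proof (cases "D y \<bullet> (y - snd p) \<le> 0")
          case True
          then show ?thesis by (intro mult_nonneg_nonpos) auto
        next
          case False
          have Dn: "D y = norm (D y) *\<^sub>R \<nu> y"
            using outward_unit_normal_unique[OF \<Omega>(1) _ ch(1) yB \<rho>y] nu yf by blast
          have Dp: "0 < norm (D y)" using B(5)[OF yB] by simp
          have "D y \<bullet> (y - snd p) = norm (D y) * (\<nu> y \<bullet> (y - snd p))" by (subst Dn) simp
          then have "0 < norm (D y) * (\<nu> y \<bullet> (y - snd p))" using False by linarith
          then have "\<nu> y \<bullet> (y - snd p) > 0" using Dp by (simp add: zero_less_mult_iff)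
          then have "normal_deriv UNIV \<nu> (cone_fun p) (t', y) > 0" by (simp add: normal_deriv_cone_fun)
          moreover have "(t', y) \<in> cone_ext p" using ext[of z] yc pos ty by simp
          ultimately have "(t', y) \<in> obs_bd T \<Omega> \<nu> p" using tT yf by (simp add: obs_bd_def lateral_def)
          from obs[OF this] have "\<mu> *\<^sub>R (0, D y) \<bullet> (0, \<nu> y) = 0"
            unfolding \<mu>[unfolded a_def] by simp
          then have "\<mu> * (D y \<bullet> \<nu> y) = 0" by (simp add: inner_prod_def)
          then have "norm (D y) * (\<mu> * (D y \<bullet> \<nu> y)) = 0" by simp
          moreover have "D y \<bullet> D y = norm (D y) * (D y \<bullet> \<nu> y)" by (subst (2) Dn) simp
          ultimately have "\<mu> * (D y \<bullet> D y) = 0" by (simp add: mult.left_commute)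
          then have "\<mu> = 0" using Dp by simp
          then show ?thesis by simp
        qed
        then show ?thesis using wz \<mu> Y ty by auto
      qed
      have 6: "\<forall>z\<in>ball q r. \<rho> (snd z) = 0 \<longrightarrow> (0, D (snd z)) \<bullet> (0 :: real ^ 'm, D x) > 0 \<and>
        fst (0 :: real ^ 'm, D (snd z)) = 0 \<and> (0 < cone_weight c d p z \<longrightarrow> w z = 0 \<and>
        (\<exists>\<mu>. a z = \<mu> *\<^sub>R (0, D (snd z)) \<and> \<mu>\<^sup>2 * ((0, D (snd z)) \<bullet> cone_field c p z) \<le> 0))"
      proof (intro ballI impI conjI)
        fix z assume z: "z \<in> ball q r" "\<rho> (snd z) = 0"
        show "(0, D (snd z)) \<bullet> (0 :: real ^ 'm, D x) > 0" using inb(3)[OF z(1)] by (simp add: inner_prod_def)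
        show "fst (0 :: real ^ 'm, D (snd z)) = 0" by simp
        assume "0 < cone_weight c d p z"
        from 5[OF z this] show "w z = 0"
          "\<exists>\<mu>. a z = \<mu> *\<^sub>R (0, D (snd z)) \<and> \<mu>\<^sup>2 * ((0, D (snd z)) \<bullet> cone_field c p z) \<le> 0" by blast+
      qed
      show ?thesis
      proof (rule exI[of _ r], rule exI[of _ "\<lambda>z. \<rho> (snd z)"], rule exI[of _ "\<lambda>z. (0, D (snd z))"],
          rule exI[of _ "(0, D x)"], intro conjI)
        show "\<forall>z\<in>ball q r. ((\<lambda>z. \<rho> (snd z)) has_derivative (\<lambda>h. (0, D (snd z)) \<bullet> h)) (at z)"
          using 1 by blast
      qed (fact r(1) 2 3 4 6)+
    qed
  qed
  then show ?thesis by (simp add: w_def)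
qed

theorem theorem1p4:
  fixes p :: "(real ^ 'm) \<times> (real ^ 'n)"
    and \<Omega> :: "(real ^ 'n) set"
    and \<nu> :: "real ^ 'n \<Rightarrow> real ^ 'n"
    and T \<sigma> :: real
    and X :: "(real ^ 'm) \<times> (real ^ 'n) \<Rightarrow> (real ^ 'm) \<times> (real ^ 'n)"
    and V F z1 z2 :: "(real ^ 'm) \<times> (real ^ 'n) \<Rightarrow> real"
    and H :: "real ^ 'm \<Rightarrow> real"
    and \<Theta> W :: "((real ^ 'm) \<times> (real ^ 'n)) set"
  assumes "\<Omega> \<noteq> {}" and "open \<Omega>" and "bounded \<Omega>"
    and "\<forall>y\<in>frontier \<Omega>. outward_unit_normal \<Omega> y (\<nu> y)"
    and "T > 0" and "T_large T \<Omega> p"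
    and "smooth_on (closure (cylinder T \<Omega>)) X"
    and "\<forall>q\<in>cylinder T \<Omega> \<inter> cone_bd p. X q = 0"
    and "smooth_on (closure (cylinder T \<Omega>)) V"
    and "smooth_on (closure (cylinder T \<Omega>)) F"
    and "smooth_on (closure (time_cube T)) H"
    and "nbhd_in (lateral T \<Omega>) (closure (obs_bd T \<Omega> \<nu> p)) \<Theta>"
    and "\<sigma> > 0"
    and "W \<subseteq> cylinder T \<Omega>"
    and "closure (space_nbhd \<sigma> (obs_bd T \<Omega> \<nu> p)) \<inter> cylinder T \<Omega> \<subseteq> W"
    and "is_solution T \<Omega> X V F H z1"
    and "is_solution T \<Omega> X V F H z2"
  shows
    "((\<forall>q\<in>\<Theta>. normal_deriv (time_cube T \<times> closure \<Omega>) \<nu> z1 q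
            = normal_deriv (time_cube T \<times> closure \<Omega>) \<nu> z2 q)
        \<longrightarrow> (\<forall>q\<in>cylinder T \<Omega> \<inter> cone_ext p. z1 q = z2 q))
     \<and> ((\<forall>q\<in>W. (z1 q, grad_t (cylinder T \<Omega>) z1 q) = (z2 q, grad_t (cylinder T \<Omega>) z2 q))
        \<longrightarrow> (\<forall>q\<in>cylinder T \<Omega> \<inter> cone_ext p. z1 q = z2 q))
     \<and> ((\<forall>q\<in>W. (z1 q, grad_x (cylinder T \<Omega>) z1 q) = (z2 q, grad_x (cylinder T \<Omega>) z2 q))
        \<longrightarrow> (\<forall>q\<in>cylinder T \<Omega> \<inter> cone_ext p. z1 q = z2 q))"
proof -
  let ?U = "cylinder T \<Omega> :: ((real ^ 'm) \<times> (real ^ 'n)) set" and ?S = "time_cube T \<times> closure \<Omega> :: ((real ^ 'm) \<times> (real ^ 'n)) set"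
  let ?obs = "\<forall>q\<in>obs_bd T \<Omega> \<nu> p. (grad_on ?S z1 q - grad_on ?S z2 q) \<bullet> (0, \<nu> (snd q)) = 0"
  have X: "continuous_on (closure ?U) X" and V: "continuous_on (closure ?U) V"
    using assms(7,9) unfolding smooth_on_def by (metis Ck_on.simps(1))+
  have main: "\<forall>q\<in>?U \<inter> cone_ext p. z1 q = z2 q" if ?obs
    using uniqueness_from_normal_derivative[OF assms(2,3,4,6) X V assms(16,17)] that by blast
  have \<Gamma>: "fst q \<in> time_cube T" "snd q \<in> frontier \<Omega>" if "q \<in> obs_bd T \<Omega> \<nu> p" for q
    using that by (auto simp: obs_bd_def lateral_def)
  have case1: ?obs if eq: "\<forall>q\<in>\<Theta>. normal_deriv ?S \<nu> z1 q = normal_deriv ?S \<nu> z2 q"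
  proof
    fix q assume q: "q \<in> obs_bd T \<Omega> \<nu> p"
    then have "q \<in> closure (obs_bd T \<Omega> \<nu> p)" using closure_subset by blast
    then have "q \<in> \<Theta>" using assms(12) unfolding nbhd_in_def by blast
    then have "normal_deriv ?S \<nu> z1 q = normal_deriv ?S \<nu> z2 q" using eq by blast
    then show "(grad_on ?S z1 q - grad_on ?S z2 q) \<bullet> (0, \<nu> (snd q)) = 0"
      by (simp add: normal_deriv_eq inner_diff_right inner_commute[of _ "(0, \<nu> (snd q))"])
  qed
  \<comment> \<open>Common to cases (2) and (3): each point of \<open>obs_bd\<close> is approached
    along the inner normal, at fixed time, through points of \<open>W\<close>.\<close>
  have case23: ?obs if eq: "\<forall>q\<in>W. z1 q = z2 q"
  proof
    fix q assume q: "q \<in> obs_bd T \<Omega> \<nu> p"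
    obtain t y where ty: "q = (t, y)" by (cases q)
    have t: "t \<in> time_cube T" and y: "y \<in> frontier \<Omega>" using \<Gamma>[OF q] ty by auto
    have C1: "Ck_on 1 ?S z1" "Ck_on 1 ?S z2" using assms(16,17) by (simp_all add: is_solution_def)
    have "q \<in> ?S" using t y ty by (simp add: frontier_def)
    then have "((\<lambda>q. z1 q - z2 q) has_derivative (\<lambda>h. grad_on ?S z1 q \<bullet> h - grad_on ?S z2 q \<bullet> h)) (at q within ?S)"
      by (intro has_derivative_diff has_derivative_grad_on Ck_on_1_grad C1)
    then have d: "((\<lambda>q. z1 q - z2 q) has_derivative (\<lambda>h. (grad_on ?S z1 q - grad_on ?S z2 q) \<bullet> h)) (at (t, y) within ?S)"
      by (simp add: inner_diff_left ty)
    have "(grad_on ?S z1 q - grad_on ?S z2 q) \<bullet> (0, \<nu> y) = 0"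
    proof (rule inward_normal_derivative_zero[OF _ assms(2) t y d _ _ assms(13)])
      show "outward_unit_normal \<Omega> y (\<nu> y)" using assms(4) y by blast
      show "z1 (t, y) - z2 (t, y) = 0"
        using assms(16,17) t y by (auto simp: is_solution_def lateral_def)
      fix x assume x: "x \<in> ball y \<sigma> \<inter> \<Omega>"
      then have "(t, x) \<in> space_nbhd \<sigma> (obs_bd T \<Omega> \<nu> p)"
        using q ty by (auto simp: space_nbhd_def)
      then have "(t, x) \<in> closure (space_nbhd \<sigma> (obs_bd T \<Omega> \<nu> p)) \<inter> ?U"
        using x t closure_subset by (auto simp: cylinder_def)
      then have "(t, x) \<in> W" using assms(15) by blast
      then show "z1 (t, x) - z2 (t, x) = 0" using eq by simp
    qed
    then show "(grad_on ?S z1 q - grad_on ?S z2 q) \<bullet> (0, \<nu> (snd q)) = 0" by (simp add: ty)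
  qed
  show ?thesis
    using main case1 case23 by (metis (no_types, lifting) prod.inject)
qed

end
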